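(* Let $\mathcal L=\text{nmod-}\mathcal M$ or $\text{mod-}\Lambda$ and let $Z_\bullet$ be a nonlinear stability function for $\mathcal L$. Then $Z_\bullet$ is generic, resp. green, if and only if the corresponding path $\gamma_Z$ is a reddening path, resp. a green path. Conversely, for any reddening path $\gamma$ for $\mathcal L$ there is a nonlinear stability function $Z_\bullet$ for $\mathcal L$ so that, for all nonzero $M\in\mathcal L$ and all $t\in\mathbb R$, $\gamma(t)\in D(M)$ if and only if $(M,t)$ is a $Z_\bullet$-semistable pair, equivalently, if and only if $\gamma_Z(t)\in D(M)$.
   Context: Let $K$ be a field. $\mathcal L$ is either (i) $\text{mod-}\Lambda$, the category of finite dimensional right modules over a finite dimensional $K$-algebra $\Lambda$, or (ii) $\text{nmod-}\mathcal M$, where $\mathcal M=(\{F_i\}_{i=1}^n,\{M_{ij}\})$ is a modulated quiver over $K$ (the $F_i$ are finite dimensional division algebras over $K$, the $M_{ij}$ finite dimensional $F_i$-$F_j$-bimodules), $T\mathcal M=\coprod_{k\ge0}T_k\mathcal M$ is its tensor algebra ($T_0\mathcal M=\prod F_i$, $T_k\mathcal M=\coprod M_{j_0j_1}\otimes_{F_{j_1}}\cdots\otimes_{F_{j_{k-1}}} M_{j_{k-1}j_k}$ for $k\ge1$), and $\text{nmod-}\mathcal M$ is the category of finitely generated right $T\mathcal M$-modules on which the ideal $R\mathcal M=\coprod_{k\ge1}T_k\mathcal M$ acts nilpotently. $\mathcal L$ has $n$ simple objects $S_1,\dots,S_n$; $\underline{\dim}\,M\in\mathbb N^n$ records the multiplicities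 of the $S_i$ in a composition series of $M$, and the Grothendieck group $K_0\mathcal L$ is identified with $\mathbb Z^n$ via $[M]\mapsto\underline{\dim}\,M$. For $M\in\mathcal L$ nonzero: $H(M)=\{x\in\mathbb R^n:x\cdot\underline{\dim}\,M=0\}$, and the semistability set of $M$ is $D(M)=\{x\in H(M):x\cdot\underline{\dim}\,M'\le0\text{ for all }M'\subseteq M\}$. A nonlinear stability function for $\mathcal L$ is a $C^1$ family of additive maps $Z_t:K_0\mathcal L\cong\mathbb Z^n\to\mathbb C$, $t\in\mathbb R$, $Z_t(x)=a_t\cdot x+\sqrt{-1}\,b_t\cdot x$ with $a_t\in\mathbb R^n$, $b_t\in(0,\infty)^n$, such that $a_t,b_t$ have velocity $0$ for $|t|$ large. For nonzero $M$, $\mu_t(M)=\frac{a_t\cdot\underline{\dim}\,M}{b_t\cdot\underline{\dim}\,M}$. A nonzero $M$ is $Z_t$-semistable if $\mu_t(M')\ge\mu_t(M)$ for all nonzero $M'\subsetneq M$. $(M,t_0)$ is a $Z_\bullet$-semistable pair if $M$ is $Z_{t_0}$-semistable and $\mu_{t_0}(M)=t_0$; the pair is green (resp. red) if $\frac{d}{dt}\mu_t(M)|_{t=t_0}$ is $<1$ (resp. $>1$), and generic if it is green or red. $Z_\bullet$ is green (resp. generic) if all $Z_\bullet$-semistable pairs are green (resp. generic). The corresponding path $\gamma_Z:\mathbb R\to\mathbb R^n$ is $\gamma_Z(t)=t\,b_t-a_t$. A reddening path for $\mathcal L$ is a $C^1$ path $\gamma:\mathbb R\to\mathbb R^n$ such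 that (1) all coordinates of $\gamma(t)$ are negative for $t\ll0$ and positive for $t\gg0$; (2) whenever $\gamma$ crosses a semistability set $D(M)$ for $M\in\mathcal L$, the crossing is transverse, i.e., $D(M)$ has codimension $1$ and the curve $\gamma$ is not tangent to the hyperplane $H(M)$. A crossing of $D(M)$ at $t=t_0$ is green if $\gamma'(t_0)\cdot\underline{\dim}\,M>0$. A reddening path is a green path if all crossings are green.
   Formalization: For "generic/green iff reddening/green path", the clause that D(M) has codimension 1 is dropped from the path, or else added as a condition beside generic/green; as stated it fails for n≥2, a_t=0, b_t=(1,…,1), where γ_Z meets D(S_1⊕S_2), of codimension 2. *)

theory Defs
  imports "HOL-Analysis.Analysis" "HOL-Algebra.AbelCoset" "HOL-Algebra.Module"
    "HOL-Algebra.Free_Abelian_Groups"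
begin

definition spanned_over ::
    "'c set \<Rightarrow> ('v \<Rightarrow> 'c \<Rightarrow> 'v) \<Rightarrow> ('v, 'x) ring_scheme \<Rightarrow> bool" where
  "spanned_over C f V \<longleftrightarrow>
     (\<exists>B. finite B \<and> B \<subseteq> carrier V \<and>
        (\<forall>v\<in>carrier V. \<exists>c. (\<forall>b\<in>B. c b \<in> C) \<and> v = (\<Oplus>\<^bsub>V\<^esub>b\<in>B. f b (c b))))"

text \<open>
  The locale \<open>algebra\<close> of HOL-Algebra is restricted to commutative algebras.
\<close>

definition fd_algebra :: "'k ring \<Rightarrow> ('k, 'a) module \<Rightarrow> bool" where
  "fd_algebra K A \<longleftrightarrow>
     field K \<and> ring A \<and> Module.module K A \<and>
     (\<forall>k\<in>carrier K. \<forall>x\<in>carrier A. \<forall>y\<in>carrier A.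
        (k \<odot>\<^bsub>A\<^esub> x) \<otimes>\<^bsub>A\<^esub> y = k \<odot>\<^bsub>A\<^esub> (x \<otimes>\<^bsub>A\<^esub> y) \<and>
        x \<otimes>\<^bsub>A\<^esub> (k \<odot>\<^bsub>A\<^esub> y) = k \<odot>\<^bsub>A\<^esub> (x \<otimes>\<^bsub>A\<^esub> y)) \<and>
     spanned_over (carrier K) (\<lambda>b k. k \<odot>\<^bsub>A\<^esub> b) A"

definition fd_division_algebra :: "'k ring \<Rightarrow> ('k, 'a) module \<Rightarrow> bool" where
  "fd_division_algebra K A \<longleftrightarrow>
     fd_algebra K A \<and> \<one>\<^bsub>A\<^esub> \<noteq> \<zero>\<^bsub>A\<^esub> \<and> Units A = carrier A - {\<zero>\<^bsub>A\<^esub>}"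

text \<open>
  As for the HOL-Algebra record \<open>module\<close>, only the additive part of the underlying \<open>ring\<close>
  record of a right module or a bimodule is used.
\<close>

record ('a, 'm) rmodule = "'m ring" +
  ract :: "'m \<Rightarrow> 'a \<Rightarrow> 'm"

definition right_module :: "('a, 'x) ring_scheme \<Rightarrow> ('a, 'm) rmodule \<Rightarrow> bool" where
  "right_module A V \<longleftrightarrow>
     abelian_group V \<and>
     (\<forall>v\<in>carrier V. \<forall>a\<in>carrier A. ract V v a \<in> carrier V) \<and>
     (\<forall>v\<in>carrier V. \<forall>w\<in>carrier V. \<forall>a\<in>carrier A.
        ract V (v \<oplus>\<^bsub>V\<^esub> w) a = ract V v a \<oplus>\<^bsub>V\<^esub> ract V w a) \<and>
     (\<forall>v\<in>carrier V. \<forall>a\<in>carrier A. \<forall>b\<in>carrier A.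
        ract V v (a \<oplus>\<^bsub>A\<^esub> b) = ract V v a \<oplus>\<^bsub>V\<^esub> ract V v b \<and>
        ract V v (a \<otimes>\<^bsub>A\<^esub> b) = ract V (ract V v a) b) \<and>
     (\<forall>v\<in>carrier V. ract V v \<one>\<^bsub>A\<^esub> = v)"

record ('f, 'b) bimodule = "'b ring" +
  bleft :: "'f \<Rightarrow> 'b \<Rightarrow> 'b"
  bright :: "'b \<Rightarrow> 'f \<Rightarrow> 'b"

text \<open>
  Bimodules over \<open>K\<close>-algebras: the two induced actions of \<open>K\<close> are required to agree, and the
  dimension is taken with respect to this common action.
\<close>

definition fd_bimodule ::
    "'k ring \<Rightarrow> ('k, 'f) module \<Rightarrow> ('k, 'f) module \<Rightarrow> ('f, 'b) bimodule \<Rightarrow> bool" where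
  "fd_bimodule K F G M \<longleftrightarrow>
     abelian_group M \<and>
     (\<forall>f\<in>carrier F. \<forall>m\<in>carrier M. bleft M f m \<in> carrier M) \<and>
     (\<forall>m\<in>carrier M. \<forall>g\<in>carrier G. bright M m g \<in> carrier M) \<and>
     (\<forall>f\<in>carrier F. \<forall>m\<in>carrier M. \<forall>m'\<in>carrier M.
        bleft M f (m \<oplus>\<^bsub>M\<^esub> m') = bleft M f m \<oplus>\<^bsub>M\<^esub> bleft M f m') \<and>
     (\<forall>f\<in>carrier F. \<forall>f'\<in>carrier F. \<forall>m\<in>carrier M.
        bleft M (f \<oplus>\<^bsub>F\<^esub> f') m = bleft M f m \<oplus>\<^bsub>M\<^esub> bleft M f' m \<and>
        bleft M (f \<otimes>\<^bsub>F\<^esub> f') m = bleft M f (bleft M f' m)) \<and>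
     (\<forall>m\<in>carrier M. bleft M \<one>\<^bsub>F\<^esub> m = m) \<and>
     (\<forall>m\<in>carrier M. \<forall>m'\<in>carrier M. \<forall>g\<in>carrier G.
        bright M (m \<oplus>\<^bsub>M\<^esub> m') g = bright M m g \<oplus>\<^bsub>M\<^esub> bright M m' g) \<and>
     (\<forall>m\<in>carrier M. \<forall>g\<in>carrier G. \<forall>g'\<in>carrier G.
        bright M m (g \<oplus>\<^bsub>G\<^esub> g') = bright M m g \<oplus>\<^bsub>M\<^esub> bright M m g' \<and>
        bright M m (g \<otimes>\<^bsub>G\<^esub> g') = bright M (bright M m g) g') \<and>
     (\<forall>m\<in>carrier M. bright M m \<one>\<^bsub>G\<^esub> = m) \<and>
     (\<forall>f\<in>carrier F. \<forall>m\<in>carrier M. \<forall>g\<in>carrier G.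
        bright M (bleft M f m) g = bleft M f (bright M m g)) \<and>
     (\<forall>k\<in>carrier K. \<forall>m\<in>carrier M.
        bleft M (k \<odot>\<^bsub>F\<^esub> \<one>\<^bsub>F\<^esub>) m = bright M m (k \<odot>\<^bsub>G\<^esub> \<one>\<^bsub>G\<^esub>)) \<and>
     spanned_over (carrier K) (\<lambda>b k. bleft M (k \<odot>\<^bsub>F\<^esub> \<one>\<^bsub>F\<^esub>) b) M"

text \<open>The vertices of the quiver are the elements of the finite type \<open>'n\<close>.\<close>

definition modulated_quiver ::
    "'k ring \<Rightarrow> ('n::finite \<Rightarrow> ('k, 'f) module) \<Rightarrow> ('n \<Rightarrow> 'n \<Rightarrow> ('f, 'b) bimodule) \<Rightarrow> bool" where
  "modulated_quiver K F M \<longleftrightarrow>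
     field K \<and> (\<forall>i. fd_division_algebra K (F i)) \<and> (\<forall>i j. fd_bimodule K (F i) (F j) (M i j))"

text \<open>
  The list \<open>[(j\<^sub>0, m\<^sub>1, j\<^sub>1), \<dots>, (j\<^sub>k\<^sub>-\<^sub>1, m\<^sub>k, j\<^sub>k)]\<close> with \<open>m\<^sub>l\<close> in the bimodule from \<open>j\<^sub>l\<^sub>-\<^sub>1\<close> to \<open>j\<^sub>l\<close>
  stands for the tensor \<open>m\<^sub>1 \<otimes> \<dots> \<otimes> m\<^sub>k\<close>. The free abelian group on these lists, modulo
  additivity in each factor and balancedness over the division algebras at the inner vertices,
  is the direct sum of the components of degree \<open>k \<ge> 1\<close> of the tensor algebra: no relation mixes
  different vertex sequences.
\<close>

type_synonym ('n, 'b) pure_tensor = "('n \<times> 'b \<times> 'n) list"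

definition pure_tensors :: "('n \<Rightarrow> 'n \<Rightarrow> ('f, 'b) bimodule) \<Rightarrow> ('n, 'b) pure_tensor set" where
  "pure_tensors M =
     {w. w \<noteq> [] \<and> (\<forall>(i, m, j)\<in>set w. m \<in> carrier (M i j)) \<and>
         successively (\<lambda>x y. snd (snd x) = fst y) w}"

definition additive_relators ::
    "('n \<Rightarrow> 'n \<Rightarrow> ('f, 'b) bimodule) \<Rightarrow> (('n, 'b) pure_tensor \<Rightarrow>\<^sub>0 int) set" where
  "additive_relators M =
     {frag_of (u @ (i, m \<oplus>\<^bsub>M i j\<^esub> m', j) # w)
        - frag_of (u @ (i, m, j) # w) - frag_of (u @ (i, m', j) # w) | u i m m' j w.
      u @ (i, m, j) # w \<in> pure_tensors M \<and> m' \<in> carrier (M i j)}"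

definition balancing_relators ::
    "('n \<Rightarrow> ('k, 'f) module) \<Rightarrow> ('n \<Rightarrow> 'n \<Rightarrow> ('f, 'b) bimodule) \<Rightarrow>
     (('n, 'b) pure_tensor \<Rightarrow>\<^sub>0 int) set" where
  "balancing_relators F M =
     {frag_of (u @ (i, bright (M i j) m f, j) # (j, m', l) # w)
        - frag_of (u @ (i, m, j) # (j, bleft (M j l) f m', l) # w) | u i m f j m' l w.
      u @ (i, m, j) # (j, m', l) # w \<in> pure_tensors M \<and> f \<in> carrier (F j)}"

definition tensor_relations ::
    "('n \<Rightarrow> ('k, 'f) module) \<Rightarrow> ('n \<Rightarrow> 'n \<Rightarrow> ('f, 'b) bimodule) \<Rightarrow>
     (('n, 'b) pure_tensor \<Rightarrow>\<^sub>0 int) set" where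
  "tensor_relations F M =
     generate (free_Abelian_group (pure_tensors M)) (additive_relators M \<union> balancing_relators F M)"

definition positive_tensors ::
    "('n \<Rightarrow> ('k, 'f) module) \<Rightarrow> ('n \<Rightarrow> 'n \<Rightarrow> ('f, 'b) bimodule) \<Rightarrow>
     (('n, 'b) pure_tensor \<Rightarrow>\<^sub>0 int) set monoid" where
  "positive_tensors F M = free_Abelian_group (pure_tensors M) Mod tensor_relations F M"

definition tensor_left ::
    "('n \<Rightarrow> 'n \<Rightarrow> ('f, 'b) bimodule) \<Rightarrow> ('n \<Rightarrow> 'f) \<Rightarrow>
     (('n, 'b) pure_tensor \<Rightarrow>\<^sub>0 int) \<Rightarrow> (('n, 'b) pure_tensor \<Rightarrow>\<^sub>0 int)" where
  "tensor_left M a =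
     frag_extend (\<lambda>w. case hd w of (i, m, j) \<Rightarrow> frag_of ((i, bleft (M i j) (a i) m, j) # tl w))"

definition tensor_right ::
    "('n \<Rightarrow> 'n \<Rightarrow> ('f, 'b) bimodule) \<Rightarrow> (('n, 'b) pure_tensor \<Rightarrow>\<^sub>0 int) \<Rightarrow>
     ('n \<Rightarrow> 'f) \<Rightarrow> (('n, 'b) pure_tensor \<Rightarrow>\<^sub>0 int)" where
  "tensor_right M x a =
     frag_extend
       (\<lambda>w. case last w of (i, m, j) \<Rightarrow> frag_of (butlast w @ [(i, bright (M i j) m (a j), j)])) x"

definition tensor_concat ::
    "(('n, 'b) pure_tensor \<Rightarrow>\<^sub>0 int) \<Rightarrow> (('n, 'b) pure_tensor \<Rightarrow>\<^sub>0 int) \<Rightarrow>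
     (('n, 'b) pure_tensor \<Rightarrow>\<^sub>0 int)" where
  "tensor_concat x y =
     frag_extend (\<lambda>u. frag_extend
       (\<lambda>w. if snd (snd (last u)) = fst (hd w) then frag_of (u @ w) else 0) y) x"

text \<open>
  An element of the tensor algebra is a pair \<open>(a, X)\<close> of \<open>a\<close> in the product of the \<open>F i\<close>
  (degree \<open>0\<close>) and a class \<open>X\<close> of tensors of positive degree.
\<close>

type_synonym ('n, 'f, 'b) tensor = "('n \<Rightarrow> 'f) \<times> (('n, 'b) pure_tensor \<Rightarrow>\<^sub>0 int) set"

definition tensor_algebra ::
    "('n \<Rightarrow> ('k, 'f) module) \<Rightarrow> ('n \<Rightarrow> 'n \<Rightarrow> ('f, 'b) bimodule) \<Rightarrow> ('n, 'f, 'b) tensor ring" where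
  "tensor_algebra F M =
     \<lparr> carrier = {a. \<forall>i. a i \<in> carrier (F i)} \<times> carrier (positive_tensors F M),
       monoid.mult = (\<lambda>s t.
         (\<lambda>i. fst s i \<otimes>\<^bsub>F i\<^esub> fst t i,
          {tensor_left M (fst s) y + tensor_right M x (fst t) + tensor_concat x y + r | x y r.
             x \<in> snd s \<and> y \<in> snd t \<and> r \<in> tensor_relations F M})),
       monoid.one = (\<lambda>i. \<one>\<^bsub>F i\<^esub>, \<one>\<^bsub>positive_tensors F M\<^esub>),
       ring.zero = (\<lambda>i. \<zero>\<^bsub>F i\<^esub>, \<one>\<^bsub>positive_tensors F M\<^esub>),
       ring.add = (\<lambda>s t.
         (\<lambda>i. fst s i \<oplus>\<^bsub>F i\<^esub> fst t i, snd s \<otimes>\<^bsub>positive_tensors F M\<^esub> snd t)) \<rparr>"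

definition tensor_radical ::
    "('n \<Rightarrow> ('k, 'f) module) \<Rightarrow> ('n \<Rightarrow> 'n \<Rightarrow> ('f, 'b) bimodule) \<Rightarrow> ('n, 'f, 'b) tensor set" where
  "tensor_radical F M = {s \<in> carrier (tensor_algebra F M). fst s = (\<lambda>i. \<zero>\<^bsub>F i\<^esub>)}"

text \<open>
  The objects are all modules with carrier in the type \<open>'m\<close>. Everything below is polymorphic in
  \<open>'m\<close>, so no object is lost; for instance, any finite dimensional module over a field of type
  \<open>'k\<close> has an isomorphic copy with carrier in \<open>nat \<Rightarrow> 'k\<close>.
\<close>

record ('a, 'm) module_category =
  scalars :: "'a set"
  objects :: "('a, 'm) rmodule set"

definition mod_category :: "'k ring \<Rightarrow> ('k, 'a) module \<Rightarrow> ('a, 'm) module_category" where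
  "mod_category K A =
     \<lparr> scalars = carrier A,
       objects = {V. right_module A V \<and>
         spanned_over (carrier K) (\<lambda>v k. ract V v (k \<odot>\<^bsub>A\<^esub> \<one>\<^bsub>A\<^esub>)) V} \<rparr>"

definition nmod_category ::
    "('n \<Rightarrow> ('k, 'f) module) \<Rightarrow> ('n \<Rightarrow> 'n \<Rightarrow> ('f, 'b) bimodule) \<Rightarrow>
     (('n, 'f, 'b) tensor, 'm) module_category" where
  "nmod_category F M =
     \<lparr> scalars = carrier (tensor_algebra F M),
       objects = {V. right_module (tensor_algebra F M) V \<and>
         spanned_over (carrier (tensor_algebra F M)) (ract V) V \<and>
         (\<exists>N. \<forall>v\<in>carrier V. \<forall>rs. length rs = N \<and> set rs \<subseteq> tensor_radical F M \<longrightarrow>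
            foldl (ract V) v rs = \<zero>\<^bsub>V\<^esub>)} \<rparr>"

definition nonzero_objects :: "('a, 'm) module_category \<Rightarrow> ('a, 'm) rmodule set" where
  "nonzero_objects L = {V \<in> objects L. carrier V \<noteq> {\<zero>\<^bsub>V\<^esub>}}"

text \<open>Submodules are given by their carriers; \<open>restrict_module\<close> turns them into modules.\<close>

definition submodule_of ::
    "('a, 'm) module_category \<Rightarrow> 'm set \<Rightarrow> ('a, 'm) rmodule \<Rightarrow> bool" where
  "submodule_of L N V \<longleftrightarrow>
     additive_subgroup N V \<and> (\<forall>v\<in>N. \<forall>a\<in>scalars L. ract V v a \<in> N)"

definition restrict_module :: "('a, 'm) rmodule \<Rightarrow> 'm set \<Rightarrow> ('a, 'm) rmodule" where
  "restrict_module V N = V\<lparr>carrier := N\<rparr>"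

text \<open>The ring multiplication and unit of the record are irrelevant for modules.\<close>

definition quotient_module ::
    "('a, 'm) rmodule \<Rightarrow> 'm set \<Rightarrow> ('a, 'm set) rmodule" where
  "quotient_module V N =
     \<lparr> carrier = a_rcosets\<^bsub>V\<^esub> N, monoid.mult = undefined, monoid.one = undefined,
       ring.zero = N, ring.add = set_add V,
       ract = (\<lambda>X a. \<Union>x\<in>X. N +>\<^bsub>V\<^esub> ract V x a) \<rparr>"

definition module_isomorphic ::
    "'a set \<Rightarrow> ('a, 'm) rmodule \<Rightarrow> ('a, 'p) rmodule \<Rightarrow> bool" where
  "module_isomorphic C V W \<longleftrightarrow>
     (\<exists>h. bij_betw h (carrier V) (carrier W) \<and>
        (\<forall>v\<in>carrier V. \<forall>w\<in>carrier V. h (v \<oplus>\<^bsub>V\<^esub> w) = h v \<oplus>\<^bsub>W\<^esub> h w) \<and>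
        (\<forall>v\<in>carrier V. \<forall>a\<in>C. h (ract V v a) = ract W (h v) a))"

definition simple_module :: "'a set \<Rightarrow> ('a, 'm) rmodule \<Rightarrow> bool" where
  "simple_module C V \<longleftrightarrow>
     carrier V \<noteq> {\<zero>\<^bsub>V\<^esub>} \<and>
     (\<forall>N. additive_subgroup N V \<and> (\<forall>v\<in>N. \<forall>a\<in>C. ract V v a \<in> N) \<longrightarrow>
        N = {\<zero>\<^bsub>V\<^esub>} \<or> N = carrier V)"

definition simple_objects ::
    "('a, 'm) module_category \<Rightarrow> ('n \<Rightarrow> ('a, 'm) rmodule) \<Rightarrow> bool" where
  "simple_objects L S \<longleftrightarrow>
     (\<forall>i. S i \<in> objects L \<and> simple_module (scalars L) (S i)) \<and>
     (\<forall>V\<in>objects L. simple_module (scalars L) V \<longrightarrow>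
        (\<exists>!i. module_isomorphic (scalars L) V (S i)))"

definition composition_series ::
    "('a, 'm) module_category \<Rightarrow> ('a, 'm) rmodule \<Rightarrow> 'm set list \<Rightarrow> bool" where
  "composition_series L V Ns \<longleftrightarrow>
     Ns \<noteq> [] \<and> hd Ns = {\<zero>\<^bsub>V\<^esub>} \<and> last Ns = carrier V \<and>
     (\<forall>N\<in>set Ns. submodule_of L N V) \<and>
     (\<forall>k. Suc k < length Ns \<longrightarrow>
        Ns ! k \<subseteq> Ns ! Suc k \<and>
        simple_module (scalars L) (quotient_module (restrict_module V (Ns ! Suc k)) (Ns ! k)))"

definition multiplicities ::
    "('a, 'm) module_category \<Rightarrow> ('n::finite \<Rightarrow> ('a, 'm) rmodule) \<Rightarrow>
     ('a, 'm) rmodule \<Rightarrow> 'm set list \<Rightarrow> nat ^ 'n" where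
  "multiplicities L S V Ns =
     (\<chi> i. card {k. Suc k < length Ns \<and>
        module_isomorphic (scalars L)
          (quotient_module (restrict_module V (Ns ! Suc k)) (Ns ! k)) (S i)})"

text \<open>By the Jordan-Hoelder theorem the choice of the composition series is immaterial.\<close>

definition dim_vector ::
    "('a, 'm) module_category \<Rightarrow> ('n::finite \<Rightarrow> ('a, 'm) rmodule) \<Rightarrow>
     ('a, 'm) rmodule \<Rightarrow> nat ^ 'n" where
  "dim_vector L S V = multiplicities L S V (SOME Ns. composition_series L V Ns)"

definition real_dim ::
    "('a, 'm) module_category \<Rightarrow> ('n::finite \<Rightarrow> ('a, 'm) rmodule) \<Rightarrow>
     ('a, 'm) rmodule \<Rightarrow> real ^ 'n" where
  "real_dim L S V = (\<chi> i. real (dim_vector L S V $ i))"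

definition hyperplane ::
    "('a, 'm) module_category \<Rightarrow> ('n::finite \<Rightarrow> ('a, 'm) rmodule) \<Rightarrow>
     ('a, 'm) rmodule \<Rightarrow> (real ^ 'n) set" where
  "hyperplane L S V = {x. x \<bullet> real_dim L S V = 0}"

definition semistability_set ::
    "('a, 'm) module_category \<Rightarrow> ('n::finite \<Rightarrow> ('a, 'm) rmodule) \<Rightarrow>
     ('a, 'm) rmodule \<Rightarrow> (real ^ 'n) set" where
  "semistability_set L S V =
     {x \<in> hyperplane L S V.
        \<forall>N. submodule_of L N V \<longrightarrow> x \<bullet> real_dim L S (restrict_module V N) \<le> 0}"

text \<open>
  \<open>K\<^sub>0\<close> is identified with \<open>int ^ 'n\<close> via dimension vectors. The coefficient vectors \<open>a\<^sub>t\<close> and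
  \<open>b\<^sub>t\<close> are recovered from the values of \<open>Z\<^sub>t\<close> on the standard basis.
\<close>

definition re_coeffs :: "(real \<Rightarrow> int ^ 'n::finite \<Rightarrow> complex) \<Rightarrow> real \<Rightarrow> real ^ 'n" where
  "re_coeffs Z t = (\<chi> i. Re (Z t (axis i 1)))"

definition im_coeffs :: "(real \<Rightarrow> int ^ 'n::finite \<Rightarrow> complex) \<Rightarrow> real \<Rightarrow> real ^ 'n" where
  "im_coeffs Z t = (\<chi> i. Im (Z t (axis i 1)))"

definition nonlinear_stability_function ::
    "(real \<Rightarrow> int ^ 'n::finite \<Rightarrow> complex) \<Rightarrow> bool" where
  "nonlinear_stability_function Z \<longleftrightarrow>
     (\<forall>t. Modules.additive (Z t)) \<and>
     re_coeffs Z C1_differentiable_on UNIV \<and> im_coeffs Z C1_differentiable_on UNIV \<and>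
     (\<forall>t i. im_coeffs Z t $ i > 0) \<and>
     (\<exists>T. \<forall>t. \<bar>t\<bar> > T \<longrightarrow>
        vector_derivative (re_coeffs Z) (at t) = 0 \<and> vector_derivative (im_coeffs Z) (at t) = 0)"

definition slope ::
    "('a, 'm) module_category \<Rightarrow> ('n::finite \<Rightarrow> ('a, 'm) rmodule) \<Rightarrow>
     (real \<Rightarrow> int ^ 'n \<Rightarrow> complex) \<Rightarrow> real \<Rightarrow> ('a, 'm) rmodule \<Rightarrow> real" where
  "slope L S Z t V = (re_coeffs Z t \<bullet> real_dim L S V) / (im_coeffs Z t \<bullet> real_dim L S V)"

definition Z_semistable ::
    "('a, 'm) module_category \<Rightarrow> ('n::finite \<Rightarrow> ('a, 'm) rmodule) \<Rightarrow>
     (real \<Rightarrow> int ^ 'n \<Rightarrow> complex) \<Rightarrow> real \<Rightarrow> ('a, 'm) rmodule \<Rightarrow> bool" where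
  "Z_semistable L S Z t V \<longleftrightarrow>
     V \<in> nonzero_objects L \<and>
     (\<forall>N. submodule_of L N V \<and> N \<noteq> {\<zero>\<^bsub>V\<^esub>} \<and> N \<noteq> carrier V \<longrightarrow>
        slope L S Z t (restrict_module V N) \<ge> slope L S Z t V)"

definition semistable_pair ::
    "('a, 'm) module_category \<Rightarrow> ('n::finite \<Rightarrow> ('a, 'm) rmodule) \<Rightarrow>
     (real \<Rightarrow> int ^ 'n \<Rightarrow> complex) \<Rightarrow> ('a, 'm) rmodule \<Rightarrow> real \<Rightarrow> bool" where
  "semistable_pair L S Z V t \<longleftrightarrow> Z_semistable L S Z t V \<and> slope L S Z t V = t"

definition green_pair ::
    "('a, 'm) module_category \<Rightarrow> ('n::finite \<Rightarrow> ('a, 'm) rmodule) \<Rightarrow>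
     (real \<Rightarrow> int ^ 'n \<Rightarrow> complex) \<Rightarrow> ('a, 'm) rmodule \<Rightarrow> real \<Rightarrow> bool" where
  "green_pair L S Z V t \<longleftrightarrow>
     semistable_pair L S Z V t \<and> deriv (\<lambda>s. slope L S Z s V) t < 1"

definition red_pair ::
    "('a, 'm) module_category \<Rightarrow> ('n::finite \<Rightarrow> ('a, 'm) rmodule) \<Rightarrow>
     (real \<Rightarrow> int ^ 'n \<Rightarrow> complex) \<Rightarrow> ('a, 'm) rmodule \<Rightarrow> real \<Rightarrow> bool" where
  "red_pair L S Z V t \<longleftrightarrow>
     semistable_pair L S Z V t \<and> deriv (\<lambda>s. slope L S Z s V) t > 1"

definition green_stability ::
    "('a, 'm) module_category \<Rightarrow> ('n::finite \<Rightarrow> ('a, 'm) rmodule) \<Rightarrow>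
     (real \<Rightarrow> int ^ 'n \<Rightarrow> complex) \<Rightarrow> bool" where
  "green_stability L S Z \<longleftrightarrow>
     (\<forall>V t. semistable_pair L S Z V t \<longrightarrow> green_pair L S Z V t)"

definition generic_stability ::
    "('a, 'm) module_category \<Rightarrow> ('n::finite \<Rightarrow> ('a, 'm) rmodule) \<Rightarrow>
     (real \<Rightarrow> int ^ 'n \<Rightarrow> complex) \<Rightarrow> bool" where
  "generic_stability L S Z \<longleftrightarrow>
     (\<forall>V t. semistable_pair L S Z V t \<longrightarrow> green_pair L S Z V t \<or> red_pair L S Z V t)"

definition stability_path ::
    "(real \<Rightarrow> int ^ 'n::finite \<Rightarrow> complex) \<Rightarrow> real \<Rightarrow> real ^ 'n" where
  "stability_path Z t = t *\<^sub>R im_coeffs Z t - re_coeffs Z t"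

definition negative_to_positive_path :: "(real \<Rightarrow> real ^ 'n::finite) \<Rightarrow> bool" where
  "negative_to_positive_path \<gamma> \<longleftrightarrow>
     \<gamma> C1_differentiable_on UNIV \<and>
     (\<forall>\<^sub>F t in at_bot. \<forall>i. \<gamma> t $ i < 0) \<and> (\<forall>\<^sub>F t in at_top. \<forall>i. \<gamma> t $ i > 0)"

definition crossing ::
    "('a, 'm) module_category \<Rightarrow> ('n::finite \<Rightarrow> ('a, 'm) rmodule) \<Rightarrow>
     (real \<Rightarrow> real ^ 'n) \<Rightarrow> ('a, 'm) rmodule \<Rightarrow> real \<Rightarrow> bool" where
  "crossing L S \<gamma> V t \<longleftrightarrow> V \<in> nonzero_objects L \<and> \<gamma> t \<in> semistability_set L S V"

definition nontangent_crossing ::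
    "('a, 'm) module_category \<Rightarrow> ('n::finite \<Rightarrow> ('a, 'm) rmodule) \<Rightarrow>
     (real \<Rightarrow> real ^ 'n) \<Rightarrow> ('a, 'm) rmodule \<Rightarrow> real \<Rightarrow> bool" where
  "nontangent_crossing L S \<gamma> V t \<longleftrightarrow>
     crossing L S \<gamma> V t \<and> vector_derivative \<gamma> (at t) \<notin> hyperplane L S V"

definition green_crossing ::
    "('a, 'm) module_category \<Rightarrow> ('n::finite \<Rightarrow> ('a, 'm) rmodule) \<Rightarrow>
     (real \<Rightarrow> real ^ 'n) \<Rightarrow> ('a, 'm) rmodule \<Rightarrow> real \<Rightarrow> bool" where
  "green_crossing L S \<gamma> V t \<longleftrightarrow>
     crossing L S \<gamma> V t \<and> vector_derivative \<gamma> (at t) \<bullet> real_dim L S V > 0"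

definition codimension_one :: "(real ^ 'n::finite) set \<Rightarrow> bool" where
  "codimension_one D \<longleftrightarrow> aff_dim D = int CARD('n) - 1"

definition codimension_one_crossings ::
    "('a, 'm) module_category \<Rightarrow> ('n::finite \<Rightarrow> ('a, 'm) rmodule) \<Rightarrow>
     (real \<Rightarrow> real ^ 'n) \<Rightarrow> bool" where
  "codimension_one_crossings L S \<gamma> \<longleftrightarrow>
     (\<forall>V t. crossing L S \<gamma> V t \<longrightarrow> codimension_one (semistability_set L S V))"

definition reddening_path ::
    "('a, 'm) module_category \<Rightarrow> ('n::finite \<Rightarrow> ('a, 'm) rmodule) \<Rightarrow>
     (real \<Rightarrow> real ^ 'n) \<Rightarrow> bool" where
  "reddening_path L S \<gamma> \<longleftrightarrow>
     negative_to_positive_path \<gamma> \<and>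
     (\<forall>V t. crossing L S \<gamma> V t \<longrightarrow>
        codimension_one (semistability_set L S V) \<and> nontangent_crossing L S \<gamma> V t)"

definition green_path ::
    "('a, 'm) module_category \<Rightarrow> ('n::finite \<Rightarrow> ('a, 'm) rmodule) \<Rightarrow>
     (real \<Rightarrow> real ^ 'n) \<Rightarrow> bool" where
  "green_path L S \<gamma> \<longleftrightarrow>
     reddening_path L S \<gamma> \<and> (\<forall>V t. crossing L S \<gamma> V t \<longrightarrow> green_crossing L S \<gamma> V t)"

text \<open>
  The weak variants omit the requirement that the semistability sets that are met have
  codimension one, which genericity of a stability function does not imply: for
  \<open>Z\<^sub>t (x) = \<i> (x\<^sub>1 + \<dots> + x\<^sub>n)\<close> every semistable pair is green, but the path
  \<open>\<gamma> t = (t, \<dots>, t)\<close> meets, at \<open>t = 0\<close>, the semistability set of the direct sum of two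
  non-isomorphic simple objects, which has codimension two. In the weak variants, transversality
  of a crossing only means that the path is not tangent to the hyperplane, which itself has
  codimension one.
\<close>

definition weak_reddening_path ::
    "('a, 'm) module_category \<Rightarrow> ('n::finite \<Rightarrow> ('a, 'm) rmodule) \<Rightarrow>
     (real \<Rightarrow> real ^ 'n) \<Rightarrow> bool" where
  "weak_reddening_path L S \<gamma> \<longleftrightarrow>
     negative_to_positive_path \<gamma> \<and>
     (\<forall>V t. crossing L S \<gamma> V t \<longrightarrow> nontangent_crossing L S \<gamma> V t)"

definition weak_green_path ::
    "('a, 'm) module_category \<Rightarrow> ('n::finite \<Rightarrow> ('a, 'm) rmodule) \<Rightarrow>
     (real \<Rightarrow> real ^ 'n) \<Rightarrow> bool" where
  "weak_green_path L S \<gamma> \<longleftrightarrow>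
     weak_reddening_path L S \<gamma> \<and> (\<forall>V t. crossing L S \<gamma> V t \<longrightarrow> green_crossing L S \<gamma> V t)"

lemma reddening_path_iff:
  "reddening_path L S \<gamma> \<longleftrightarrow> weak_reddening_path L S \<gamma> \<and> codimension_one_crossings L S \<gamma>"
  unfolding reddening_path_def weak_reddening_path_def codimension_one_crossings_def by blast

lemma green_path_iff:
  "green_path L S \<gamma> \<longleftrightarrow> weak_green_path L S \<gamma> \<and> codimension_one_crossings L S \<gamma>"
  unfolding green_path_def weak_green_path_def reddening_path_iff by blast

end

theory Submission
  imports Defs
begin

text \<open>
  Every composition series of a nonzero object starts with a simple submodule, which is isomorphic
  to one of the \<open>S\<^sub>i\<close>, so dimension vectors of nonzero submodules are nonzero and pair positively
  with \<open>b\<^sub>t\<close>. Hence \<open>\<mu>\<^sub>t(N) \<ge> t\<close> is equivalent to \<open>\<gamma>\<^sub>Z(t) \<bullet> dim N \<le> 0\<close>, which identifies semistable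
  pairs with crossings; at such a pair the derivative of \<open>\<gamma>\<^sub>Z\<close> pairs with \<open>dim M\<close> to
  \<open>(b\<^sub>t \<bullet> dim M) (1 - \<mu>\<^sub>t'(M))\<close>. Conversely, a reddening path is modified far out, where it meets
  no semistability set, so as to become \<open>t (1, \<dots>, 1) - a\<^sub>t\<close> with \<open>a\<close> of compact support.

  For the existence of composition series, the objects are seen to be finite dimensional over \<open>K\<close>;
  for a tensor algebra this uses that the radical acts nilpotently.
\<close>

section \<open>Stability functions and paths\<close>

text \<open>Dimension vectors are defined through a chosen composition series, and \<open>S\<close>
  classifies only those simple modules that are objects of the category and have their carrier in
  the given type. Both points shape the algebra. A composition factor lives in the type of sets of
  elements, so the first factor, a quotient by zero, is traded for the first nonzero term of the
  series; and that term must be recognised as an object, although objects are defined by finiteness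
  conditions. A simple submodule is cyclic, which settles this in both cases. The stability part
  sees the category through the locale \<open>length_category\<close>, the algebra part sees the
  acting ring through \<open>scalar_ring\<close>: operations that stay in the carrier, and a map
  \<iota> from K through which every module becomes a vector space. The tensor algebra, whose
  elements are pairs of a family and a coset of formal sums of words, can supply this interface by
  computing with representatives.\<close>

lemma nonneg_nonzero_inner_pos:
  fixes x d :: "real ^ 'n"
  assumes "\<And>i. 0 < x $ i" "\<And>i. 0 \<le> d $ i" "d \<noteq> 0"
  shows "0 < x \<bullet> d"
proof -
  obtain i where "d $ i \<noteq> 0" using assms(3) by (auto simp: vec_eq_iff)
  then have "0 < x $ i * d $ i" using assms(1,2)[of i] by simp
  moreover have "0 \<le> x $ j * d $ j" for j using assms(1,2)[of j] by simp
  ultimately have "0 < (\<Sum>j\<in>UNIV. x $ j * d $ j)" by (intro sum_pos2[of _ i]) auto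
  then show ?thesis by (simp add: inner_vec_def)
qed

lemma real_dim_nonneg: "0 \<le> real_dim L S V $ i"
  by (simp add: real_dim_def)

lemma restrict_module_carrier [simp]: "restrict_module V (carrier V) = V"
  by (simp add: restrict_module_def)

section \<open>Semistable pairs and crossings of semistability sets\<close>

text \<open>The interface between the algebra and the stability arguments. Submodules are carriers,
  so they enter through \<open>restrict_module\<close>. The zero submodule has its own axiom because
  \<open>semistability_set\<close> tests it, and \<open>real_dim_nonzero\<close> makes the
  denominators in the slopes of nonzero submodules positive.\<close>

locale length_category =
  fixes L :: "('a, 'm) module_category" and S :: "'n::finite \<Rightarrow> ('a, 'm) rmodule"
  assumes zero_sub: "V \<in> objects L \<Longrightarrow> submodule_of L {\<zero>\<^bsub>V\<^esub>} V"
    and carrier_sub: "V \<in> objects L \<Longrightarrow> submodule_of L (carrier V) V"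
    and real_dim_zero: "V \<in> objects L \<Longrightarrow> real_dim L S (restrict_module V {\<zero>\<^bsub>V\<^esub>}) = 0"
    and real_dim_nonzero:
      "V \<in> objects L \<Longrightarrow> submodule_of L N V \<Longrightarrow> N \<noteq> {\<zero>\<^bsub>V\<^esub>} \<Longrightarrow>
        real_dim L S (restrict_module V N) \<noteq> 0"
begin

lemma inner_real_dim_pos:
  assumes "V \<in> nonzero_objects L" "\<And>i. 0 < x $ i"
  shows "0 < x \<bullet> real_dim L S V"
proof -
  have "real_dim L S V \<noteq> 0"
    using assms(1) carrier_sub real_dim_nonzero[of V "carrier V"]
    by (auto simp: nonzero_objects_def)
  then show ?thesis using assms(2) real_dim_nonneg nonneg_nonzero_inner_pos by blast
qed

lemma positive_notin_semistability_set:
  assumes "V \<in> nonzero_objects L" "\<And>i. 0 < x $ i"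
  shows "x \<notin> semistability_set L S V"
  using inner_real_dim_pos[OF assms] by (auto simp: semistability_set_def hyperplane_def)

lemma negative_notin_semistability_set:
  assumes "V \<in> nonzero_objects L" "\<And>i. x $ i < 0"
  shows "x \<notin> semistability_set L S V"
  using inner_real_dim_pos[OF assms(1), of "- x"] assms(2)
  by (auto simp: semistability_set_def hyperplane_def)

lemma semistable_pair_iff:
  assumes Z: "nonlinear_stability_function Z" and V: "V \<in> nonzero_objects L"
  shows "semistable_pair L S Z V t \<longleftrightarrow> stability_path Z t \<in> semistability_set L S V"
proof -
  let ?a = "re_coeffs Z t" and ?b = "im_coeffs Z t"
  have b: "0 < ?b $ i" for i using Z by (simp add: nonlinear_stability_function_def)
  have VL: "V \<in> objects L" using V by (simp add: nonzero_objects_def)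
  have path: "stability_path Z t \<bullet> d = t * (?b \<bullet> d) - ?a \<bullet> d" for d
    by (simp add: stability_path_def inner_diff_left)
  have bV: "0 < ?b \<bullet> real_dim L S V" using V b by (rule inner_real_dim_pos)
  have slope_V: "slope L S Z t V = t \<longleftrightarrow> stability_path Z t \<in> hyperplane L S V"
    using bV by (auto simp: slope_def hyperplane_def path field_simps)
  have slope_N: "t \<le> slope L S Z t (restrict_module V N) \<longleftrightarrow>
      stability_path Z t \<bullet> real_dim L S (restrict_module V N) \<le> 0"
    if "submodule_of L N V" "N \<noteq> {\<zero>\<^bsub>V\<^esub>}" for N
  proof -
    have "0 < ?b \<bullet> real_dim L S (restrict_module V N)"
      using nonneg_nonzero_inner_pos[OF b] real_dim_nonneg real_dim_nonzero[OF VL that] by blast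
    then show ?thesis by (auto simp: slope_def path field_simps)
  qed
  show ?thesis
  proof
    assume "semistable_pair L S Z V t"
    then have t: "slope L S Z t V = t"
      and ss: "\<And>N. submodule_of L N V \<Longrightarrow> N \<noteq> {\<zero>\<^bsub>V\<^esub>} \<Longrightarrow> N \<noteq> carrier V \<Longrightarrow>
        t \<le> slope L S Z t (restrict_module V N)"
      by (auto simp: semistable_pair_def Z_semistable_def)
    have "stability_path Z t \<bullet> real_dim L S (restrict_module V N) \<le> 0"
      if N: "submodule_of L N V" for N
    proof -
      \<comment> \<open>Semistability tests proper nonzero submodules, whereas
        \<open>semistability_set\<close> tests all of them; at the two extremes the pairing is
        0.\<close>
      consider "N = {\<zero>\<^bsub>V\<^esub>}" | "N = carrier V" | "N \<noteq> {\<zero>\<^bsub>V\<^esub>}" "N \<noteq> carrier V" by blast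
      then show ?thesis
      proof cases
        case 1
        then show ?thesis using real_dim_zero[OF VL] by simp
      next
        case 2
        then show ?thesis using t slope_V by (simp add: hyperplane_def)
      next
        case 3
        then show ?thesis using ss slope_N N by blast
      qed
    qed
    then show "stability_path Z t \<in> semistability_set L S V"
      using t slope_V by (simp add: semistability_set_def)
  next
    assume "stability_path Z t \<in> semistability_set L S V"
    then show "semistable_pair L S Z V t"
      using V slope_V slope_N
      by (auto simp: semistability_set_def semistable_pair_def Z_semistable_def)
  qed
qed

lemma crossing_stability_path_iff:
  assumes "nonlinear_stability_function Z"
  shows "crossing L S (stability_path Z) V t \<longleftrightarrow> semistable_pair L S Z V t"
proof (cases "V \<in> nonzero_objects L")
  case True
  then show ?thesis using semistable_pair_iff[OF assms] by (simp add: crossing_def)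
next
  case False
  then show ?thesis by (simp add: crossing_def semistable_pair_def Z_semistable_def)
qed

text \<open>Let d be the dimension vector of V. At a semistable pair a . d = t (b . d), so the
  quotient rule gives \<mu>' = (a' . d - t (b' . d)) / (b . d), while the velocity of the path is b
  + t b' - a'. Comparing the two yields the identity.\<close>

lemma derivative_stability_path_inner:
  assumes Z: "nonlinear_stability_function Z" and pair: "semistable_pair L S Z V t"
  shows "vector_derivative (stability_path Z) (at t) \<bullet> real_dim L S V =
    (im_coeffs Z t \<bullet> real_dim L S V) * (1 - deriv (\<lambda>s. slope L S Z s V) t)"
proof -
  let ?d = "real_dim L S V"
  have V: "V \<in> nonzero_objects L" and slope: "slope L S Z t V = t"
    using pair by (auto simp: semistable_pair_def Z_semistable_def)
  have bpos: "0 < im_coeffs Z t \<bullet> ?d"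
    using Z V by (intro inner_real_dim_pos) (auto simp: nonlinear_stability_function_def)
  then have at: "re_coeffs Z t \<bullet> ?d = t * (im_coeffs Z t \<bullet> ?d)"
    using slope by (auto simp: slope_def field_simps)
  have "re_coeffs Z differentiable at t" "im_coeffs Z differentiable at t"
    using Z by (auto simp: nonlinear_stability_function_def C1_differentiable_on_eq)
  then obtain a' b' where a': "(re_coeffs Z has_vector_derivative a') (at t)"
    and b': "(im_coeffs Z has_vector_derivative b') (at t)"
    by (meson vector_derivative_works)
  have ad: "((\<lambda>s. re_coeffs Z s \<bullet> ?d) has_real_derivative a' \<bullet> ?d) (at t)"
    and bd: "((\<lambda>s. im_coeffs Z s \<bullet> ?d) has_real_derivative b' \<bullet> ?d) (at t)"
    using bounded_linear.has_vector_derivative[OF bounded_linear_inner_left a']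
      bounded_linear.has_vector_derivative[OF bounded_linear_inner_left b']
    by (auto simp: has_real_derivative_iff_has_vector_derivative)
  have "((\<lambda>s. slope L S Z s V) has_real_derivative
      ((a' \<bullet> ?d) * (im_coeffs Z t \<bullet> ?d) - (re_coeffs Z t \<bullet> ?d) * (b' \<bullet> ?d)) /
        ((im_coeffs Z t \<bullet> ?d) * (im_coeffs Z t \<bullet> ?d))) (at t)"
    unfolding slope_def using bpos by (intro DERIV_divide ad bd) auto
  then have "deriv (\<lambda>s. slope L S Z s V) t = (a' \<bullet> ?d - t * (b' \<bullet> ?d)) / (im_coeffs Z t \<bullet> ?d)"
    using bpos by (simp add: DERIV_imp_deriv at field_simps)
  moreover have "(stability_path Z has_vector_derivative (t *\<^sub>R b' + im_coeffs Z t) - a') (at t)"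
    unfolding stability_path_def[abs_def]
    using has_vector_derivative_diff[OF has_vector_derivative_scaleR[OF DERIV_ident b'] a'] by simp
  ultimately show ?thesis
    using bpos by (simp add: vector_derivative_at inner_diff_left inner_add_left field_simps)
qed

text \<open>As b . dim V is positive, 1 - \<mu>' has the sign of the pairing of the velocity with
  dim V.\<close>

lemma green_pair_iff:
  assumes "nonlinear_stability_function Z" "semistable_pair L S Z V t"
  shows "green_pair L S Z V t \<longleftrightarrow> green_crossing L S (stability_path Z) V t"
    and "green_pair L S Z V t \<or> red_pair L S Z V t \<longleftrightarrow>
      nontangent_crossing L S (stability_path Z) V t"
proof -
  have "0 < im_coeffs Z t \<bullet> real_dim L S V"
    using assms by (intro inner_real_dim_pos)
      (auto simp: nonlinear_stability_function_def semistable_pair_def Z_semistable_def)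
  then show "green_pair L S Z V t \<longleftrightarrow> green_crossing L S (stability_path Z) V t"
    and "green_pair L S Z V t \<or> red_pair L S Z V t \<longleftrightarrow>
      nontangent_crossing L S (stability_path Z) V t"
    using assms derivative_stability_path_inner[OF assms] crossing_stability_path_iff[OF assms(1)]
    by (auto simp: green_pair_def red_pair_def green_crossing_def nontangent_crossing_def
        hyperplane_def zero_less_mult_iff)
qed

end

section \<open>Behaviour of stability paths at both ends\<close>

lemma has_vector_derivative_zero_constant_on:
  fixes f :: "real \<Rightarrow> 'a::real_normed_vector"
  assumes "convex X" "\<And>t. t \<in> X \<Longrightarrow> (f has_vector_derivative 0) (at t)"
  shows "\<exists>c. \<forall>t\<in>X. f t = c"
proof -
  have "(f has_derivative (\<lambda>h. 0)) (at t within X)" if "t \<in> X" for t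
    using assms(2)[OF that] by (auto simp: has_vector_derivative_def intro: has_derivative_at_withinI)
  from has_derivative_zero_constant[OF assms(1) this] show ?thesis by blast
qed

text \<open>Vanishing velocities make the coefficients constant on each of two rays, possibly with
  different values. There the path is affine in t with a direction b whose coordinates are all
  positive, so each coordinate eventually takes the sign of t.\<close>

lemma stability_path_negative_to_positive:
  assumes Z: "nonlinear_stability_function Z"
  shows "negative_to_positive_path (stability_path Z)"
proof -
  have C1: "re_coeffs Z C1_differentiable_on UNIV" "im_coeffs Z C1_differentiable_on UNIV"
    and b: "\<And>t i. im_coeffs Z t $ i > 0"
    using Z by (auto simp: nonlinear_stability_function_def)
  obtain T where T: "\<forall>t. \<bar>t\<bar> > T \<longrightarrow> vector_derivative (re_coeffs Z) (at t) = 0 \<and>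
      vector_derivative (im_coeffs Z) (at t) = 0"
    using Z unfolding nonlinear_stability_function_def by blast
  have diff: "re_coeffs Z differentiable at t" "im_coeffs Z differentiable at t" for t
    using C1 by (auto simp: C1_differentiable_on_eq)
  have der: "(re_coeffs Z has_vector_derivative 0) (at t)"
      "(im_coeffs Z has_vector_derivative 0) (at t)" if "\<bar>t\<bar> > T" for t
    using diff[of t] T that unfolding vector_derivative_works by auto
  have path: "stability_path Z t $ i = t * im_coeffs Z t $ i - re_coeffs Z t $ i" for t i
    by (simp add: stability_path_def)
  have der_up: "\<bar>t\<bar> > T" if "t \<in> {max 0 T<..}" for t using that by auto
  have der_down: "\<bar>t\<bar> > T" if "t \<in> {..<- max 0 T}" for t using that by auto
  obtain a where a: "\<forall>t\<in>{max 0 T<..}. re_coeffs Z t = a"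
    using has_vector_derivative_zero_constant_on[OF convex_real_interval(3) der(1)] der_up by blast
  obtain b0 where b0: "\<forall>t\<in>{max 0 T<..}. im_coeffs Z t = b0"
    using has_vector_derivative_zero_constant_on[OF convex_real_interval(3) der(2)] der_up by blast
  obtain a' where a': "\<forall>t\<in>{..<- max 0 T}. re_coeffs Z t = a'"
    using has_vector_derivative_zero_constant_on[OF convex_real_interval(4) der(1)] der_down by blast
  obtain b' where b': "\<forall>t\<in>{..<- max 0 T}. im_coeffs Z t = b'"
    using has_vector_derivative_zero_constant_on[OF convex_real_interval(4) der(2)] der_down by blast
  have "\<forall>\<^sub>F t in at_top. stability_path Z t $ i > 0" for i
  proof -
    have "b0 $ i > 0" using b[of "max 0 T + 1" i] b0 by simp
    then have "t * b0 $ i - a $ i > 0" if "t > a $ i / b0 $ i" for t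
      using that by (simp add: field_simps)
    then have "\<forall>\<^sub>F t in at_top. t * b0 $ i - a $ i > 0"
      using eventually_at_top_dense by blast
    moreover have "\<forall>\<^sub>F t in at_top. t > max 0 T"
      by (rule eventually_gt_at_top)
    ultimately show ?thesis by eventually_elim (simp add: path a b0)
  qed
  moreover have "\<forall>\<^sub>F t in at_bot. stability_path Z t $ i < 0" for i
  proof -
    have "b' $ i > 0" using b[of "- max 0 T - 1" i] b' by simp
    then have "t * b' $ i - a' $ i < 0" if "t < a' $ i / b' $ i" for t
      using that by (simp add: field_simps)
    then have "\<forall>\<^sub>F t in at_bot. t * b' $ i - a' $ i < 0"
      using eventually_at_bot_dense by blast
    moreover have "\<forall>\<^sub>F t in at_bot. t < - max 0 T"
      by (rule eventually_gt_at_bot)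
    ultimately show ?thesis by eventually_elim (simp add: path a' b')
  qed
  moreover have "stability_path Z C1_differentiable_on UNIV"
    unfolding stability_path_def[abs_def] using C1
    by (intro C1_differentiable_on_diff C1_differentiable_on_scaleR) auto
  ultimately show ?thesis by (simp add: negative_to_positive_path_def eventually_all_finite)
qed

context length_category
begin

lemma generic_stability_iff:
  assumes "nonlinear_stability_function Z"
  shows "generic_stability L S Z \<longleftrightarrow> weak_reddening_path L S (stability_path Z)"
  using assms stability_path_negative_to_positive green_pair_iff(2) crossing_stability_path_iff
  by (auto simp: generic_stability_def weak_reddening_path_def)

lemma green_stability_iff:
  assumes "nonlinear_stability_function Z"
  shows "green_stability L S Z \<longleftrightarrow> weak_green_path L S (stability_path Z)"
proof -
  have "green_stability L S Z \<Longrightarrow> generic_stability L S Z"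
    by (auto simp: green_stability_def generic_stability_def)
  then show ?thesis
    using assms generic_stability_iff green_pair_iff(1) crossing_stability_path_iff
    by (auto simp: green_stability_def weak_green_path_def)
qed

end

section \<open>A continuously differentiable cutoff function\<close>

text \<open>The square of the positive part is an elementary C1 function vanishing on a half-line.
  Differentiability at 0 rests on the difference quotient being at most |h| in absolute
  value.\<close>

lemma square_max_has_real_derivative:
  "((\<lambda>s::real. (max 0 s)\<^sup>2) has_real_derivative 2 * max 0 s) (at s)"
proof -
  consider "s < 0" | "s = 0" | "s > 0" by linarith
  then show ?thesis
  proof cases
    case 1
    then have "\<forall>\<^sub>F x in nhds s. 0 = (max 0 x)\<^sup>2"
      using eventually_nhds_in_open[of "{..<0}" s] by (auto elim!: eventually_mono)
    then show ?thesis using 1 DERIV_cong_ev[of s s "\<lambda>_. 0" "\<lambda>x. (max 0 x)\<^sup>2" 0 0] by simp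
  next
    case 2
    have "((\<lambda>h. (max 0 h)\<^sup>2 / h) \<longlongrightarrow> 0) (at (0::real))"
    proof (rule Lim_null_comparison)
      have "norm ((max 0 h)\<^sup>2 / h) \<le> \<bar>h\<bar>" for h :: real
        by (cases "h > 0") (auto simp: power2_eq_square max_def)
      then show "\<forall>\<^sub>F h in at 0. norm ((max 0 h)\<^sup>2 / h) \<le> \<bar>h\<bar>" for h :: real by simp
      show "((\<lambda>h. \<bar>h\<bar>) \<longlongrightarrow> 0) (at (0::real))"
        using tendsto_rabs[OF tendsto_ident_at[of "0::real" UNIV]] by simp
    qed
    then show ?thesis using 2 by (simp add: has_field_derivative_iff)
  next
    case 3
    then have "\<forall>\<^sub>F x in nhds s. x\<^sup>2 = (max 0 x)\<^sup>2"
      using eventually_nhds_in_open[of "{0<..}" s] by (auto elim!: eventually_mono)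
    moreover have "((\<lambda>x. x\<^sup>2) has_real_derivative 2 * s) (at s)"
      by (auto intro!: derivative_eq_intros)
    ultimately show ?thesis using 3 DERIV_cong_ev[of s s "\<lambda>x. x\<^sup>2" "\<lambda>x. (max 0 x)\<^sup>2"] by simp
  qed
qed

lemma C1_differentiable_on_square_max:
  fixes f :: "real \<Rightarrow> real"
  assumes "f C1_differentiable_on X"
  shows "(\<lambda>t. (max 0 (f t))\<^sup>2) C1_differentiable_on X"
proof -
  from assms obtain D where D: "\<And>x. x \<in> X \<Longrightarrow> (f has_real_derivative D x) (at x)"
      "continuous_on X D"
    by (auto simp: C1_differentiable_on_def has_real_derivative_iff_has_vector_derivative)
  have "continuous_on X f" using assms C1_differentiable_imp_continuous_on by blast
  then have "continuous_on X (\<lambda>x. 2 * max 0 (f x) * D x)"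
    using D(2) by (intro continuous_intros)
  moreover have "((\<lambda>t. (max 0 (f t))\<^sup>2) has_real_derivative 2 * max 0 (f x) * D x) (at x)"
    if "x \<in> X" for x
    using DERIV_chain2[OF square_max_has_real_derivative D(1)[OF that]] .
  ultimately have "(\<forall>x\<in>X. ((\<lambda>t. (max 0 (f t))\<^sup>2) has_vector_derivative 2 * max 0 (f x) * D x) (at x)) \<and>
      continuous_on X (\<lambda>x. 2 * max 0 (f x) * D x)"
    by (simp add: has_real_derivative_iff_has_vector_derivative)
  then show ?thesis unfolding C1_differentiable_on_def
    by (rule exI[of _ "\<lambda>x. 2 * max 0 (f x) * D x"])
qed

text \<open>With h(s) = max(0, s)^2 the witness is h(1 - h(t^2 - T^2)). For |t| \<le> T the inner
  value is 0 and h(1) = 1; for |t| \<ge> |T| + 1 one has t^2 - T^2 \<ge> 2 |T| + 1 \<ge> 1, so the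
  argument of the outer h is at most 0.\<close>

lemma C1_cutoff:
  fixes T :: real
  shows "\<exists>\<phi>::real \<Rightarrow> real. \<phi> C1_differentiable_on UNIV \<and> (\<forall>t. 0 \<le> \<phi> t \<and> \<phi> t \<le> 1) \<and>
    (\<forall>t. \<bar>t\<bar> \<le> T \<longrightarrow> \<phi> t = 1) \<and> (\<forall>t. \<bar>t\<bar> \<ge> \<bar>T\<bar> + 1 \<longrightarrow> \<phi> t = 0)"
proof (intro exI conjI allI impI)
  let ?h = "\<lambda>s::real. (max 0 s)\<^sup>2"
  let ?\<phi> = "\<lambda>t. ?h (1 - ?h (t * t - T * T))"
  show "?\<phi> C1_differentiable_on UNIV"
    by (intro C1_differentiable_on_square_max C1_differentiable_on_diff
        C1_differentiable_on_mult C1_differentiable_on_ident C1_differentiable_on_const)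
  show "0 \<le> ?\<phi> t" for t by simp
  show "?\<phi> t \<le> 1" for t by (intro power_le_one) auto
  show "?\<phi> t = 1" if "\<bar>t\<bar> \<le> T" for t
    using abs_le_square_iff[of t T] that by (simp add: max_def power2_eq_square)
  show "?\<phi> t = 0" if "\<bar>t\<bar> \<ge> \<bar>T\<bar> + 1" for t
  proof -
    have "(\<bar>T\<bar> + 1)\<^sup>2 \<le> \<bar>t\<bar>\<^sup>2" using that by (intro power_mono) auto
    then have "1 \<le> t * t - T * T" by (simp add: power2_sum flip: power2_eq_square)
    then have "1 \<le> ?h (t * t - T * T)" by (intro one_le_power) auto
    then show ?thesis by simp
  qed
qed

section \<open>From paths to stability functions\<close>

lemma stability_function_of_coeffs:
  fixes a b :: "real \<Rightarrow> real ^ 'n"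
  assumes "Z = (\<lambda>t (x::int ^ 'n). Complex (\<Sum>i\<in>UNIV. a t $ i * of_int (x $ i))
    (\<Sum>i\<in>UNIV. b t $ i * of_int (x $ i)))"
  shows "re_coeffs Z = a" "im_coeffs Z = b" "Modules.additive (Z t)"
proof -
  have axis: "(\<Sum>j\<in>UNIV. c $ j * of_int (axis i 1 $ j)) = c $ i" for c :: "real ^ 'n" and i
    by (simp add: axis_def if_distrib[of of_int] if_distrib[of "(*) _"] sum.delta cong: if_cong)
  show "re_coeffs Z = a" "im_coeffs Z = b"
    by (auto simp: assms re_coeffs_def im_coeffs_def axis vec_eq_iff)
  show "Modules.additive (Z t)"
    by (simp add: Modules.additive_def assms complex_eq_iff algebra_simps sum.distrib)
qed

context length_category
begin

text \<open>
  Outside a compact interval the path stays in the open negative or positive orthant, which meets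
  no semistability set, so there it may be replaced by the path of a constant \<open>Z\<close>.
\<close>

lemma stability_function_of_path:
  assumes \<gamma>: "negative_to_positive_path \<gamma>"
  obtains Z where "nonlinear_stability_function Z"
    "\<And>V t. V \<in> nonzero_objects L \<Longrightarrow>
      stability_path Z t \<in> semistability_set L S V \<longleftrightarrow> \<gamma> t \<in> semistability_set L S V"
proof -
  from \<gamma> have "\<exists>T1. \<forall>t\<le>T1. \<forall>i. \<gamma> t $ i < 0" "\<exists>T2. \<forall>t\<ge>T2. \<forall>i. \<gamma> t $ i > 0"
    by (simp_all add: negative_to_positive_path_def eventually_at_bot_linorder
        eventually_at_top_linorder)
  then obtain T1 T2 where neg: "\<forall>t\<le>T1. \<forall>i. \<gamma> t $ i < 0"
    and pos: "\<forall>t\<ge>T2. \<forall>i. \<gamma> t $ i > 0" by auto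
  define T where "T = max \<bar>T1\<bar> \<bar>T2\<bar>"
  obtain \<phi> :: "real \<Rightarrow> real" where cutoff: "\<phi> C1_differentiable_on UNIV \<and> (\<forall>t. 0 \<le> \<phi> t \<and> \<phi> t \<le> 1) \<and>
      (\<forall>t. \<bar>t\<bar> \<le> T \<longrightarrow> \<phi> t = 1) \<and> (\<forall>t. \<bar>t\<bar> \<ge> \<bar>T\<bar> + 1 \<longrightarrow> \<phi> t = 0)"
    using C1_cutoff[of T] by blast
  then have \<phi>: "\<phi> C1_differentiable_on UNIV" "0 \<le> \<phi> t" "\<phi> t \<le> 1" "\<bar>t\<bar> \<le> T \<Longrightarrow> \<phi> t = 1"
    "\<bar>t\<bar> \<ge> \<bar>T\<bar> + 1 \<Longrightarrow> \<phi> t = 0" for t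
    by simp_all
  \<comment> \<open>For b = (1, ..., 1) this a turns the stability path into \<phi> \<gamma> + (1 -
    \<phi>) t (1, ..., 1). That path is \<gamma> where \<phi> = 1, and a vanishes where \<phi> = 0,
    as the condition on the velocities demands.\<close>
  define a where "a = (\<lambda>t. \<phi> t *\<^sub>R (t *\<^sub>R (1 :: real ^ 'n) - \<gamma> t))"
  define b where "b = (\<lambda>t::real. 1 :: real ^ 'n)"
  define Z where "Z = (\<lambda>t (x::int ^ 'n). Complex (\<Sum>i\<in>UNIV. a t $ i * of_int (x $ i))
    (\<Sum>i\<in>UNIV. b t $ i * of_int (x $ i)))"
  note coeffs = stability_function_of_coeffs[OF Z_def]
  have "vector_derivative a (at t) = 0" if "\<bar>t\<bar> > \<bar>T\<bar> + 1" for t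
  proof -
    have "open {x. \<bar>x\<bar> > \<bar>T\<bar> + 1}" by (intro open_Collect_less continuous_intros)
    then have "\<forall>\<^sub>F x in nhds t. x \<in> {x. \<bar>x\<bar> > \<bar>T\<bar> + 1}"
      using that by (intro eventually_nhds_in_open) auto
    then have "\<forall>\<^sub>F x in nhds t. x \<in> UNIV \<longrightarrow> 0 = a x"
      by (auto elim!: eventually_mono simp: a_def \<phi>(5))
    moreover have "0 = a t" using that by (simp add: a_def \<phi>(5))
    ultimately have "((\<lambda>_. 0 :: real ^ 'n) has_vector_derivative 0) (at t) = (a has_vector_derivative 0) (at t)"
      by (rule has_vector_derivative_cong_ev[where f = "\<lambda>_. 0" and g = a])
    then have "(a has_vector_derivative 0) (at t)" by (simp only: has_vector_derivative_const)
    then show ?thesis by (rule vector_derivative_at)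
  qed
  moreover have "a C1_differentiable_on UNIV"
    unfolding a_def using \<gamma> \<phi>(1)
    by (intro C1_differentiable_on_scaleR C1_differentiable_on_diff)
      (auto simp: negative_to_positive_path_def)
  ultimately have "nonlinear_stability_function Z"
    by (auto simp: nonlinear_stability_function_def coeffs b_def intro!: exI[of _ "\<bar>T\<bar> + 1"])
  moreover have "stability_path Z t \<in> semistability_set L S V \<longleftrightarrow> \<gamma> t \<in> semistability_set L S V"
    if V: "V \<in> nonzero_objects L" for V t
  proof -
    have path: "stability_path Z t = \<phi> t *\<^sub>R \<gamma> t + (1 - \<phi> t) *\<^sub>R (t *\<^sub>R 1)"
      by (simp add: stability_path_def coeffs a_def b_def algebra_simps)
    then have path_i: "stability_path Z t $ i = \<phi> t * \<gamma> t $ i + (1 - \<phi> t) * t" for i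
      by simp
    \<comment> \<open>Open orthants are convex; the case split covers the end of the segment where
      \<phi> vanishes. The negative orthant is reached by negating both points.\<close>
    have comb: "0 < \<phi> t * x + (1 - \<phi> t) * y" if "0 < x" "0 < y" for x y
    proof (cases "\<phi> t = 0")
      case False
      then have "0 < \<phi> t * x" "0 \<le> (1 - \<phi> t) * y"
        using \<phi>(2,3)[of t] that by (simp_all add: less_le)
      then show ?thesis by simp
    qed (use that in simp)
    consider "\<bar>t\<bar> \<le> T" | "t > T" | "t < - T" by linarith
    then show ?thesis
    proof cases
      case 1
      then show ?thesis by (simp add: path \<phi>(4))
    next
      case 2
      then have "t \<ge> T2" "t > 0" by (auto simp: T_def)
      then have "\<gamma> t $ i > 0" for i using pos by blast
      moreover from this \<open>t > 0\<close> have "stability_path Z t $ i > 0" for i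
        unfolding path_i by (intro comb)
      ultimately have "\<gamma> t \<notin> semistability_set L S V" "stability_path Z t \<notin> semistability_set L S V"
        by (auto intro!: positive_notin_semistability_set[OF V])
      then show ?thesis by simp
    next
      case 3
      then have "t \<le> T1" "t < 0" by (auto simp: T_def)
      then have "\<gamma> t $ i < 0" for i using neg by blast
      moreover from this \<open>t < 0\<close> have "stability_path Z t $ i < 0" for i
        using comb[of "- \<gamma> t $ i" "- t"] by (simp add: path_i)
      ultimately have "\<gamma> t \<notin> semistability_set L S V" "stability_path Z t \<notin> semistability_set L S V"
        by (auto intro!: negative_notin_semistability_set[OF V])
      then show ?thesis by simp
    qed
  qed
  ultimately show ?thesis using that by blast
qed

lemma stability_correspondence:
  "(\<forall>Z. nonlinear_stability_function Z \<longrightarrow>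
      (generic_stability L S Z \<longleftrightarrow> weak_reddening_path L S (stability_path Z)) \<and>
      (green_stability L S Z \<longleftrightarrow> weak_green_path L S (stability_path Z)) \<and>
      (generic_stability L S Z \<and> codimension_one_crossings L S (stability_path Z)
         \<longleftrightarrow> reddening_path L S (stability_path Z)) \<and>
      (green_stability L S Z \<and> codimension_one_crossings L S (stability_path Z)
         \<longleftrightarrow> green_path L S (stability_path Z))) \<and>
   (\<forall>\<gamma>. weak_reddening_path L S \<gamma> \<longrightarrow>
      (\<exists>Z. nonlinear_stability_function Z \<and>
         (\<forall>V\<in>nonzero_objects L. \<forall>t.
            (\<gamma> t \<in> semistability_set L S V \<longleftrightarrow> semistable_pair L S Z V t) \<and>
            (semistable_pair L S Z V t \<longleftrightarrow> stability_path Z t \<in> semistability_set L S V))))"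
proof (intro conjI allI impI)
  fix \<gamma> assume "weak_reddening_path L S \<gamma>"
  then have "negative_to_positive_path \<gamma>" by (simp add: weak_reddening_path_def)
  then obtain Z where "nonlinear_stability_function Z"
    "\<And>V t. V \<in> nonzero_objects L \<Longrightarrow>
      stability_path Z t \<in> semistability_set L S V \<longleftrightarrow> \<gamma> t \<in> semistability_set L S V"
    using stability_function_of_path by metis
  then show "\<exists>Z. nonlinear_stability_function Z \<and>
         (\<forall>V\<in>nonzero_objects L. \<forall>t.
            (\<gamma> t \<in> semistability_set L S V \<longleftrightarrow> semistable_pair L S Z V t) \<and>
            (semistable_pair L S Z V t \<longleftrightarrow> stability_path Z t \<in> semistability_set L S V))"
    using semistable_pair_iff by blast
qed (simp_all add: generic_stability_iff green_stability_iff reddening_path_iff green_path_iff)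

end

section \<open>Submodules of finite length\<close>

text \<open>Negatives are asked for as left inverses found somewhere in N. This suits unions of
  cosets and restricted modules, where the negation at hand belongs to another record; uniqueness of
  inverses identifies it with negation in G.\<close>

lemma (in abelian_group) additive_subgroupI:
  assumes N: "N \<subseteq> carrier G" "\<zero> \<in> N" "\<And>x y. x \<in> N \<Longrightarrow> y \<in> N \<Longrightarrow> x \<oplus> y \<in> N"
    and neg: "\<And>x. x \<in> N \<Longrightarrow> \<exists>y\<in>N. y \<oplus> x = \<zero>"
  shows "additive_subgroup N G"
proof -
  have "inv\<^bsub>add_monoid G\<^esub> x \<in> N" if x: "x \<in> N" for x
  proof -
    from neg[OF x] show ?thesis
    proof (rule bexE)
      fix y assume y: "y \<in> N" "y \<oplus> x = \<zero>"
      have "\<ominus> x = y"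
        using y(2) subsetD[OF N(1) x] subsetD[OF N(1) y(1)] by (rule minus_equality)
      then show ?thesis using y(1) by (simp add: a_inv_def)
    qed
  qed
  with N show ?thesis
    by (intro additive_subgroup.intro subgroup.intro) simp_all
qed

lemma (in abelian_group) add_diff_cancel_right:
  assumes "u \<in> carrier G" "v \<in> carrier G" "g \<in> carrier G"
  shows "(u \<oplus> g) \<ominus> (v \<oplus> g) = u \<ominus> v"
proof -
  have "g \<oplus> (\<ominus> v \<oplus> \<ominus> g) = \<ominus> v"
    using assms a_lcomm[of g "\<ominus> v" "\<ominus> g"] by (simp add: r_neg)
  then show ?thesis using assms by (simp add: a_minus_def minus_add a_assoc)
qed

text \<open>The span as a closure, so that its properties are proved by rule induction. For a module
  over K it is matched below with the linear combinations in \<open>spanned_over\<close>; negatives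
  come from the action of -1.\<close>

inductive_set action_span ::
    "'c set \<Rightarrow> ('v \<Rightarrow> 'c \<Rightarrow> 'v) \<Rightarrow> ('v, 'x) ring_scheme \<Rightarrow> 'v set \<Rightarrow> 'v set"
  for C f V X where
  span_zero: "\<zero>\<^bsub>V\<^esub> \<in> action_span C f V X"
| span_base: "x \<in> X \<Longrightarrow> x \<in> action_span C f V X"
| span_add: "x \<in> action_span C f V X \<Longrightarrow> y \<in> action_span C f V X \<Longrightarrow>
    x \<oplus>\<^bsub>V\<^esub> y \<in> action_span C f V X"
| span_act: "x \<in> action_span C f V X \<Longrightarrow> c \<in> C \<Longrightarrow> f x c \<in> action_span C f V X"

lemma action_span_subset:
  assumes "X \<subseteq> action_span C f V Y" shows "action_span C f V X \<subseteq> action_span C f V Y"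
proof
  fix x assume "x \<in> action_span C f V X"
  then show "x \<in> action_span C f V Y"
    by induction (use assms in \<open>auto intro: action_span.intros\<close>)
qed

lemma action_span_mono: "X \<subseteq> Y \<Longrightarrow> action_span C f V X \<subseteq> action_span C f V Y"
  by (intro action_span_subset) (auto intro: span_base)

lemma (in abelian_monoid) finsum_mem_closed:
  assumes "finite B" "\<And>b. b \<in> B \<Longrightarrow> g b \<in> U" "U \<subseteq> carrier G" "\<zero> \<in> U"
    "\<And>x y. x \<in> U \<Longrightarrow> y \<in> U \<Longrightarrow> x \<oplus> y \<in> U"
  shows "(\<Oplus>b\<in>B. g b) \<in> U"
  using assms(1,2)
proof (induction B)
  case (insert b B)
  then have "g b \<in> carrier G" "g \<in> B \<rightarrow> carrier G" using assms(3) by auto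
  then show ?case using insert assms(5) by (simp add: finsum_insert)
qed (simp add: assms(4))

section \<open>Modules as vector spaces over K\<close>

text \<open>The acting ring, reduced to what both cases supply: a finite dimensional algebra with
  \<iota> k = k 1, and the tensor algebra with \<iota> k the family of all k 1 in degree 0.
  Associativity, distributivity and the unit law are drawn from the module axioms when elements of A
  act.\<close>

locale scalar_ring =
  fixes K :: "'k ring" and A :: "('a, 'x) ring_scheme" and \<iota> :: "'k \<Rightarrow> 'a"
  assumes field_K: "field K"
    and scalar_add_closed: "a \<in> carrier A \<Longrightarrow> b \<in> carrier A \<Longrightarrow> a \<oplus>\<^bsub>A\<^esub> b \<in> carrier A"
    and scalar_mult_closed: "a \<in> carrier A \<Longrightarrow> b \<in> carrier A \<Longrightarrow> a \<otimes>\<^bsub>A\<^esub> b \<in> carrier A"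
    and iota_closed: "k \<in> carrier K \<Longrightarrow> \<iota> k \<in> carrier A"
    and iota_add: "k \<in> carrier K \<Longrightarrow> l \<in> carrier K \<Longrightarrow> \<iota> (k \<oplus>\<^bsub>K\<^esub> l) = \<iota> k \<oplus>\<^bsub>A\<^esub> \<iota> l"
    and iota_mult: "k \<in> carrier K \<Longrightarrow> l \<in> carrier K \<Longrightarrow> \<iota> (k \<otimes>\<^bsub>K\<^esub> l) = \<iota> k \<otimes>\<^bsub>A\<^esub> \<iota> l"
    and iota_one: "\<iota> \<one>\<^bsub>K\<^esub> = \<one>\<^bsub>A\<^esub>"
begin

sublocale K: field K by (rule field_K)

end

locale scalar_module = scalar_ring K A \<iota>
  for K :: "'k ring" and A :: "('a, 'x) ring_scheme" and \<iota> :: "'k \<Rightarrow> 'a" +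
  fixes V :: "('a, 'm) rmodule"
  assumes right_module: "right_module A V"
begin

sublocale V: abelian_group V
  using right_module by (simp add: right_module_def)

abbreviation smult :: "'m \<Rightarrow> 'k \<Rightarrow> 'm"
  where "smult v k \<equiv> ract V v (\<iota> k)"

abbreviation span :: "'m set \<Rightarrow> 'm set"
  where "span \<equiv> action_span (carrier K) smult V"

definition submod :: "'m set \<Rightarrow> bool"
  where "submod N \<longleftrightarrow> additive_subgroup N V \<and> (\<forall>v\<in>N. \<forall>a\<in>carrier A. ract V v a \<in> N)"

lemma ract_closed: "v \<in> carrier V \<Longrightarrow> a \<in> carrier A \<Longrightarrow> ract V v a \<in> carrier V"
  and ract_add_left: "v \<in> carrier V \<Longrightarrow> w \<in> carrier V \<Longrightarrow> a \<in> carrier A \<Longrightarrow>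
    ract V (v \<oplus>\<^bsub>V\<^esub> w) a = ract V v a \<oplus>\<^bsub>V\<^esub> ract V w a"
  and ract_add_right: "v \<in> carrier V \<Longrightarrow> a \<in> carrier A \<Longrightarrow> b \<in> carrier A \<Longrightarrow>
    ract V v (a \<oplus>\<^bsub>A\<^esub> b) = ract V v a \<oplus>\<^bsub>V\<^esub> ract V v b"
  and ract_mult: "v \<in> carrier V \<Longrightarrow> a \<in> carrier A \<Longrightarrow> b \<in> carrier A \<Longrightarrow>
    ract V v (a \<otimes>\<^bsub>A\<^esub> b) = ract V (ract V v a) b"
  and ract_one: "v \<in> carrier V \<Longrightarrow> ract V v \<one>\<^bsub>A\<^esub> = v"
  using right_module by (auto simp: right_module_def)

lemma smult_closed: "v \<in> carrier V \<Longrightarrow> k \<in> carrier K \<Longrightarrow> smult v k \<in> carrier V"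
  by (simp add: ract_closed iota_closed)

lemma smult_zero: "v \<in> carrier V \<Longrightarrow> smult v \<zero>\<^bsub>K\<^esub> = \<zero>\<^bsub>V\<^esub>"
proof -
  assume v: "v \<in> carrier V"
  \<comment> \<open>\<open>scalar_ring\<close> does not mention the zero of A; additivity of \<iota>
    at 0 + 0 makes the vector in question equal to its own double.\<close>
  have "\<iota> \<zero>\<^bsub>K\<^esub> \<oplus>\<^bsub>A\<^esub> \<iota> \<zero>\<^bsub>K\<^esub> = \<iota> \<zero>\<^bsub>K\<^esub>"
    by (simp flip: iota_add)
  then have "smult v \<zero>\<^bsub>K\<^esub> \<oplus>\<^bsub>V\<^esub> smult v \<zero>\<^bsub>K\<^esub> = smult v \<zero>\<^bsub>K\<^esub>"
    using ract_add_right[of v "\<iota> \<zero>\<^bsub>K\<^esub>" "\<iota> \<zero>\<^bsub>K\<^esub>"] v by (simp add: iota_closed)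
  then show ?thesis using v by (simp add: iota_closed ract_closed)
qed

lemma smult_one: "v \<in> carrier V \<Longrightarrow> smult v \<one>\<^bsub>K\<^esub> = v"
  by (simp add: iota_one ract_one)

lemma smult_add_right: "v \<in> carrier V \<Longrightarrow> k \<in> carrier K \<Longrightarrow> l \<in> carrier K \<Longrightarrow>
    smult v (k \<oplus>\<^bsub>K\<^esub> l) = smult v k \<oplus>\<^bsub>V\<^esub> smult v l"
  by (simp add: iota_add ract_add_right iota_closed)

lemma smult_mult: "v \<in> carrier V \<Longrightarrow> k \<in> carrier K \<Longrightarrow> l \<in> carrier K \<Longrightarrow>
    smult v (k \<otimes>\<^bsub>K\<^esub> l) = smult (smult v k) l"
  by (simp add: iota_mult ract_mult iota_closed)

lemma smult_minus_one: "v \<in> carrier V \<Longrightarrow> smult v (\<ominus>\<^bsub>K\<^esub> \<one>\<^bsub>K\<^esub>) = \<ominus>\<^bsub>V\<^esub> v"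
proof -
  assume v: "v \<in> carrier V"
  then have "smult v (\<ominus>\<^bsub>K\<^esub> \<one>\<^bsub>K\<^esub>) \<oplus>\<^bsub>V\<^esub> v = \<zero>\<^bsub>V\<^esub>"
    using smult_add_right[of v "\<ominus>\<^bsub>K\<^esub> \<one>\<^bsub>K\<^esub>" "\<one>\<^bsub>K\<^esub>"] by (simp add: K.l_neg smult_zero smult_one)
  from V.minus_equality[OF this v] v show ?thesis by (simp add: smult_closed)
qed

lemma ract_zero: "a \<in> carrier A \<Longrightarrow> ract V \<zero>\<^bsub>V\<^esub> a = \<zero>\<^bsub>V\<^esub>"
proof -
  assume a: "a \<in> carrier A"
  then have "ract V \<zero>\<^bsub>V\<^esub> a \<oplus>\<^bsub>V\<^esub> ract V \<zero>\<^bsub>V\<^esub> a = ract V \<zero>\<^bsub>V\<^esub> a"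
    by (simp flip: ract_add_left)
  then show ?thesis using a by (simp add: ract_closed)
qed

lemma span_closed: "X \<subseteq> carrier V \<Longrightarrow> span X \<subseteq> carrier V"
proof
  fix x assume X: "X \<subseteq> carrier V" and "x \<in> span X"
  from this(2) show "x \<in> carrier V" by induction (use X in \<open>auto intro: smult_closed\<close>)
qed

lemma span_uminus:
  assumes "X \<subseteq> carrier V" "x \<in> span X" shows "\<ominus>\<^bsub>V\<^esub> x \<in> span X"
proof -
  have "smult x (\<ominus>\<^bsub>K\<^esub> \<one>\<^bsub>K\<^esub>) \<in> span X" using assms(2) by (intro span_act) auto
  then show ?thesis using assms(2) span_closed[OF assms(1)] by (simp add: smult_minus_one subset_iff)
qed

lemma span_minus:
  assumes "X \<subseteq> carrier V" "x \<in> span X" "y \<in> span X" shows "x \<ominus>\<^bsub>V\<^esub> y \<in> span X"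
  using assms by (simp add: a_minus_def span_add span_uminus)

lemma spanned_over_imp_span:
  assumes "spanned_over (carrier K) smult V"
  shows "\<exists>B. finite B \<and> B \<subseteq> carrier V \<and> carrier V \<subseteq> span B"
proof -
  obtain B where B: "finite B" "B \<subseteq> carrier V"
    and sum: "\<forall>v\<in>carrier V. \<exists>c. (\<forall>b\<in>B. c b \<in> carrier K) \<and> v = (\<Oplus>\<^bsub>V\<^esub>b\<in>B. smult b (c b))"
    using assms by (auto simp: spanned_over_def)
  have "(\<Oplus>\<^bsub>V\<^esub>b\<in>B. smult b (c b)) \<in> span B" if "\<forall>b\<in>B. c b \<in> carrier K" for c
    using that B span_closed
    by (intro V.finsum_mem_closed) (auto intro: action_span.intros)
  then have "v \<in> span B" if "v \<in> carrier V" for v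
    using bspec[OF sum that] by (elim exE conjE) simp
  then have "carrier V \<subseteq> span B" by (rule subsetI)
  with B show ?thesis by (intro exI[of _ B] conjI)
qed

text \<open>Combinations over a fixed finite B obey the rules of \<open>action_span\<close>: zero
  and Kronecker coefficients give zero and the elements of B, and sums and multiples are formed
  coefficientwise.\<close>

lemma span_imp_spanned_over:
  assumes B: "finite B" "B \<subseteq> carrier V" "carrier V \<subseteq> span B"
  shows "spanned_over (carrier K) smult V"
proof -
  have sum: "\<exists>c. (\<forall>b\<in>B. c b \<in> carrier K) \<and> v = (\<Oplus>\<^bsub>V\<^esub>b\<in>B. smult b (c b))" if "v \<in> span B" for v
    using that
  proof induction
    case span_zero
    have "(\<Oplus>\<^bsub>V\<^esub>b\<in>B. smult b \<zero>\<^bsub>K\<^esub>) = (\<Oplus>\<^bsub>V\<^esub>b\<in>B. \<zero>\<^bsub>V\<^esub>)"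
      using B(2) by (intro V.finsum_cong') (auto simp: smult_zero)
    then show ?case by (intro exI[of _ "\<lambda>_. \<zero>\<^bsub>K\<^esub>"]) (simp add: V.finsum_zero)
  next
    case (span_base x)
    have "(\<Oplus>\<^bsub>V\<^esub>b\<in>B. smult b (if x = b then \<one>\<^bsub>K\<^esub> else \<zero>\<^bsub>K\<^esub>)) =
        (\<Oplus>\<^bsub>V\<^esub>b\<in>B. if x = b then b else \<zero>\<^bsub>V\<^esub>)"
      using B(2) by (intro V.finsum_cong') (auto simp: smult_zero smult_one)
    also have "\<dots> = x"
      using V.finsum_singleton[OF span_base B(1), of "\<lambda>b. b"] B(2) by auto
    finally show ?case by (intro exI[of _ "\<lambda>b. if x = b then \<one>\<^bsub>K\<^esub> else \<zero>\<^bsub>K\<^esub>"]) auto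
  next
    case (span_add x y)
    then obtain c d where c: "\<forall>b\<in>B. c b \<in> carrier K" "x = (\<Oplus>\<^bsub>V\<^esub>b\<in>B. smult b (c b))"
      and d: "\<forall>b\<in>B. d b \<in> carrier K" "y = (\<Oplus>\<^bsub>V\<^esub>b\<in>B. smult b (d b))" by auto
    have "x \<oplus>\<^bsub>V\<^esub> y = (\<Oplus>\<^bsub>V\<^esub>b\<in>B. smult b (c b) \<oplus>\<^bsub>V\<^esub> smult b (d b))"
      unfolding c(2) d(2) using c(1) d(1) B(2)
      by (intro V.finsum_addf[symmetric]) (auto intro: smult_closed)
    also have "\<dots> = (\<Oplus>\<^bsub>V\<^esub>b\<in>B. smult b (c b \<oplus>\<^bsub>K\<^esub> d b))"
      using c(1) d(1) B(2)
      by (intro V.finsum_cong') (auto simp: smult_add_right subset_iff intro!: smult_closed)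
    finally show ?case using c(1) d(1) by (intro exI[of _ "\<lambda>b. c b \<oplus>\<^bsub>K\<^esub> d b"]) auto
  next
    case (span_act x k)
    then obtain c where c: "\<forall>b\<in>B. c b \<in> carrier K" "x = (\<Oplus>\<^bsub>V\<^esub>b\<in>B. smult b (c b))" by auto
    have "smult (\<Oplus>\<^bsub>V\<^esub>b\<in>B'. smult b (c b)) k = (\<Oplus>\<^bsub>V\<^esub>b\<in>B'. smult b (c b \<otimes>\<^bsub>K\<^esub> k))" if "B' \<subseteq> B" for B'
      using finite_subset[OF that B(1)] that
    proof (induction B')
      case empty
      then show ?case using span_act(2) by (simp add: ract_zero iota_closed)
    next
      case (insert b B')
      then have "(\<lambda>b. smult b (c b)) \<in> B' \<rightarrow> carrier V" "(\<lambda>b. smult b (c b \<otimes>\<^bsub>K\<^esub> k)) \<in> B' \<rightarrow> carrier V"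
        "b \<in> carrier V" "c b \<in> carrier K"
        using c(1) B(2) span_act(2) by (auto intro!: smult_closed)
      then show ?case using insert span_act(2)
        by (simp add: V.finsum_insert smult_closed ract_add_left iota_closed V.finsum_closed smult_mult)
    qed
    then show ?case using c span_act(2) by (intro exI[of _ "\<lambda>b. c b \<otimes>\<^bsub>K\<^esub> k"]) auto
  qed
  have "\<forall>v\<in>carrier V. \<exists>c. (\<forall>b\<in>B. c b \<in> carrier K) \<and> v = (\<Oplus>\<^bsub>V\<^esub>b\<in>B. smult b (c b))"
    by (intro ballI sum subsetD[OF B(3)])
  with B(1,2) show ?thesis unfolding spanned_over_def by (intro exI[of _ B] conjI)
qed

text \<open>Adjoining one vector enlarges a span by at most one line; this is the linear algebra
  behind counting the jumps of a filtration.\<close>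

lemma span_insert_decompose:
  assumes X: "X \<subseteq> carrier V" and g: "g \<in> carrier V" and "x \<in> span (insert g X)"
  shows "\<exists>u\<in>span X. \<exists>k\<in>carrier K. x = u \<oplus>\<^bsub>V\<^esub> smult g k"
  using assms(3)
proof induction
  case span_zero
  show ?case using g by (intro bexI[of _ "\<zero>\<^bsub>V\<^esub>"] bexI[of _ "\<zero>\<^bsub>K\<^esub>"])
      (auto simp: smult_zero intro: action_span.span_zero)
next
  case (span_base x)
  show ?case
  proof (cases "x = g")
    case True
    then show ?thesis using g by (intro bexI[of _ "\<zero>\<^bsub>V\<^esub>"] bexI[of _ "\<one>\<^bsub>K\<^esub>"])
      (auto simp: smult_one intro: action_span.span_zero)
  next
    case False
    then have "x \<in> X" using span_base by blast
    then show ?thesis using g X by (intro bexI[of _ x] bexI[of _ "\<zero>\<^bsub>K\<^esub>"])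
      (auto simp: smult_zero intro: action_span.span_base)
  qed
next
  case (span_add x y)
  then obtain u k v l where u: "u \<in> span X" "k \<in> carrier K" "x = u \<oplus>\<^bsub>V\<^esub> smult g k"
    and v: "v \<in> span X" "l \<in> carrier K" "y = v \<oplus>\<^bsub>V\<^esub> smult g l" by blast
  then have "x \<oplus>\<^bsub>V\<^esub> y = (u \<oplus>\<^bsub>V\<^esub> v) \<oplus>\<^bsub>V\<^esub> smult g (k \<oplus>\<^bsub>K\<^esub> l)"
    using g span_closed[OF X] by (simp add: smult_add_right smult_closed subset_iff V.a_ac)
  then show ?case using u v by (metis K.a_closed action_span.span_add)
next
  case (span_act x l)
  then obtain u k where u: "u \<in> span X" "k \<in> carrier K" "x = u \<oplus>\<^bsub>V\<^esub> smult g k" by blast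
  then have "smult x l = smult u l \<oplus>\<^bsub>V\<^esub> smult g (k \<otimes>\<^bsub>K\<^esub> l)"
    using g span_closed[OF X] span_act(2)
    by (simp add: smult_mult smult_closed subset_iff ract_add_left iota_closed)
  then show ?case using u span_act(2) by (metis K.m_closed action_span.span_act)
qed

text \<open>
  With respect to the filtration of \<open>V\<close> by the spans of the initial segments of a finite spanning
  list, a submodule is determined, among those containing it, by the positions at which its
  intersection with the filtration grows. Counting them replaces the dimension over \<open>K\<close>.
\<close>

lemma submod_length_function:
  assumes G: "finite G" "G \<subseteq> carrier V" "carrier V \<subseteq> span G"
  shows "\<exists>d :: 'm set \<Rightarrow> nat. \<forall>N N'. submod N \<longrightarrow> submod N' \<longrightarrow> N \<subset> N' \<longrightarrow> d N < d N'"
proof -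
  obtain gs where gs: "set gs = G" using G(1) finite_list by blast
  define U where "U = (\<lambda>j. span (set (take j gs)))"
  have gs_closed: "set (take j gs) \<subseteq> carrier V" for j
    by (rule subset_trans[OF set_take_subset]) (simp add: gs G(2))
  have U_Suc: "set (take (Suc j) gs) = insert (gs ! j) (set (take j gs))" if "j < length gs" for j
    using that by (simp add: take_Suc_conv_app_nth)
  define jumps where "jumps = (\<lambda>N. {j. j < length gs \<and> (\<exists>y\<in>N \<inter> U (Suc j). y \<notin> U j)})"
  have eq: "N' \<subseteq> N" if N: "submod N" and N': "submod N'" and sub: "N \<subseteq> N'" and jumps: "jumps N' \<subseteq> jumps N" for N N'
  proof -
    interpret N: additive_subgroup N V using N by (simp add: submod_def)
    interpret N': additive_subgroup N' V using N' by (simp add: submod_def)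
    have "N' \<inter> U j \<subseteq> N" if "j \<le> length gs" for j
      using that
    proof (induction j)
      case 0
      have "x = \<zero>\<^bsub>V\<^esub>" if "x \<in> span {}" for x
        using that by induction (auto simp: ract_zero iota_closed)
      then have "span {} \<subseteq> {\<zero>\<^bsub>V\<^esub>}" by (intro subsetI) simp
      then have "N' \<inter> span {} \<subseteq> {\<zero>\<^bsub>V\<^esub>}" by (rule le_infI2)
      then show ?case by (simp add: U_def subset_trans[of _ "{\<zero>\<^bsub>V\<^esub>}"])
    next
      case (Suc j)
      then have j: "j < length gs" and IH: "N' \<inter> U j \<subseteq> N" by auto
      have g: "gs ! j \<in> carrier V" using subsetD[OF G(2)[folded gs] nth_mem[OF j]] .
      have dec: "\<exists>u\<in>U j. \<exists>k\<in>carrier K. x = u \<oplus>\<^bsub>V\<^esub> smult (gs ! j) k" if "x \<in> U (Suc j)" for x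
        using that unfolding U_def U_Suc[OF j] by (rule span_insert_decompose[OF gs_closed g])
      show ?case
      proof
        fix x assume "x \<in> N' \<inter> U (Suc j)"
        then have x: "x \<in> N'" "x \<in> U (Suc j)" by auto
        show "x \<in> N"
        proof (cases "x \<in> U j")
          case True
          then show ?thesis using x IH by blast
        next
          case False
          then have "j \<in> jumps N'" using x j by (auto simp: jumps_def)
          then obtain y where y: "y \<in> N" "y \<in> U (Suc j)" "y \<notin> U j"
            using jumps by (auto simp: jumps_def)
          obtain u k where u: "u \<in> U j" "k \<in> carrier K" "x = u \<oplus>\<^bsub>V\<^esub> smult (gs ! j) k"
            using dec[OF x(2)] by (elim bexE)
          obtain v l where v: "v \<in> U j" "l \<in> carrier K" "y = v \<oplus>\<^bsub>V\<^esub> smult (gs ! j) l"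
            using dec[OF y(2)] by (elim bexE)
          have closed: "u \<in> carrier V" "v \<in> carrier V" "x \<in> carrier V" "y \<in> carrier V"
            using u(1) v(1) span_closed[OF gs_closed] x y N.a_subset N'.a_subset by (auto simp: U_def)
          \<comment> \<open>If l were 0, then y would lie in \<open>U j\<close>. Hence l is
            invertible, and m = l^-1 k makes the components of x and y m along the j-th generator
            equal. Their difference falls back into \<open>U j\<close>, where the induction
            hypothesis applies.\<close>
          have "l \<noteq> \<zero>\<^bsub>K\<^esub>" using v y(3) closed g by (auto simp: smult_zero)
          then have "l \<in> Units K" using v(2) by (simp add: K.field_Units)
          define m where "m = inv\<^bsub>K\<^esub> l \<otimes>\<^bsub>K\<^esub> k"
          have m: "m \<in> carrier K" "l \<otimes>\<^bsub>K\<^esub> m = k"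
            using \<open>l \<in> Units K\<close> u(2) v(2) by (auto simp: m_def K.m_assoc[symmetric])
          have "smult y m = smult v m \<oplus>\<^bsub>V\<^esub> smult (gs ! j) k"
            using v g m closed by (simp add: ract_add_left smult_closed iota_closed flip: smult_mult)
          then have "x \<ominus>\<^bsub>V\<^esub> smult y m = u \<ominus>\<^bsub>V\<^esub> smult v m"
            unfolding u(3) using closed u(2) m(1) g
            by (simp add: smult_closed V.add_diff_cancel_right)
          also have "\<dots> \<in> U j"
            using u(1) v(1) m(1) unfolding U_def by (intro span_minus gs_closed span_act)
          finally have "x \<ominus>\<^bsub>V\<^esub> smult y m \<in> U j" .
          moreover have ym: "smult y m \<in> N"
            using N y(1) m(1) by (auto simp: submod_def iota_closed)
          then have "x \<ominus>\<^bsub>V\<^esub> smult y m \<in> N'"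
            using x sub unfolding a_minus_def by (blast intro: N'.a_closed N'.a_inv_closed)
          ultimately have "x \<ominus>\<^bsub>V\<^esub> smult y m \<in> N" using IH by blast
          then have "(x \<ominus>\<^bsub>V\<^esub> smult y m) \<oplus>\<^bsub>V\<^esub> smult y m \<in> N" using ym by (rule N.a_closed)
          then show ?thesis
            using closed smult_closed[OF closed(4) m(1)]
            by (simp add: a_minus_def V.a_assoc V.l_neg)
        qed
      qed
    qed
    from this[of "length gs"] show ?thesis
      using N'.a_subset G(3) gs by (auto simp: U_def)
  qed
  have "card (jumps N) < card (jumps N')" if "submod N" "submod N'" "N \<subset> N'" for N N'
  proof (rule psubset_card_mono)
    show "finite (jumps N')" by (simp add: jumps_def)
    have "jumps N \<subseteq> jumps N'" using that(3) by (auto simp: jumps_def)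
    then show "jumps N \<subset> jumps N'" using eq[OF that(1,2)] that(3) by blast
  qed
  then show ?thesis by (intro exI[of _ "\<lambda>N. card (jumps N)"] allI impI)
qed

end

section \<open>Submodules, quotients and composition series\<close>

lemma module_isomorphic_trans:
  assumes "module_isomorphic C U V" "module_isomorphic C V W"
  shows "module_isomorphic C U W"
proof -
  obtain g where g: "bij_betw g (carrier U) (carrier V)"
    "\<forall>v\<in>carrier U. \<forall>w\<in>carrier U. g (v \<oplus>\<^bsub>U\<^esub> w) = g v \<oplus>\<^bsub>V\<^esub> g w"
    "\<forall>v\<in>carrier U. \<forall>a\<in>C. g (ract U v a) = ract V (g v) a"
    using assms(1) unfolding module_isomorphic_def by (elim exE conjE)
  obtain h where h: "bij_betw h (carrier V) (carrier W)"
    "\<forall>v\<in>carrier V. \<forall>w\<in>carrier V. h (v \<oplus>\<^bsub>V\<^esub> w) = h v \<oplus>\<^bsub>W\<^esub> h w"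
    "\<forall>v\<in>carrier V. \<forall>a\<in>C. h (ract V v a) = ract W (h v) a"
    using assms(2) unfolding module_isomorphic_def by (elim exE conjE)
  have gV: "g v \<in> carrier V" if "v \<in> carrier U" for v
    using g(1) that by (rule bij_betw_apply)
  show ?thesis unfolding module_isomorphic_def
    by (intro exI[of _ "h \<circ> g"] conjI bij_betw_trans[OF g(1) h(1)]) (simp_all add: g h gV)
qed

context scalar_module
begin

lemma submod_zero: "submod {\<zero>\<^bsub>V\<^esub>}"
  unfolding submod_def by (intro conjI V.additive_subgroupI) (simp_all add: ract_zero)

lemma submod_carrier: "submod (carrier V)"
  unfolding submod_def
proof (intro conjI V.additive_subgroupI)
  show "\<exists>y\<in>carrier V. y \<oplus>\<^bsub>V\<^esub> x = \<zero>\<^bsub>V\<^esub>" if "x \<in> carrier V" for x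
    using that by (intro bexI[of _ "\<ominus>\<^bsub>V\<^esub> x"]) (simp_all add: V.l_neg)
qed (simp_all add: ract_closed)

lemma scalar_module_restrict:
  assumes N: "submod N"
  shows "scalar_module K A \<iota> (restrict_module V N)"
proof -
  interpret N: additive_subgroup N V using N by (simp add: submod_def)
  have closed: "x \<in> carrier V" if "x \<in> N" for x using N.a_subset that by (rule subsetD)
  have act: "ract V v a \<in> N" if "v \<in> N" "a \<in> carrier A" for v a
    using N that by (simp add: submod_def)
  have "abelian_group (restrict_module V N)"
  proof (rule abelian_groupI)
    show "\<exists>y\<in>carrier (restrict_module V N). y \<oplus>\<^bsub>restrict_module V N\<^esub> x = \<zero>\<^bsub>restrict_module V N\<^esub>"
      if "x \<in> carrier (restrict_module V N)" for x
      using that by (intro bexI[of _ "\<ominus>\<^bsub>V\<^esub> x"])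
        (simp_all add: restrict_module_def V.l_neg closed N.a_inv_closed)
  qed (simp_all add: restrict_module_def closed V.a_ac)
  then have "right_module A (restrict_module V N)"
    unfolding right_module_def
    by (simp add: restrict_module_def act closed ract_add_left ract_add_right ract_mult ract_one)
  then show ?thesis
    by (intro scalar_module.intro scalar_ring_axioms scalar_module_axioms.intro)
qed

text \<open>The two records share their operations, but negation is a definite description over the
  carrier. Each direction takes the negative in the record where membership is known and passes on
  only that it is a left inverse.\<close>

lemma submod_restrict_iff:
  assumes N: "submod N"
  shows "scalar_module.submod A (restrict_module V N) N' \<longleftrightarrow> submod N' \<and> N' \<subseteq> N"
proof -
  interpret W: scalar_module K A \<iota> "restrict_module V N" using N by (rule scalar_module_restrict)
  interpret N: additive_subgroup N V using N by (simp add: submod_def)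
  have sel: "carrier (restrict_module V N) = N" "\<zero>\<^bsub>restrict_module V N\<^esub> = \<zero>\<^bsub>V\<^esub>"
    "x \<oplus>\<^bsub>restrict_module V N\<^esub> y = x \<oplus>\<^bsub>V\<^esub> y" "ract (restrict_module V N) x a = ract V x a" for x y a
    by (simp_all add: restrict_module_def)
  show ?thesis
  proof
    assume *: "W.submod N'"
    then interpret N': additive_subgroup N' "restrict_module V N" by (simp add: W.submod_def)
    have sub: "N' \<subseteq> N" using N'.a_subset by (simp add: sel)
    have "additive_subgroup N' V"
    proof (rule V.additive_subgroupI)
      show "N' \<subseteq> carrier V" using sub N.a_subset by (rule subset_trans)
      show "\<exists>y\<in>N'. y \<oplus>\<^bsub>V\<^esub> x = \<zero>\<^bsub>V\<^esub>" if "x \<in> N'" for x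
        using that N'.a_inv_closed[OF that] W.V.l_neg[of x] subsetD[OF N'.a_subset that]
        by (intro bexI[of _ "\<ominus>\<^bsub>restrict_module V N\<^esub> x"]) (simp_all add: sel)
    qed (use N'.zero_closed N'.a_closed in \<open>simp_all add: sel\<close>)
    then show "submod N' \<and> N' \<subseteq> N" using * sub by (simp add: submod_def W.submod_def sel)
  next
    assume *: "submod N' \<and> N' \<subseteq> N"
    then interpret N': additive_subgroup N' V by (simp add: submod_def)
    have "additive_subgroup N' (restrict_module V N)"
    proof (rule W.V.additive_subgroupI)
      show "\<exists>y\<in>N'. y \<oplus>\<^bsub>restrict_module V N\<^esub> x = \<zero>\<^bsub>restrict_module V N\<^esub>" if "x \<in> N'" for x
        using that N'.a_inv_closed[OF that] V.l_neg[of x] subsetD[OF N'.a_subset that]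
        by (intro bexI[of _ "\<ominus>\<^bsub>V\<^esub> x"]) (simp_all add: sel)
    qed (use N'.zero_closed N'.a_closed * in \<open>simp_all add: sel\<close>)
    then show "W.submod N'" using * by (simp add: submod_def W.submod_def sel)
  qed
qed

lemma restrict_restrict [simp]:
  "restrict_module (restrict_module V N) N' = restrict_module V N'"
  by (simp add: restrict_module_def)

text \<open>The additive part of \<open>quotient_module\<close> is the factor group
  \<open>V A_Mod N\<close>, whose coset addition is stored as a multiplication; the group laws are
  transported along this identification of fields.\<close>

lemma abelian_group_quotient:
  assumes "submod N" shows "abelian_group (quotient_module V N)"
proof -
  interpret N: abelian_subgroup N V
    using assms V.abelian_group_axioms by (intro abelian_subgroupI3) (simp_all add: submod_def)
  interpret Q: comm_group "V A_Mod N" by (rule N.a_factorgroup_is_comm_group)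
  have sel: "carrier (V A_Mod N) = carrier (quotient_module V N)"
    "monoid.mult (V A_Mod N) = ring.add (quotient_module V N)"
    "\<one>\<^bsub>V A_Mod N\<^esub> = \<zero>\<^bsub>quotient_module V N\<^esub>"
    by (simp_all add: quotient_module_def A_FactGroup_def FactGroup_def A_RCOSETS_def set_add_def)
  show ?thesis
    by (rule abelian_groupI; rule Q.m_closed[unfolded sel] Q.one_closed[unfolded sel]
        Q.m_assoc[unfolded sel] Q.m_comm[unfolded sel] Q.l_one[unfolded sel] Q.l_inv_ex[unfolded sel];
        assumption)
qed

lemma simple_module_iff:
  "simple_module (carrier A) V \<longleftrightarrow>
    carrier V \<noteq> {\<zero>\<^bsub>V\<^esub>} \<and> (\<forall>N. submod N \<longrightarrow> N = {\<zero>\<^bsub>V\<^esub>} \<or> N = carrier V)"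
  by (simp add: simple_module_def submod_def)

text \<open>Correspondence of submodules: the union of the cosets in a submodule P of the quotient
  is a submodule of V above N. Maximality leaves N and V as its only values, and P is recovered as
  the set of cosets contained in it.\<close>

lemma simple_quotient_module:
  assumes N: "submod N" and ne: "N \<noteq> carrier V"
    and max: "\<And>N'. submod N' \<Longrightarrow> N \<subseteq> N' \<Longrightarrow> N' = N \<or> N' = carrier V"
  shows "simple_module (carrier A) (quotient_module V N)"
  unfolding simple_module_def
proof (intro conjI allI impI)
  let ?Q = "quotient_module V N"
  interpret N: abelian_subgroup N V
    using N V.abelian_group_axioms by (intro abelian_subgroupI3) (simp_all add: submod_def)
  interpret Q: abelian_group ?Q using N by (rule abelian_group_quotient)
  have carrier_Q: "carrier ?Q = a_rcosets\<^bsub>V\<^esub> N" and zero_Q: "\<zero>\<^bsub>?Q\<^esub> = N"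
    by (simp_all add: quotient_module_def)
  have coset: "N +>\<^bsub>V\<^esub> x \<in> carrier ?Q" "x \<in> N +>\<^bsub>V\<^esub> x" if "x \<in> carrier V" for x
    using that N.a_rcos_self by (auto simp: carrier_Q A_RCOSETS_def')
  have coset_eq: "X = N +>\<^bsub>V\<^esub> x" if "X \<in> carrier ?Q" "x \<in> X" for X x
  proof -
    from that(1) obtain y where y: "y \<in> carrier V" "X = N +>\<^bsub>V\<^esub> y"
      by (auto simp: carrier_Q A_RCOSETS_def')
    then show ?thesis using V.a_repr_independence[OF _ y(1) N.a_subgroup, of x] that(2) by simp
  qed
  have closed: "x \<in> carrier V" if "X \<in> carrier ?Q" "x \<in> X" for X x
    using subsetD[OF N.a_rcosets_carrier] that unfolding carrier_Q .
  have sub: "N \<subset> carrier V" using N.a_subset ne by (rule psubsetI)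
  show "carrier ?Q \<noteq> {\<zero>\<^bsub>?Q\<^esub>}"
  proof
    assume *: "carrier ?Q = {\<zero>\<^bsub>?Q\<^esub>}"
    obtain x where "x \<in> carrier V" "x \<notin> N" using sub by (rule psubsetE) auto
    with coset[of x] * zero_Q show False by auto
  qed
  fix P assume P: "additive_subgroup P ?Q \<and> (\<forall>v\<in>P. \<forall>a\<in>carrier A. ract ?Q v a \<in> P)"
  then interpret P: additive_subgroup P ?Q by (simp add: submod_def)
  have PQ: "X \<in> carrier ?Q" if "X \<in> P" for X using P.a_subset that by (rule subsetD)
  have add_mem: "x \<oplus>\<^bsub>V\<^esub> y \<in> X \<oplus>\<^bsub>?Q\<^esub> Y" if "x \<in> X" "y \<in> Y" for x y X Y
    using that by (auto simp: quotient_module_def set_add_def')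
  have "additive_subgroup (\<Union>P) V"
  proof (rule V.additive_subgroupI)
    show "\<Union>P \<subseteq> carrier V"
      using closed[OF PQ] by (intro Union_least subsetI)
    show "\<zero>\<^bsub>V\<^esub> \<in> \<Union>P" using P.zero_closed N.zero_closed zero_Q by auto
    show "x \<oplus>\<^bsub>V\<^esub> y \<in> \<Union>P" if "x \<in> \<Union>P" "y \<in> \<Union>P" for x y
    proof -
      obtain X Y where "X \<in> P" "x \<in> X" "Y \<in> P" "y \<in> Y" using \<open>x \<in> \<Union>P\<close> \<open>y \<in> \<Union>P\<close> by (elim UnionE)
      then show ?thesis by (intro UnionI[OF P.a_closed add_mem])
    qed
    show "\<exists>y\<in>\<Union>P. y \<oplus>\<^bsub>V\<^esub> x = \<zero>\<^bsub>V\<^esub>" if "x \<in> \<Union>P" for x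
    proof -
      obtain X where X: "X \<in> P" "x \<in> X" using \<open>x \<in> \<Union>P\<close> by (elim UnionE)
      let ?Y = "\<ominus>\<^bsub>?Q\<^esub> X"
      have Y: "?Y \<in> P" using X(1) by (rule P.a_inv_closed)
      have xV: "x \<in> carrier V" using PQ[OF X(1)] X(2) by (rule closed)
      \<comment> \<open>To find a negative of x, pick y in -X and z in X with y + z = 0. As z = n +
        x with n in N, the vector y + n is a negative of x that still lies in the coset -X.\<close>
      have "?Y \<oplus>\<^bsub>?Q\<^esub> X = N" using Q.l_neg[OF PQ[OF X(1)]] by (simp add: zero_Q)
      then have "\<zero>\<^bsub>V\<^esub> \<in> ?Y \<oplus>\<^bsub>?Q\<^esub> X" using N.zero_closed by simp
      then obtain y z where yz: "y \<in> ?Y" "z \<in> X" "\<zero>\<^bsub>V\<^esub> = y \<oplus>\<^bsub>V\<^esub> z"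
        by (auto simp: quotient_module_def set_add_def')
      have yV: "y \<in> carrier V" using PQ[OF Y] yz(1) by (rule closed)
      have "z \<in> N +>\<^bsub>V\<^esub> x" using coset_eq[OF PQ[OF X(1)] X(2)] yz(2) by simp
      then obtain n where n: "n \<in> N" "z = n \<oplus>\<^bsub>V\<^esub> x" by (auto simp: a_r_coset_def')
      have nV: "n \<in> carrier V" using N.a_subset n(1) by (rule subsetD)
      have "n \<oplus>\<^bsub>V\<^esub> y \<in> ?Y"
        using coset_eq[OF PQ[OF Y] yz(1)] n(1) by (auto simp: a_r_coset_def')
      then have "y \<oplus>\<^bsub>V\<^esub> n \<in> ?Y" using V.a_comm[OF yV nV] by simp
      moreover have "(y \<oplus>\<^bsub>V\<^esub> n) \<oplus>\<^bsub>V\<^esub> x = \<zero>\<^bsub>V\<^esub>"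
        using yz(3) n(2) xV yV nV by (simp add: V.a_assoc)
      ultimately show ?thesis using Y by (intro bexI[of _ "y \<oplus>\<^bsub>V\<^esub> n"] UnionI)
    qed
  qed
  moreover have "ract V v a \<in> \<Union>P" if "v \<in> \<Union>P" "a \<in> carrier A" for v a
  proof -
    obtain X where X: "X \<in> P" "v \<in> X" using \<open>v \<in> \<Union>P\<close> by (elim UnionE)
    \<comment> \<open>The quotient action sends X to the union of the cosets N + x a over x in X.
      This set contains v a and is a member of P, so v a lies in the union of P.\<close>
    have "ract V v a \<in> N +>\<^bsub>V\<^esub> ract V v a"
      using closed[OF PQ[OF X(1)] X(2)] \<open>a \<in> carrier A\<close> by (intro coset ract_closed)
    then have "ract V v a \<in> ract ?Q X a" using X(2) by (auto simp: quotient_module_def)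
    moreover have "ract ?Q X a \<in> P" using P X(1) \<open>a \<in> carrier A\<close> by simp
    ultimately show ?thesis by (rule UnionI[rotated])
  qed
  ultimately have "submod (\<Union>P)" by (simp add: submod_def)
  moreover have "N \<subseteq> \<Union>P" using P.zero_closed zero_Q by auto
  ultimately have "\<Union>P = N \<or> \<Union>P = carrier V" by (rule max)
  then show "P = {\<zero>\<^bsub>?Q\<^esub>} \<or> P = carrier ?Q"
  proof (elim disjE)
    assume *: "\<Union>P = N"
    have "X \<in> {N}" if X: "X \<in> P" for X
    proof -
      have "X \<in> a_rcosets\<^bsub>V\<^esub> N" using PQ[OF X] by (simp add: carrier_Q)
      then obtain x where x: "x \<in> carrier V" "X = N +>\<^bsub>V\<^esub> x" by (auto simp: A_RCOSETS_def')
      then have "x \<in> X" using coset(2) by simp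
      then have "x \<in> N" using X * by auto
      then show ?thesis using x(2) N.a_rcos_const by simp
    qed
    then have "P \<subseteq> {N}" by (rule subsetI)
    moreover have "{N} \<subseteq> P" using P.zero_closed unfolding zero_Q by simp
    ultimately have "P = {N}" by (rule equalityI)
    then show ?thesis by (simp add: zero_Q)
  next
    assume *: "\<Union>P = carrier V"
    have "X \<in> P" if X: "X \<in> carrier ?Q" for X
    proof -
      from X obtain x where x: "x \<in> carrier V" "X = N +>\<^bsub>V\<^esub> x" by (auto simp: A_RCOSETS_def' carrier_Q)
      then have "x \<in> \<Union>P" using * by simp
      then obtain Y where Y: "Y \<in> P" "x \<in> Y" by (elim UnionE)
      then have "Y = X" using coset_eq[OF PQ[OF Y(1)] Y(2)] x(2) by simp
      then show ?thesis using Y(1) by simp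
    qed
    then have "carrier ?Q \<subseteq> P" by (rule subsetI)
    with P.a_subset have "P = carrier ?Q" by (rule equalityI)
    then show ?thesis by simp
  qed
qed

lemma quotient_by_zero:
  defines "Q \<equiv> quotient_module V {\<zero>\<^bsub>V\<^esub>}"
  shows "carrier Q = (\<lambda>x. {x}) ` carrier V" "\<zero>\<^bsub>Q\<^esub> = {\<zero>\<^bsub>V\<^esub>}" "{x} \<oplus>\<^bsub>Q\<^esub> {y} = {x \<oplus>\<^bsub>V\<^esub> y}"
    "x \<in> carrier V \<Longrightarrow> a \<in> carrier A \<Longrightarrow> ract Q {x} a = {ract V x a}"
proof -
  have "{\<zero>\<^bsub>V\<^esub>} +>\<^bsub>V\<^esub> x = {x}" if "x \<in> carrier V" for x
    using that by (simp add: a_r_coset_def')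
  then show "carrier Q = (\<lambda>x. {x}) ` carrier V"
    "x \<in> carrier V \<Longrightarrow> a \<in> carrier A \<Longrightarrow> ract Q {x} a = {ract V x a}"
    by (auto simp: Q_def quotient_module_def A_RCOSETS_def' ract_closed)
qed (simp_all add: Q_def quotient_module_def set_add_def')

text \<open>The quotient lives in the type of sets of elements; this isomorphism brings the first
  factor of a composition series back to the type of the objects and of the
  \<open>S i\<close>.\<close>

lemma quotient_by_zero_isomorphic:
  "module_isomorphic (carrier A) (quotient_module V {\<zero>\<^bsub>V\<^esub>}) V"
  unfolding module_isomorphic_def
proof (intro exI[of _ the_elem] conjI ballI)
  show "bij_betw the_elem (carrier (quotient_module V {\<zero>\<^bsub>V\<^esub>})) (carrier V)"
    unfolding quotient_by_zero by (auto simp: bij_betw_def inj_on_def image_image)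
qed (auto simp: quotient_by_zero)

text \<open>Forming singletons maps submodules of V to submodules of the quotient and is injective
  on sets, so the two alternatives in the quotient pull back to V.\<close>

lemma simple_of_quotient_by_zero:
  assumes "simple_module (carrier A) (quotient_module V {\<zero>\<^bsub>V\<^esub>})"
  shows "simple_module (carrier A) V"
proof -
  let ?Q = "quotient_module V {\<zero>\<^bsub>V\<^esub>}"
  interpret Q: abelian_group ?Q by (rule abelian_group_quotient[OF submod_zero])
  have ne: "carrier V \<noteq> {\<zero>\<^bsub>V\<^esub>}"
  proof
    assume "carrier V = {\<zero>\<^bsub>V\<^esub>}"
    then have "carrier ?Q = {\<zero>\<^bsub>?Q\<^esub>}" by (simp add: quotient_by_zero)
    with conjunct1[OF assms[unfolded simple_module_def]] show False by (rule notE)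
  qed
  have "N = {\<zero>\<^bsub>V\<^esub>} \<or> N = carrier V" if N: "submod N" for N
  proof -
    interpret N: additive_subgroup N V using N by (simp add: submod_def)
    let ?P = "(\<lambda>x. {x}) ` N"
    have "additive_subgroup ?P ?Q"
    proof (rule Q.additive_subgroupI)
      show "?P \<subseteq> carrier ?Q" using N.a_subset by (simp add: quotient_by_zero image_mono)
      show "\<exists>Y\<in>?P. Y \<oplus>\<^bsub>?Q\<^esub> X = \<zero>\<^bsub>?Q\<^esub>" if "X \<in> ?P" for X
      proof -
        obtain x where x: "x \<in> N" "X = {x}" using \<open>X \<in> ?P\<close> by (elim imageE)
        have "\<ominus>\<^bsub>V\<^esub> x \<oplus>\<^bsub>V\<^esub> x = \<zero>\<^bsub>V\<^esub>" using subsetD[OF N.a_subset x(1)] by (rule V.l_neg)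
        then show ?thesis using N.a_inv_closed[OF x(1)]
          by (intro bexI[of _ "{\<ominus>\<^bsub>V\<^esub> x}"]) (simp_all add: quotient_by_zero x(2))
      qed
    qed (auto simp: quotient_by_zero)
    moreover have "\<forall>X\<in>?P. \<forall>a\<in>carrier A. ract ?Q X a \<in> ?P"
    proof (intro ballI)
      fix X a assume "X \<in> ?P" and a: "a \<in> carrier A"
      then obtain x where x: "x \<in> N" "X = {x}" by (elim imageE)
      have "ract V x a \<in> N" using N x(1) a by (simp add: submod_def)
      then show "ract ?Q X a \<in> ?P"
        using quotient_by_zero(4)[OF subsetD[OF N.a_subset x(1)] a] by (simp add: x(2))
    qed
    ultimately have "?P = {\<zero>\<^bsub>?Q\<^esub>} \<or> ?P = carrier ?Q"
      using conjunct2[OF assms[unfolded simple_module_def]] by simp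
    then show ?thesis
      by (auto simp: quotient_by_zero inj_image_eq_iff[OF inj_singleton] simp flip: image_insert)
  qed
  then show ?thesis using ne by (simp add: simple_module_iff)
qed

text \<open>Strong induction on \<open>d N\<close>: a proper submodule M of N with the largest value
  of d is maximal among the proper ones, so the factor N / M is simple and N can be appended to a
  chain for M.\<close>

lemma exists_composition_chain:
  fixes d :: "'m set \<Rightarrow> nat"
  assumes d: "\<And>N N'. submod N \<Longrightarrow> submod N' \<Longrightarrow> N \<subset> N' \<Longrightarrow> d N < d N'"
    and "submod N"
  shows "\<exists>Ns. Ns \<noteq> [] \<and> hd Ns = {\<zero>\<^bsub>V\<^esub>} \<and> last Ns = N \<and> (\<forall>N'\<in>set Ns. submod N' \<and> N' \<subseteq> N) \<and>
    (\<forall>k. Suc k < length Ns \<longrightarrow> Ns ! k \<subseteq> Ns ! Suc k \<and>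
      simple_module (carrier A) (quotient_module (restrict_module V (Ns ! Suc k)) (Ns ! k)))"
  using \<open>submod N\<close>
proof (induction "d N" arbitrary: N rule: less_induct)
  case less
  note N = \<open>submod N\<close>
  interpret N: additive_subgroup N V using N by (simp add: submod_def)
  show ?case
  proof (cases "N = {\<zero>\<^bsub>V\<^esub>}")
    case True
    then show ?thesis using N by (intro exI[of _ "[N]"]) simp
  next
    case False
    let ?P = "\<lambda>M. submod M \<and> M \<subset> N"
    have "?P {\<zero>\<^bsub>V\<^esub>}" using False N.zero_closed submod_zero by auto
    moreover have "\<forall>M. ?P M \<longrightarrow> d M < d N"
      using d[OF _ N] by (intro allI impI) simp
    ultimately obtain M where M: "?P M" and max: "\<forall>M'. ?P M' \<longrightarrow> d M' \<le> d M"
      using ex_has_greatest_nat[of ?P "{\<zero>\<^bsub>V\<^esub>}" d "d N"] by auto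
    have "d M < d N" using M d[OF _ N] by simp
    from less.hyps[OF this] M obtain Ns where Ns: "Ns \<noteq> []" "hd Ns = {\<zero>\<^bsub>V\<^esub>}" "last Ns = M"
      "\<forall>N'\<in>set Ns. submod N' \<and> N' \<subseteq> M"
      "\<forall>k. Suc k < length Ns \<longrightarrow> Ns ! k \<subseteq> Ns ! Suc k \<and>
        simple_module (carrier A) (quotient_module (restrict_module V (Ns ! Suc k)) (Ns ! k))"
      by (elim conjE impE exE meta_impE) simp
    interpret W: scalar_module K A \<iota> "restrict_module V N"
      using N by (rule scalar_module_restrict)
    have carrier_W: "carrier (restrict_module V N) = N" by (simp add: restrict_module_def)
    have top: "simple_module (carrier A) (quotient_module (restrict_module V N) M)"
    proof (rule W.simple_quotient_module)
      show "W.submod M" using M submod_restrict_iff[OF N] by (simp add: psubset_imp_subset)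
      show "M \<noteq> carrier (restrict_module V N)" using M by (auto simp: carrier_W)
      fix N' assume "W.submod N'" "M \<subseteq> N'"
      then have N': "submod N'" "N' \<subseteq> N" using submod_restrict_iff[OF N] by simp_all
      have "\<not> (M \<subset> N' \<and> N' \<subset> N)"
      proof
        assume *: "M \<subset> N' \<and> N' \<subset> N"
        then have "d N' \<le> d M" using max N'(1) by simp
        moreover have "d M < d N'" using d[OF _ N'(1)] M * by simp
        ultimately show False by simp
      qed
      then show "N' = M \<or> N' = carrier (restrict_module V N)"
        using \<open>M \<subseteq> N'\<close> N'(2) unfolding carrier_W psubset_eq by metis
    qed
    have "(Ns @ [N]) ! k \<subseteq> (Ns @ [N]) ! Suc k \<and>
        simple_module (carrier A) (quotient_module (restrict_module V ((Ns @ [N]) ! Suc k)) ((Ns @ [N]) ! k))"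
      if "Suc k < length (Ns @ [N])" for k
    proof (cases "Suc k < length Ns")
      case True
      then show ?thesis using Ns(5) by (simp add: nth_append)
    next
      case False
      then have "k = length Ns - 1" "Suc k = length Ns" using that by auto
      then have "(Ns @ [N]) ! k = M" "(Ns @ [N]) ! Suc k = N"
        using Ns(1,3) by (simp_all add: nth_append last_conv_nth)
      then show ?thesis using top M by auto
    qed
    moreover have "\<forall>N'\<in>set (Ns @ [N]). submod N' \<and> N' \<subseteq> N" using Ns(4) M N by auto
    ultimately show ?thesis using Ns(1,2) by (intro exI[of _ "Ns @ [N]"]) simp
  qed
qed

lemma exists_composition_series:
  fixes d :: "'m set \<Rightarrow> nat"
  assumes d: "\<And>N N'. submod N \<Longrightarrow> submod N' \<Longrightarrow> N \<subset> N' \<Longrightarrow> d N < d N'"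
    and N: "submod N" and L: "scalars L = carrier A"
  shows "\<exists>Ns. composition_series L (restrict_module V N) Ns"
proof -
  have "submodule_of L N' (restrict_module V N) \<longleftrightarrow> submod N' \<and> N' \<subseteq> N" for N'
    using submod_restrict_iff[OF N, of N']
      scalar_module.submod_def[OF scalar_module_restrict[OF N], of N']
    by (simp add: submodule_of_def L)
  moreover have "\<zero>\<^bsub>restrict_module V N\<^esub> = \<zero>\<^bsub>V\<^esub>" "carrier (restrict_module V N) = N"
    by (simp_all add: restrict_module_def)
  ultimately show ?thesis
    using exists_composition_chain[OF d N] by (simp add: composition_series_def L)
qed

end

section \<open>Dimension vectors of nonzero submodules\<close>

text \<open>The assumption \<open>sub_simple\<close> bridges the gap between simple modules and
  simple objects: S classifies objects of L, and the first nonzero term of a composition series has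
  to be shown to be one.\<close>

lemma (in scalar_ring) length_categoryI:
  fixes L :: "('a, 'm) module_category"
  assumes L: "scalars L = carrier A" and simple: "simple_objects L S"
    and right: "\<And>V. V \<in> objects L \<Longrightarrow> right_module A V"
    and spanned: "\<And>V. V \<in> objects L \<Longrightarrow> \<exists>G. finite G \<and> G \<subseteq> carrier V \<and>
      carrier V \<subseteq> action_span (carrier K) (\<lambda>v k. ract V v (\<iota> k)) V G"
    and sub_simple: "\<And>V N. V \<in> objects L \<Longrightarrow> submodule_of L N V \<Longrightarrow>
      simple_module (carrier A) (restrict_module V N) \<Longrightarrow> restrict_module V N \<in> objects L"
  shows "length_category L S"
proof -
  have main: "submodule_of L {\<zero>\<^bsub>V\<^esub>} V" "submodule_of L (carrier V) V"
    "real_dim L S (restrict_module V {\<zero>\<^bsub>V\<^esub>}) = 0"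
    "submodule_of L N V \<Longrightarrow> N \<noteq> {\<zero>\<^bsub>V\<^esub>} \<Longrightarrow> real_dim L S (restrict_module V N) \<noteq> 0"
    if V: "V \<in> objects L" for V N
  proof -
    interpret V: scalar_module K A \<iota> V
      using right[OF V] by (intro scalar_module.intro scalar_ring_axioms scalar_module_axioms.intro)
    have sub_iff: "submodule_of L N V \<longleftrightarrow> V.submod N" for N
      by (simp add: submodule_of_def V.submod_def L)
    then show "submodule_of L {\<zero>\<^bsub>V\<^esub>} V" "submodule_of L (carrier V) V"
      by (simp_all add: V.submod_zero V.submod_carrier)
    obtain G where G: "finite G" "G \<subseteq> carrier V" "carrier V \<subseteq> V.span G"
      using spanned[OF V] by (elim exE conjE)
    obtain d :: "'m set \<Rightarrow> nat"
      where "\<forall>N N'. V.submod N \<longrightarrow> V.submod N' \<longrightarrow> N \<subset> N' \<longrightarrow> d N < d N'"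
      using V.submod_length_function[OF G] by (rule exE)
    then have d: "d N < d N'" if "V.submod N" "V.submod N'" "N \<subset> N'" for N N'
      using that by simp
    \<comment> \<open>\<open>dim_vector\<close> evaluates \<open>multiplicities\<close> at a list
      picked by choice; the existence of a composition series guarantees that this list is
      one.\<close>
    have series: "\<exists>Ns. composition_series L (restrict_module V N) Ns \<and>
        dim_vector L S (restrict_module V N) = multiplicities L S (restrict_module V N) Ns"
      if "V.submod N" for N
      using someI_ex[OF V.exists_composition_series[OF d that L]] unfolding dim_vector_def
      by (intro exI[of _ "SOME Ns. composition_series L (restrict_module V N) Ns"]) simp
    have sub_restrict: "submodule_of L N' (restrict_module V N) \<longleftrightarrow> V.submod N' \<and> N' \<subseteq> N"
      if "V.submod N" for N N'
      using V.submod_restrict_iff[OF that, of N']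
        scalar_module.submod_def[OF V.scalar_module_restrict[OF that], of N']
      by (simp add: submodule_of_def L)
    have zero_mem: "\<zero>\<^bsub>V\<^esub> \<in> N" if "V.submod N" for N
      using that additive_subgroup.zero_closed by (auto simp: V.submod_def)
    show "real_dim L S (restrict_module V {\<zero>\<^bsub>V\<^esub>}) = 0"
    proof -
      let ?W = "restrict_module V {\<zero>\<^bsub>V\<^esub>}"
      obtain Ns where Ns: "composition_series L ?W Ns"
        and dim: "dim_vector L S ?W = multiplicities L S ?W Ns"
        using series[OF V.submod_zero] by (elim exE conjE)
      interpret W: scalar_module K A \<iota> ?W
        by (rule V.scalar_module_restrict[OF V.submod_zero])
      \<comment> \<open>All terms are zero, so a factor would be the quotient of the zero module by
        itself, which is not simple. The series thus has a single term and contributes no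
        factor.\<close>
      have "\<not> Suc k < length Ns" for k
      proof
        assume k: "Suc k < length Ns"
        have "\<forall>N\<in>set Ns. N = {\<zero>\<^bsub>V\<^esub>}"
          using Ns zero_mem sub_restrict[OF V.submod_zero] by (auto simp: composition_series_def)
        then have "Ns ! k = {\<zero>\<^bsub>V\<^esub>}" "Ns ! Suc k = {\<zero>\<^bsub>V\<^esub>}" using k by simp_all
        moreover have "simple_module (carrier A) (quotient_module (restrict_module ?W (Ns ! Suc k)) (Ns ! k))"
          using Ns k unfolding composition_series_def L by metis
        ultimately have "simple_module (carrier A) (quotient_module ?W {\<zero>\<^bsub>V\<^esub>})" by simp
        then have "simple_module (carrier A) ?W"
          using W.simple_of_quotient_by_zero by (simp add: restrict_module_def)
        then show False by (simp add: simple_module_def restrict_module_def)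
      qed
      then show ?thesis by (simp add: real_dim_def dim multiplicities_def vec_eq_iff)
    qed
    show "real_dim L S (restrict_module V N) \<noteq> 0" if "submodule_of L N V" and ne: "N \<noteq> {\<zero>\<^bsub>V\<^esub>}"
    proof -
      have N: "V.submod N" using that(1) sub_iff by simp
      let ?W = "restrict_module V N"
      obtain Ns where Ns: "composition_series L ?W Ns"
        and dim: "dim_vector L S ?W = multiplicities L S ?W Ns"
        using series[OF N] by (elim exE conjE)
      have ends: "Ns \<noteq> []" "hd Ns = {\<zero>\<^bsub>V\<^esub>}" "last Ns = N"
        using Ns by (simp_all add: composition_series_def restrict_module_def)
      have "Suc 0 < length Ns"
      proof (rule ccontr)
        assume "\<not> Suc 0 < length Ns"
        then have "length Ns = 1" using ends(1) by (cases Ns) auto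
        then have "hd Ns = last Ns" by (cases Ns) auto
        with ends ne show False by simp
      qed
      then have zero: "Ns ! 0 = {\<zero>\<^bsub>V\<^esub>}" and mem: "Ns ! Suc 0 \<in> set Ns"
        using ends by (simp_all add: hd_conv_nth)
      let ?X = "restrict_module V (Ns ! Suc 0)"
      have X: "V.submod (Ns ! Suc 0)" and simple_Q: "simple_module (carrier A) (quotient_module ?X {\<zero>\<^bsub>V\<^esub>})"
        using Ns \<open>Suc 0 < length Ns\<close> mem sub_restrict[OF N] zero
        by (auto simp: composition_series_def L)
      interpret X: scalar_module K A \<iota> ?X by (rule V.scalar_module_restrict[OF X])
      have zero_X: "\<zero>\<^bsub>?X\<^esub> = \<zero>\<^bsub>V\<^esub>" by (simp add: restrict_module_def)
      have simple_X: "simple_module (carrier A) ?X"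
        using simple_Q by (rule X.simple_of_quotient_by_zero[unfolded zero_X])
      then have "?X \<in> objects L" using X sub_iff by (intro sub_simple[OF V]) simp_all
      then obtain i where "module_isomorphic (carrier A) ?X (S i)"
        using simple simple_X by (auto simp: simple_objects_def L)
      then have "module_isomorphic (carrier A) (quotient_module ?X {\<zero>\<^bsub>V\<^esub>}) (S i)"
        using module_isomorphic_trans[OF X.quotient_by_zero_isomorphic] by (simp add: zero_X)
      then have "0 \<in> {k. Suc k < length Ns \<and> module_isomorphic (scalars L)
          (quotient_module (restrict_module ?W (Ns ! Suc k)) (Ns ! k)) (S i)}"
        using \<open>Suc 0 < length Ns\<close> zero by (simp add: L)
      \<comment> \<open>\<open>card\<close> of an infinite set is 0, so the presence of index 0
        makes the multiplicity positive only together with finiteness.\<close>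
      moreover have "finite {k. Suc k < length Ns \<and> module_isomorphic (scalars L)
          (quotient_module (restrict_module ?W (Ns ! Suc k)) (Ns ! k)) (S i)}"
        by (rule finite_subset[of _ "{..<length Ns}"]) auto
      ultimately have "dim_vector L S ?W $ i \<noteq> 0"
        by (auto simp: dim multiplicities_def card_eq_0_iff)
      then show ?thesis by (auto simp: real_dim_def vec_eq_iff)
    qed
  qed
  show ?thesis by (rule length_category.intro) (rule main; assumption)+
qed

text \<open>For nonzero w the set w A is a submodule containing w = w 1, hence all of V. Through
  this, simple submodules inherit the finiteness conditions that define the objects.\<close>

lemma (in scalar_module) simple_module_cyclic:
  assumes "simple_module (carrier A) V"
  shows "\<exists>w\<in>carrier V. carrier V = ract V w ` carrier A"
proof -
  have "carrier V \<noteq> {\<zero>\<^bsub>V\<^esub>}" using assms by (simp only: simple_module_iff simp_thms)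
  then obtain w where w: "w \<in> carrier V" "w \<noteq> \<zero>\<^bsub>V\<^esub>" using V.zero_closed by auto
  let ?X = "ract V w ` carrier A"
  have one: "\<one>\<^bsub>A\<^esub> \<in> carrier A" using iota_closed[OF K.one_closed] by (simp add: iota_one)
  have zero: "\<iota> \<zero>\<^bsub>K\<^esub> \<in> carrier A" and minus: "\<iota> (\<ominus>\<^bsub>K\<^esub> \<one>\<^bsub>K\<^esub>) \<in> carrier A"
    by (simp_all add: iota_closed)
  have "additive_subgroup ?X V"
  proof (rule V.additive_subgroupI)
    show "?X \<subseteq> carrier V" using w(1) by (intro image_subsetI ract_closed)
    show "\<zero>\<^bsub>V\<^esub> \<in> ?X" using smult_zero[OF w(1)] zero by (intro image_eqI[of _ _ "\<iota> \<zero>\<^bsub>K\<^esub>"]) simp_all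
    show "x \<oplus>\<^bsub>V\<^esub> y \<in> ?X" if xy: "x \<in> ?X" "y \<in> ?X" for x y
    proof -
      obtain a b where ab: "a \<in> carrier A" "x = ract V w a" "b \<in> carrier A" "y = ract V w b"
        using xy by (elim imageE)
      then show ?thesis
        using w(1) by (intro image_eqI[of _ _ "a \<oplus>\<^bsub>A\<^esub> b"]) (simp_all add: ract_add_right scalar_add_closed)
    qed
    show "\<exists>y\<in>?X. y \<oplus>\<^bsub>V\<^esub> x = \<zero>\<^bsub>V\<^esub>" if x: "x \<in> ?X" for x
    proof -
      obtain a where a: "a \<in> carrier A" "x = ract V w a" using x by (elim imageE)
      then have xV: "x \<in> carrier V" using w(1) by (simp add: ract_closed)
      \<comment> \<open>Negation in A is not part of \<open>scalar_ring\<close>; the negative of w a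
        is obtained by letting \<iota>(-1) act on it, that is, as w (a \<iota>(-1)).\<close>
      have "\<ominus>\<^bsub>V\<^esub> x = ract V w (a \<otimes>\<^bsub>A\<^esub> \<iota> (\<ominus>\<^bsub>K\<^esub> \<one>\<^bsub>K\<^esub>))"
        using smult_minus_one[OF xV] a minus w(1) by (simp add: ract_mult)
      then have "\<ominus>\<^bsub>V\<^esub> x \<in> ?X" using a(1) minus by (simp add: scalar_mult_closed)
      then show ?thesis using V.l_neg[OF xV] by (rule bexI[rotated])
    qed
  qed
  moreover have "ract V v b \<in> ?X" if v: "v \<in> ?X" and b: "b \<in> carrier A" for v b
  proof -
    obtain a where "a \<in> carrier A" "v = ract V w a" using v by (elim imageE)
    then show ?thesis
      using w(1) b by (intro image_eqI[of _ _ "a \<otimes>\<^bsub>A\<^esub> b"]) (simp_all add: ract_mult scalar_mult_closed)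
  qed
  ultimately have "submod ?X" by (simp add: submod_def)
  then have "?X = {\<zero>\<^bsub>V\<^esub>} \<or> ?X = carrier V" using assms by (simp only: simple_module_iff simp_thms)
  moreover have "w \<in> ?X" using one ract_one[OF w(1)] by (intro image_eqI[of _ _ "\<one>\<^bsub>A\<^esub>"]) simp_all
  ultimately show ?thesis using w by auto
qed

section \<open>Modules over finite dimensional algebras\<close>

lemma scalar_ring_fd_algebra:
  assumes A: "fd_algebra K A"
  shows "scalar_ring K A (\<lambda>k. k \<odot>\<^bsub>A\<^esub> \<one>\<^bsub>A\<^esub>)"
proof -
  interpret K: field K using A by (simp add: fd_algebra_def)
  interpret R: ring A using A by (simp add: fd_algebra_def)
  interpret M: Module.module K A using A by (simp add: fd_algebra_def)
  have mult: "(k \<odot>\<^bsub>A\<^esub> x) \<otimes>\<^bsub>A\<^esub> y = k \<odot>\<^bsub>A\<^esub> (x \<otimes>\<^bsub>A\<^esub> y)"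
    if "k \<in> carrier K" "x \<in> carrier A" "y \<in> carrier A" for k x y
    using A that by (simp add: fd_algebra_def)
  show ?thesis
    by unfold_locales (simp_all add: mult M.smult_l_distr M.smult_assoc1)
qed

text \<open>A simple submodule has the form w A. If B spans A over K, the finitely many vectors w b
  with b in B span w A over K, so it is again an object.\<close>

lemma length_category_mod_category:
  fixes S :: "'n::finite \<Rightarrow> ('a, 'm) rmodule"
  assumes A: "fd_algebra K A" and S: "simple_objects (mod_category K A) S"
  shows "length_category (mod_category K A) S"
proof -
  interpret scalar_ring K A "\<lambda>k. k \<odot>\<^bsub>A\<^esub> \<one>\<^bsub>A\<^esub>" using A by (rule scalar_ring_fd_algebra)
  interpret R: ring A using A by (simp add: fd_algebra_def)
  have objects: "V \<in> objects (mod_category K A) \<longleftrightarrow> right_module A V \<and>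
      spanned_over (carrier K) (\<lambda>v k. ract V v (k \<odot>\<^bsub>A\<^esub> \<one>\<^bsub>A\<^esub>)) V" for V :: "('a, 'm) rmodule"
    by (simp add: mod_category_def)
  have scalars: "scalars (mod_category K A) = carrier A" by (simp add: mod_category_def)
  show ?thesis
  proof (rule length_categoryI[OF scalars S])
    fix V :: "('a, 'm) rmodule" assume V: "V \<in> objects (mod_category K A)"
    then show right: "right_module A V" by (simp add: objects)
    then interpret V: scalar_module K A "\<lambda>k. k \<odot>\<^bsub>A\<^esub> \<one>\<^bsub>A\<^esub>" V
      by (intro scalar_module.intro scalar_ring_axioms scalar_module_axioms.intro)
    show "\<exists>G. finite G \<and> G \<subseteq> carrier V \<and> carrier V \<subseteq> V.span G"
      using V by (intro V.spanned_over_imp_span) (simp add: objects)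
    fix N assume "submodule_of (mod_category K A) N V"
      and simple: "simple_module (carrier A) (restrict_module V N)"
    then have N: "V.submod N" by (simp add: submodule_of_def V.submod_def scalars)
    interpret W: scalar_module K A "\<lambda>k. k \<odot>\<^bsub>A\<^esub> \<one>\<^bsub>A\<^esub>" "restrict_module V N"
      using N by (rule V.scalar_module_restrict)
    let ?W = "restrict_module V N"
    obtain w where w: "w \<in> carrier ?W" "carrier ?W = ract ?W w ` carrier A"
      using W.simple_module_cyclic[OF simple] by (elim bexE)
    obtain B where B: "finite B" "B \<subseteq> carrier A"
      "\<forall>a\<in>carrier A. \<exists>c. (\<forall>b\<in>B. c b \<in> carrier K) \<and> a = (\<Oplus>\<^bsub>A\<^esub>b\<in>B. c b \<odot>\<^bsub>A\<^esub> b)"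
      using A unfolding fd_algebra_def spanned_over_def by (elim exE conjE)
    let ?G = "ract ?W w ` B"
    have G: "?G \<subseteq> carrier ?W" unfolding w(2) using B(2) by (rule image_mono)
    have "ract ?W w a \<in> W.span ?G" if a: "a \<in> carrier A" for a
    proof -
      obtain c where c: "\<forall>b\<in>B. c b \<in> carrier K" "a = (\<Oplus>\<^bsub>A\<^esub>b\<in>B. c b \<odot>\<^bsub>A\<^esub> b)"
        using bspec[OF B(3) a] by (elim exE conjE)
      have "(\<Oplus>\<^bsub>A\<^esub>b\<in>B. c b \<odot>\<^bsub>A\<^esub> b) \<in> {a \<in> carrier A. ract ?W w a \<in> W.span ?G}"
      proof (rule R.finsum_mem_closed[OF B(1)])
        fix b assume b: "b \<in> B"
        then have bA: "b \<in> carrier A" and k: "c b \<in> carrier K" using B(2) c(1) by auto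
        \<comment> \<open>In a right module the scalar has to act last: K is central in A, so k b =
          b (k 1), which acts as b followed by k.\<close>
        have eq: "c b \<odot>\<^bsub>A\<^esub> b = b \<otimes>\<^bsub>A\<^esub> (c b \<odot>\<^bsub>A\<^esub> \<one>\<^bsub>A\<^esub>)"
          using A bA k by (simp add: fd_algebra_def)
        have "W.smult (ract ?W w b) (c b) \<in> W.span ?G"
          using b k by (intro span_act span_base imageI)
        then show "c b \<odot>\<^bsub>A\<^esub> b \<in> {a \<in> carrier A. ract ?W w a \<in> W.span ?G}"
          using bA k w(1) by (simp add: eq W.ract_mult iota_closed)
      next
        have "ract ?W w \<zero>\<^bsub>A\<^esub> \<oplus>\<^bsub>?W\<^esub> ract ?W w \<zero>\<^bsub>A\<^esub> = ract ?W w \<zero>\<^bsub>A\<^esub>"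
          using w(1) by (simp flip: W.ract_add_right)
        then have "ract ?W w \<zero>\<^bsub>A\<^esub> = \<zero>\<^bsub>?W\<^esub>" using w(1) by (simp add: W.ract_closed)
        then show "\<zero>\<^bsub>A\<^esub> \<in> {a \<in> carrier A. ract ?W w a \<in> W.span ?G}" by (simp add: span_zero)
      next
        fix x y assume "x \<in> {a \<in> carrier A. ract ?W w a \<in> W.span ?G}"
          "y \<in> {a \<in> carrier A. ract ?W w a \<in> W.span ?G}"
        then show "x \<oplus>\<^bsub>A\<^esub> y \<in> {a \<in> carrier A. ract ?W w a \<in> W.span ?G}"
          using w(1) by (simp add: W.ract_add_right span_add)
      qed simp
      then show ?thesis by (simp add: c(2))
    qed
    then have "carrier ?W \<subseteq> W.span ?G" unfolding w(2) by (rule image_subsetI)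
    then have "spanned_over (carrier K) W.smult ?W"
      using B(1) G by (intro W.span_imp_spanned_over) simp_all
    then show "?W \<in> objects (mod_category K A)" using W.right_module by (simp add: objects)
  qed
qed

section \<open>Tensor algebras of modulated quivers\<close>

text \<open>The second argument of \<open>tensor_concat\<close> enters through the function that is
  extended; this makes the operation additive in it.\<close>

lemma frag_extend_diff_fun:
  "frag_extend (\<lambda>u. f u - g u) x = frag_extend f x - frag_extend g x"
  by (rule frag_induction[of x UNIV]) (simp_all add: frag_extend_diff)

locale tensor_setting =
  fixes K :: "'k ring" and F :: "'n::finite \<Rightarrow> ('k, 'f) module"
    and M :: "'n \<Rightarrow> 'n \<Rightarrow> ('f, 'b) bimodule"
  assumes modulated: "modulated_quiver K F M"
begin

sublocale K: field K using modulated by (simp add: modulated_quiver_def)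

sublocale F: ring "F i" for i
  using modulated by (simp add: modulated_quiver_def fd_division_algebra_def fd_algebra_def)

sublocale FK: Module.module K "F i" for i
  using modulated by (simp add: modulated_quiver_def fd_division_algebra_def fd_algebra_def)

sublocale B: abelian_group "M i j" for i j
  using modulated by (simp add: modulated_quiver_def fd_bimodule_def)

lemma bimodule: "fd_bimodule K (F i) (F j) (M i j)"
  using modulated by (simp add: modulated_quiver_def)

lemma fd_algebra_F: "fd_algebra K (F i)"
  using modulated by (simp add: modulated_quiver_def fd_division_algebra_def)

lemma bleft_closed: "f \<in> carrier (F i) \<Longrightarrow> m \<in> carrier (M i j) \<Longrightarrow> bleft (M i j) f m \<in> carrier (M i j)"
  and bright_closed: "m \<in> carrier (M i j) \<Longrightarrow> g \<in> carrier (F j) \<Longrightarrow> bright (M i j) m g \<in> carrier (M i j)"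
  and bleft_add: "f \<in> carrier (F i) \<Longrightarrow> m \<in> carrier (M i j) \<Longrightarrow> m' \<in> carrier (M i j) \<Longrightarrow>
    bleft (M i j) f (m \<oplus>\<^bsub>M i j\<^esub> m') = bleft (M i j) f m \<oplus>\<^bsub>M i j\<^esub> bleft (M i j) f m'"
  and bleft_add_scalar: "f \<in> carrier (F i) \<Longrightarrow> f' \<in> carrier (F i) \<Longrightarrow> m \<in> carrier (M i j) \<Longrightarrow>
    bleft (M i j) (f \<oplus>\<^bsub>F i\<^esub> f') m = bleft (M i j) f m \<oplus>\<^bsub>M i j\<^esub> bleft (M i j) f' m"
  and bright_add: "m \<in> carrier (M i j) \<Longrightarrow> m' \<in> carrier (M i j) \<Longrightarrow> g \<in> carrier (F j) \<Longrightarrow>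
    bright (M i j) (m \<oplus>\<^bsub>M i j\<^esub> m') g = bright (M i j) m g \<oplus>\<^bsub>M i j\<^esub> bright (M i j) m' g"
  and bright_add_scalar: "m \<in> carrier (M i j) \<Longrightarrow> g \<in> carrier (F j) \<Longrightarrow> g' \<in> carrier (F j) \<Longrightarrow>
    bright (M i j) m (g \<oplus>\<^bsub>F j\<^esub> g') = bright (M i j) m g \<oplus>\<^bsub>M i j\<^esub> bright (M i j) m g'"
  and bright_bleft: "f \<in> carrier (F i) \<Longrightarrow> m \<in> carrier (M i j) \<Longrightarrow> g \<in> carrier (F j) \<Longrightarrow>
    bright (M i j) (bleft (M i j) f m) g = bleft (M i j) f (bright (M i j) m g)"
  and bleft_central: "k \<in> carrier K \<Longrightarrow> m \<in> carrier (M i j) \<Longrightarrow>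
    bleft (M i j) (k \<odot>\<^bsub>F i\<^esub> \<one>\<^bsub>F i\<^esub>) m = bright (M i j) m (k \<odot>\<^bsub>F j\<^esub> \<one>\<^bsub>F j\<^esub>)"
  and bimodule_spanned:
    "spanned_over (carrier K) (\<lambda>b k. bleft (M i j) (k \<odot>\<^bsub>F i\<^esub> \<one>\<^bsub>F i\<^esub>) b) (M i j)"
  using bimodule[of i j] by (simp_all add: fd_bimodule_def)

lemma bleft_zero: "m \<in> carrier (M i j) \<Longrightarrow> bleft (M i j) \<zero>\<^bsub>F i\<^esub> m = \<zero>\<^bsub>M i j\<^esub>"
proof -
  assume m: "m \<in> carrier (M i j)"
  then have "bleft (M i j) \<zero>\<^bsub>F i\<^esub> m \<oplus>\<^bsub>M i j\<^esub> bleft (M i j) \<zero>\<^bsub>F i\<^esub> m = bleft (M i j) \<zero>\<^bsub>F i\<^esub> m"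
    by (simp flip: bleft_add_scalar)
  then show ?thesis using m by (simp add: bleft_closed)
qed

lemma bright_zero: "m \<in> carrier (M i j) \<Longrightarrow> bright (M i j) m \<zero>\<^bsub>F j\<^esub> = \<zero>\<^bsub>M i j\<^esub>"
proof -
  assume m: "m \<in> carrier (M i j)"
  then have "bright (M i j) m \<zero>\<^bsub>F j\<^esub> \<oplus>\<^bsub>M i j\<^esub> bright (M i j) m \<zero>\<^bsub>F j\<^esub> = bright (M i j) m \<zero>\<^bsub>F j\<^esub>"
    by (simp flip: bright_add_scalar)
  then show ?thesis using m by (simp add: bright_closed)
qed

section \<open>The subgroup of tensor relations and its stability under the operations\<close>

abbreviation "PT \<equiv> pure_tensors M"
abbreviation "TR \<equiv> tensor_relations F M"
abbreviation "TA \<equiv> tensor_algebra F M"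

abbreviation tensor :: "(('n, 'b) pure_tensor \<Rightarrow>\<^sub>0 int) \<Rightarrow> bool"
  where "tensor x \<equiv> Poly_Mapping.keys x \<subseteq> PT"

lemma tensor_diff: "tensor x \<Longrightarrow> tensor y \<Longrightarrow> tensor (x - y)"
  by (rule subset_trans[OF keys_diff Un_least])

lemma tensor_add: "tensor x \<Longrightarrow> tensor y \<Longrightarrow> tensor (x + y)"
  by (rule subset_trans[OF Poly_Mapping.keys_add Un_least])

lemma tensor_extend: "tensor x \<Longrightarrow> (\<And>w. w \<in> PT \<Longrightarrow> tensor (g w)) \<Longrightarrow> tensor (frag_extend g x)"
  by (rule subset_trans[OF keys_frag_extend UN_least]) (simp add: subsetD)

lemma pure_tensor_replace:
  "u @ (i, m, j) # w \<in> PT \<Longrightarrow> m' \<in> carrier (M i j) \<Longrightarrow> u @ (i, m', j) # w \<in> PT"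
  by (auto simp: pure_tensors_def successively_append_iff successively_Cons)

lemma pure_tensor_append:
  "u \<in> PT \<Longrightarrow> w \<in> PT \<Longrightarrow> snd (snd (last u)) = fst (hd w) \<Longrightarrow> u @ w \<in> PT"
  by (auto simp: pure_tensors_def successively_append_iff)

lemma pure_tensor_mem: "w \<in> PT \<Longrightarrow> (i, m, j) \<in> set w \<Longrightarrow> m \<in> carrier (M i j)"
  by (auto simp: pure_tensors_def)

lemma relators_tensor: "r \<in> additive_relators M \<union> balancing_relators F M \<Longrightarrow> tensor r"
proof (elim UnE)
  assume "r \<in> additive_relators M"
  then obtain u i m m' j w where r: "r = frag_of (u @ (i, m \<oplus>\<^bsub>M i j\<^esub> m', j) # w)
        - frag_of (u @ (i, m, j) # w) - frag_of (u @ (i, m', j) # w)"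
    and P: "u @ (i, m, j) # w \<in> PT" and m': "m' \<in> carrier (M i j)"
    by (auto simp: additive_relators_def)
  have m: "m \<in> carrier (M i j)" using P by (rule pure_tensor_mem) simp
  show ?thesis unfolding r
    using P pure_tensor_replace[OF P m'] pure_tensor_replace[OF P B.a_closed[OF m m']]
    by (intro tensor_diff) simp_all
next
  assume "r \<in> balancing_relators F M"
  then obtain u i m f j m' l w where r: "r = frag_of (u @ (i, bright (M i j) m f, j) # (j, m', l) # w)
        - frag_of (u @ (i, m, j) # (j, bleft (M j l) f m', l) # w)"
    and P: "u @ (i, m, j) # (j, m', l) # w \<in> PT" and f: "f \<in> carrier (F j)"
    by (auto simp: balancing_relators_def)
  have m: "m \<in> carrier (M i j)" "m' \<in> carrier (M j l)" using P by (rule pure_tensor_mem; simp)+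
  have "(u @ [(i, m, j)]) @ (j, m', l) # w \<in> PT" using P by simp
  from pure_tensor_replace[OF this bleft_closed[OF f m(2)]] pure_tensor_replace[OF P bright_closed[OF m(1) f]]
  show ?thesis unfolding r by (intro tensor_diff) simp_all
qed

lemma subgroup_TR: "subgroup TR (free_Abelian_group PT)"
  unfolding tensor_relations_def
  using relators_tensor by (intro group.generate_is_subgroup group_free_Abelian_group) auto

lemma TR_tensor: "x \<in> TR \<Longrightarrow> tensor x"
  using subsetD[OF subgroup.subset[OF subgroup_TR], of x] by simp

lemma TR_zero: "0 \<in> TR"
  using subgroup.one_closed[OF subgroup_TR] by simp

lemma TR_add: "x \<in> TR \<Longrightarrow> y \<in> TR \<Longrightarrow> x + y \<in> TR"
  using subgroup.m_closed[OF subgroup_TR, of x y] by simp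

lemma TR_uminus: "x \<in> TR \<Longrightarrow> - x \<in> TR"
  using subgroup.m_inv_closed[OF subgroup_TR, of x] TR_tensor[of x] by simp

lemma TR_diff: "x \<in> TR \<Longrightarrow> y \<in> TR \<Longrightarrow> x - y \<in> TR"
  using TR_add[of x "- y"] TR_uminus[of y] by simp

lemma additive_relator:
  "u @ (i, m, j) # w \<in> PT \<Longrightarrow> m' \<in> carrier (M i j) \<Longrightarrow>
    frag_of (u @ (i, m \<oplus>\<^bsub>M i j\<^esub> m', j) # w)
        - frag_of (u @ (i, m, j) # w) - frag_of (u @ (i, m', j) # w) \<in> TR"
  unfolding tensor_relations_def
  by (rule generate.incl, rule UnI1, unfold additive_relators_def, rule CollectI)
    (intro exI conjI; (rule refl | assumption))

lemma balancing_relator: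
  "u @ (i, m, j) # (j, m', l) # w \<in> PT \<Longrightarrow> f \<in> carrier (F j) \<Longrightarrow>
    frag_of (u @ (i, bright (M i j) m f, j) # (j, m', l) # w)
        - frag_of (u @ (i, m, j) # (j, bleft (M j l) f m', l) # w) \<in> TR"
  unfolding tensor_relations_def
  by (rule generate.incl, rule UnI2, unfold balancing_relators_def, rule CollectI)
    (intro exI conjI; (rule refl | assumption))

text \<open>For the word w with a zero factor, the additivity relator of 0 + 0 is w - w - w = -
  w.\<close>

lemma zero_factor_TR: "u @ (i, m, j) # w \<in> PT \<Longrightarrow> frag_of (u @ (i, \<zero>\<^bsub>M i j\<^esub>, j) # w) \<in> TR"
  using additive_relator[OF pure_tensor_replace, of u i m j w "\<zero>\<^bsub>M i j\<^esub>" "\<zero>\<^bsub>M i j\<^esub>"]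
    TR_uminus[of "- frag_of (u @ (i, \<zero>\<^bsub>M i j\<^esub>, j) # w)"] by simp

text \<open>The relations are generated by the relators, so a homomorphism preserves them once it
  sends each relator to a relation. This is the well-definedness test for the left and right actions
  and for concatenation.\<close>

lemma frag_extend_TR:
  assumes "x \<in> TR"
    and additive: "\<And>u i m m' j w. u @ (i, m, j) # w \<in> PT \<Longrightarrow> m \<in> carrier (M i j) \<Longrightarrow> m' \<in> carrier (M i j) \<Longrightarrow>
      g (u @ (i, m \<oplus>\<^bsub>M i j\<^esub> m', j) # w) - g (u @ (i, m, j) # w) - g (u @ (i, m', j) # w) \<in> TR"
    and balancing: "\<And>u i m f j m' l w. u @ (i, m, j) # (j, m', l) # w \<in> PT \<Longrightarrow> m \<in> carrier (M i j) \<Longrightarrow>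
      m' \<in> carrier (M j l) \<Longrightarrow> f \<in> carrier (F j) \<Longrightarrow>
      g (u @ (i, bright (M i j) m f, j) # (j, m', l) # w)
        - g (u @ (i, m, j) # (j, bleft (M j l) f m', l) # w) \<in> TR"
  shows "frag_extend g x \<in> TR"
proof -
  have rel: "frag_extend g r \<in> TR" if "r \<in> additive_relators M \<union> balancing_relators F M" for r
    using that
  proof (elim UnE)
    assume "r \<in> additive_relators M"
    then obtain u i m m' j w where r: "r = frag_of (u @ (i, m \<oplus>\<^bsub>M i j\<^esub> m', j) # w)
          - frag_of (u @ (i, m, j) # w) - frag_of (u @ (i, m', j) # w)"
      and P: "u @ (i, m, j) # w \<in> PT" and m': "m' \<in> carrier (M i j)"
      by (auto simp: additive_relators_def)
    have "m \<in> carrier (M i j)" using P by (rule pure_tensor_mem) simp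
    with additive[OF P _ m'] show ?thesis by (simp add: r frag_extend_diff)
  next
    assume "r \<in> balancing_relators F M"
    then obtain u i m f j m' l w where r: "r = frag_of (u @ (i, bright (M i j) m f, j) # (j, m', l) # w)
          - frag_of (u @ (i, m, j) # (j, bleft (M j l) f m', l) # w)"
      and P: "u @ (i, m, j) # (j, m', l) # w \<in> PT" and f: "f \<in> carrier (F j)"
      by (auto simp: balancing_relators_def)
    have "m \<in> carrier (M i j)" "m' \<in> carrier (M j l)" using P by (rule pure_tensor_mem; simp)+
    with balancing[OF P _ _ f] show ?thesis by (simp add: r frag_extend_diff)
  qed
  from assms(1) show ?thesis
    unfolding tensor_relations_def
  proof (induction)
    case one
    then show ?case using TR_zero by (simp add: tensor_relations_def)
  next
    case (incl h)
    then show ?case using rel by (simp add: tensor_relations_def)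
  next
    case (inv h)
    then show ?case using rel[OF inv] relators_tensor[OF inv] TR_uminus
      by (simp add: tensor_relations_def frag_extend_minus)
  next
    case (eng h1 h2)
    then show ?case using TR_add by (simp add: tensor_relations_def frag_extend_add)
  qed
qed

text \<open>The action changes the first letter only. A relator that alters later letters is sent to
  a relator of the same kind; for one that alters the first letter, additivity of the left action,
  or its commuting with the right action, produces a relator again.\<close>

lemma tensor_left_TR:
  assumes a: "\<And>i. a i \<in> carrier (F i)" and "x \<in> TR" shows "tensor_left M a x \<in> TR"
  unfolding tensor_left_def
proof (rule frag_extend_TR[OF assms(2)], goal_cases)
  case (1 u i m m' j w)
  show ?case
  proof (cases u)
    case Nil
    have "[] @ (i, bleft (M i j) (a i) m, j) # w \<in> PT"
      using 1(1)[unfolded Nil] bleft_closed[OF a 1(2)] by (rule pure_tensor_replace)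
    from additive_relator[OF this, of "bleft (M i j) (a i) m'"] show ?thesis
      using 1 Nil by (simp add: bleft_add bleft_closed a)
  next
    case (Cons e u')
    obtain i0 m0 j0 where e: "e = (i0, m0, j0)" by (cases e)
    have m0: "m0 \<in> carrier (M i0 j0)" using 1(1) by (rule pure_tensor_mem) (simp add: Cons e)
    have "((i0, bleft (M i0 j0) (a i0) m0, j0) # u') @ (i, m, j) # w \<in> PT"
      using pure_tensor_replace[of "[]" i0 m0 j0 "u' @ (i, m, j) # w", OF _ bleft_closed[OF a m0]] 1
      by (simp add: Cons e)
    from additive_relator[OF this 1(3)] show ?thesis by (simp add: Cons e)
  qed
next
  case (2 u i m f j m' l w)
  show ?case
  proof (cases u)
    case Nil
    have "[] @ (i, bleft (M i j) (a i) m, j) # (j, m', l) # w \<in> PT"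
      using 2(1)[unfolded Nil] bleft_closed[OF a 2(2)] by (rule pure_tensor_replace)
    from balancing_relator[OF this 2(4)] show ?thesis
      using 2 Nil by (simp add: bright_bleft a)
  next
    case (Cons e u')
    obtain i0 m0 j0 where e: "e = (i0, m0, j0)" by (cases e)
    have m0: "m0 \<in> carrier (M i0 j0)" using 2(1) by (rule pure_tensor_mem) (simp add: Cons e)
    have "((i0, bleft (M i0 j0) (a i0) m0, j0) # u') @ (i, m, j) # (j, m', l) # w \<in> PT"
      using pure_tensor_replace[of "[]" i0 m0 j0 "u' @ (i, m, j) # (j, m', l) # w", OF _ bleft_closed[OF a m0]] 2
      by (simp add: Cons e)
    from balancing_relator[OF this 2(4)] show ?thesis by (simp add: Cons e)
  qed
qed

text \<open>The mirror image, with the last letter in place of the first. In a balancing relator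
  with w empty, the last letter is the one that carries the left action of f.\<close>

lemma tensor_right_TR:
  assumes a: "\<And>i. a i \<in> carrier (F i)" and "x \<in> TR" shows "tensor_right M x a \<in> TR"
  unfolding tensor_right_def
proof (rule frag_extend_TR[OF assms(2)], goal_cases)
  case (1 u i m m' j w)
  show ?case
  proof (cases w rule: rev_cases)
    case Nil
    have "u @ (i, bright (M i j) m (a j), j) # [] \<in> PT"
      using 1(1)[unfolded Nil] bright_closed[OF 1(2) a] by (rule pure_tensor_replace)
    from additive_relator[OF this, of "bright (M i j) m' (a j)"] show ?thesis
      using 1 Nil by (simp add: bright_add bright_closed a)
  next
    case (snoc w' e)
    obtain i0 m0 j0 where e: "e = (i0, m0, j0)" by (cases e)
    have m0: "m0 \<in> carrier (M i0 j0)" using 1(1) by (rule pure_tensor_mem) (simp add: snoc e)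
    have "u @ (i, m, j) # (w' @ [(i0, bright (M i0 j0) m0 (a j0), j0)]) \<in> PT"
      using pure_tensor_replace[of "u @ (i, m, j) # w'" i0 m0 j0 "[]", OF _ bright_closed[OF m0 a]] 1
      by (simp add: snoc e)
    from additive_relator[OF this 1(3)] show ?thesis by (simp add: snoc e butlast_append)
  qed
next
  case (2 u i m f j m' l w)
  show ?case
  proof (cases w rule: rev_cases)
    case Nil
    have "u @ (i, m, j) # (j, bright (M j l) m' (a l), l) # [] \<in> PT"
      using pure_tensor_replace[of "u @ [(i, m, j)]" j m' l "[]", OF _ bright_closed[OF 2(3) a]] 2
      by (simp add: Nil)
    from balancing_relator[OF this 2(4)] show ?thesis
      using 2 Nil by (simp add: bright_bleft a butlast_append)
  next
    case (snoc w' e)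
    obtain i0 m0 j0 where e: "e = (i0, m0, j0)" by (cases e)
    have m0: "m0 \<in> carrier (M i0 j0)" using 2(1) by (rule pure_tensor_mem) (simp add: snoc e)
    have "u @ (i, m, j) # (j, m', l) # (w' @ [(i0, bright (M i0 j0) m0 (a j0), j0)]) \<in> PT"
      using pure_tensor_replace[of "u @ (i, m, j) # (j, m', l) # w'" i0 m0 j0 "[]", OF _ bright_closed[OF m0 a]] 2
      by (simp add: snoc e)
    from balancing_relator[OF this 2(4)] show ?thesis by (simp add: snoc e butlast_append)
  qed
qed

lemma tensor_left_tensor:
  assumes a: "\<And>i. a i \<in> carrier (F i)" and "tensor x" shows "tensor (tensor_left M a x)"
  unfolding tensor_left_def
proof (rule tensor_extend[OF assms(2)])
  fix w assume w: "w \<in> PT"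
  then obtain i m j w' where eq: "w = (i, m, j) # w'" by (cases w) (auto simp: pure_tensors_def)
  have "m \<in> carrier (M i j)" using w by (rule pure_tensor_mem) (simp add: eq)
  with pure_tensor_replace[of "[]" i m j w' "bleft (M i j) (a i) m"] w
  show "tensor (case hd w of (i, m, j) \<Rightarrow> frag_of ((i, bleft (M i j) (a i) m, j) # tl w))"
    by (simp add: eq bleft_closed a)
qed

lemma tensor_right_tensor:
  assumes a: "\<And>i. a i \<in> carrier (F i)" and "tensor x" shows "tensor (tensor_right M x a)"
  unfolding tensor_right_def
proof (rule tensor_extend[OF assms(2)])
  fix w assume w: "w \<in> PT"
  then obtain i m j w' where eq: "w = w' @ [(i, m, j)]"
    by (cases w rule: rev_cases) (auto simp: pure_tensors_def)
  have "m \<in> carrier (M i j)" using w by (rule pure_tensor_mem) (simp add: eq)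
  with pure_tensor_replace[of w' i m j "[]" "bright (M i j) m (a j)"] w
  show "tensor (case last w of (i, m, j) \<Rightarrow> frag_of (butlast w @ [(i, bright (M i j) m (a j), j)]))"
    by (simp add: eq bright_closed a)
qed

lemma tensor_concat_tensor: "tensor x \<Longrightarrow> tensor y \<Longrightarrow> tensor (tensor_concat x y)"
  unfolding tensor_concat_def by (intro tensor_extend) (simp_all add: pure_tensor_append)

lemma tensor_concat_diff_left: "tensor_concat (x - x') y = tensor_concat x y - tensor_concat x' y"
  by (simp add: tensor_concat_def frag_extend_diff)

lemma tensor_concat_diff_right: "tensor_concat x (y - y') = tensor_concat x y - tensor_concat x y'"
  by (simp add: tensor_concat_def frag_extend_diff frag_extend_diff_fun)

lemma tensor_concat_zero [simp]: "tensor_concat 0 y = 0" "tensor_concat x 0 = 0"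
  using tensor_concat_diff_left[of 0 0] tensor_concat_diff_right[of x 0 0] by simp_all

text \<open>By additivity in y it suffices to append a single word v. All words of a relator have
  the same vertex sequence, so either all of them can be followed by v, which gives a longer
  relator, or all products vanish.\<close>

lemma tensor_concat_TR_left:
  assumes x: "x \<in> TR" and "tensor y" shows "tensor_concat x y \<in> TR"
  using assms(2)
proof (induction y rule: frag_induction)
  case zero
  show ?case by (simp add: TR_zero)
next
  case (one v)
  have "frag_extend (\<lambda>u. if snd (snd (last u)) = fst (hd v) then frag_of (u @ v) else 0) x \<in> TR"
  proof (rule frag_extend_TR[OF x], goal_cases)
    case (1 u i m m' j w)
    show ?case
    proof (cases "snd (snd (last ((i, m, j) # w))) = fst (hd v)")
      case True
      have "u @ (i, m, j) # w @ v \<in> PT" using pure_tensor_append[OF 1(1) one] True by simp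
      from additive_relator[OF this 1(3)] show ?thesis using True by (cases "w = []") auto
    next
      case False
      then show ?thesis by (cases "w = []") (auto simp: TR_zero)
    qed
  next
    case (2 u i m f j m' l w)
    show ?case
    proof (cases "snd (snd (last ((j, m', l) # w))) = fst (hd v)")
      case True
      have "u @ (i, m, j) # (j, m', l) # w @ v \<in> PT" using pure_tensor_append[OF 2(1) one] True by simp
      from balancing_relator[OF this 2(4)] show ?thesis using True by (cases "w = []") auto
    next
      case False
      then show ?thesis by (cases "w = []") (auto simp: TR_zero)
    qed
  qed
  then show ?case by (simp add: tensor_concat_def)
next
  case (diff a b)
  then show ?case by (simp add: tensor_concat_diff_right TR_diff)
qed

lemma tensor_concat_TR_right:
  assumes "tensor x" and y: "y \<in> TR" shows "tensor_concat x y \<in> TR"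
  using assms(1)
proof (induction x rule: frag_induction)
  case zero
  show ?case by (simp add: TR_zero)
next
  case (one v)
  then have ne: "v \<noteq> []" by (auto simp: pure_tensors_def)
  have "frag_extend (\<lambda>w. if snd (snd (last v)) = fst (hd w) then frag_of (v @ w) else 0) y \<in> TR"
  proof (rule frag_extend_TR[OF y], goal_cases)
    case (1 u i m m' j w)
    show ?case
    proof (cases "snd (snd (last v)) = fst (hd (u @ [(i, m, j)]))")
      case True
      have "(v @ u) @ (i, m, j) # w \<in> PT"
        using pure_tensor_append[OF one 1(1)] True by (cases u) auto
      from additive_relator[OF this 1(3)] show ?thesis using True by (cases u) auto
    next
      case False
      then show ?thesis by (cases u) (auto simp: TR_zero)
    qed
  next
    case (2 u i m f j m' l w)
    show ?case
    proof (cases "snd (snd (last v)) = fst (hd (u @ [(i, m, j)]))")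
      case True
      have "(v @ u) @ (i, m, j) # (j, m', l) # w \<in> PT"
        using pure_tensor_append[OF one 2(1)] True by (cases u) auto
      from balancing_relator[OF this 2(4)] show ?thesis using True by (cases u) auto
    next
      case False
      then show ?thesis by (cases u) (auto simp: TR_zero)
    qed
  qed
  then show ?case by (simp add: tensor_concat_def)
next
  case (diff a b)
  then show ?case by (simp add: tensor_concat_diff_left TR_diff)
qed

section \<open>Elements and operations of the tensor algebra\<close>

definition tclass :: "(('n, 'b) pure_tensor \<Rightarrow>\<^sub>0 int) \<Rightarrow> (('n, 'b) pure_tensor \<Rightarrow>\<^sub>0 int) set"
  where "tclass x = {r + x | r. r \<in> TR}"

abbreviation unit_family :: "'k \<Rightarrow> 'n \<Rightarrow> 'f"
  where "unit_family k \<equiv> \<lambda>i. k \<odot>\<^bsub>F i\<^esub> \<one>\<^bsub>F i\<^esub>"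

definition scalar :: "'k \<Rightarrow> ('n, 'f, 'b) tensor"
  where "scalar k = (unit_family k, tclass 0)"

lemma tclass_eqI: "x - y \<in> TR \<Longrightarrow> tclass x = tclass y"
proof -
  assume xy: "x - y \<in> TR"
  have "r + x \<in> tclass y" if "r \<in> TR" for r
  proof -
    have "r + x = (r + (x - y)) + y" by simp
    then show ?thesis using TR_add[OF that xy] unfolding tclass_def by blast
  qed
  moreover have "r + y \<in> tclass x" if "r \<in> TR" for r
  proof -
    have "r + y = (r - (x - y)) + x" by simp
    then show ?thesis using TR_diff[OF that xy] unfolding tclass_def by blast
  qed
  ultimately show ?thesis unfolding tclass_def by blast
qed

lemma tclass_zero: "tclass 0 = TR"
  by (auto simp: tclass_def)

lemma carrier_positive_tensors: "carrier (positive_tensors F M) = {tclass x | x. tensor x}"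
proof -
  have "TR #>\<^bsub>free_Abelian_group PT\<^esub> x = tclass x" for x
    by (auto simp: r_coset_def tclass_def)
  then show ?thesis by (auto simp: positive_tensors_def FactGroup_def RCOSETS_def)
qed

lemma one_positive_tensors: "\<one>\<^bsub>positive_tensors F M\<^esub> = tclass 0"
  by (simp add: positive_tensors_def FactGroup_def tclass_zero)

lemma mult_positive_tensors: "tclass x \<otimes>\<^bsub>positive_tensors F M\<^esub> tclass y = tclass (x + y)"
proof -
  have "r + x + (s + y) \<in> tclass (x + y)" if "r \<in> TR" "s \<in> TR" for r s
  proof -
    have "r + x + (s + y) = (r + s) + (x + y)" by simp
    then show ?thesis using TR_add[OF that] unfolding tclass_def by blast
  qed
  moreover have "\<exists>r s. r \<in> TR \<and> s \<in> TR \<and> t + (x + y) = r + x + (s + y)" if "t \<in> TR" for t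
    using that TR_zero by (intro exI[of _ t] exI[of _ 0]) (simp add: algebra_simps)
  ultimately show ?thesis
    by (fastforce simp: positive_tensors_def FactGroup_def set_mult_def tclass_def)
qed

lemma carrier_TA: "carrier TA = {(a, tclass x) | a x. (\<forall>i. a i \<in> carrier (F i)) \<and> tensor x}"
  by (auto simp: tensor_algebra_def carrier_positive_tensors)

lemma add_TA: "(a, tclass x) \<oplus>\<^bsub>TA\<^esub> (b, tclass y) = (\<lambda>i. a i \<oplus>\<^bsub>F i\<^esub> b i, tclass (x + y))"
  by (simp add: tensor_algebra_def mult_positive_tensors)

lemma one_TA: "\<one>\<^bsub>TA\<^esub> = (\<lambda>i. \<one>\<^bsub>F i\<^esub>, tclass 0)"
  by (simp add: tensor_algebra_def one_positive_tensors)

lemma tensor_concat_add_left: "tensor_concat (x + x') y = tensor_concat x y + tensor_concat x' y"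
  by (simp add: tensor_concat_def frag_extend_add)

lemma tensor_concat_add_right: "tensor_concat x (y + y') = tensor_concat x y + tensor_concat x y'"
  using tensor_concat_diff_right[of x "y + y'" y'] by (simp add: algebra_simps)

text \<open>The product in \<open>tensor_algebra\<close> collects the values over all
  representatives. Replacing x and y by r + x and s + y, with relations r and s, changes the value
  by a s + r b + r (s + y) + x s, a sum of relations; so the collection is a single class.\<close>

lemma mult_TA:
  assumes a: "\<And>i. a i \<in> carrier (F i)" and b: "\<And>i. b i \<in> carrier (F i)"
    and x: "tensor x" and y: "tensor y"
  shows "(a, tclass x) \<otimes>\<^bsub>TA\<^esub> (b, tclass y) =
    (\<lambda>i. a i \<otimes>\<^bsub>F i\<^esub> b i, tclass (tensor_left M a y + tensor_right M x b + tensor_concat x y))"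
proof -
  let ?z = "\<lambda>x y. tensor_left M a y + tensor_right M x b + tensor_concat x y"
  have left: "tensor_left M a (s + y) = tensor_left M a s + tensor_left M a y" for s
    by (simp add: tensor_left_def frag_extend_add)
  have right: "tensor_right M (r + x) b = tensor_right M r b + tensor_right M x b" for r
    by (simp add: tensor_right_def frag_extend_add)
  have concat: "tensor_concat (r + x) (s + y) =
      tensor_concat r (s + y) + tensor_concat x s + tensor_concat x y" for r s
    by (simp add: tensor_concat_add_left tensor_concat_add_right[of x])
  have diff: "?z (r + x) (s + y) - ?z x y \<in> TR" if r: "r \<in> TR" and s: "s \<in> TR" for r s
  proof -
    have "?z (r + x) (s + y) - ?z x y = tensor_left M a s + tensor_right M r b
        + tensor_concat r (s + y) + tensor_concat x s"
      by (simp add: left right concat)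
    then show ?thesis
      using tensor_left_TR[OF a s] tensor_right_TR[OF b r] tensor_concat_TR_right[OF x s]
        tensor_concat_TR_left[OF r tensor_add[OF TR_tensor[OF s] y]]
      by (simp add: TR_add)
  qed
  have "{?z x' y' + t | x' y' t. x' \<in> tclass x \<and> y' \<in> tclass y \<and> t \<in> TR} = tclass (?z x y)"
  proof (intro equalityI subsetI)
    fix v assume "v \<in> {?z x' y' + t | x' y' t. x' \<in> tclass x \<and> y' \<in> tclass y \<and> t \<in> TR}"
    then obtain r s t where rst: "r \<in> TR" "s \<in> TR" "t \<in> TR" and v: "v = ?z (r + x) (s + y) + t"
      by (auto simp: tclass_def)
    have "v = (?z (r + x) (s + y) - ?z x y + t) + ?z x y" by (simp add: v)
    then show "v \<in> tclass (?z x y)" using TR_add[OF diff[OF rst(1,2)] rst(3)] unfolding tclass_def by blast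
  next
    fix v assume "v \<in> tclass (?z x y)"
    then obtain t where "t \<in> TR" "v = ?z x y + t" by (auto simp: tclass_def add.commute)
    moreover have "x \<in> tclass x" "y \<in> tclass y"
      using TR_zero by (auto simp: tclass_def intro!: exI[of _ 0])
    ultimately show "v \<in> {?z x' y' + t | x' y' t. x' \<in> tclass x \<and> y' \<in> tclass y \<and> t \<in> TR}" by blast
  qed
  then show ?thesis by (simp add: tensor_algebra_def)
qed

text \<open>In the free abelian group a word with a zero factor does not vanish; it is merely a
  relation.\<close>

lemma zero_left_TR:
  assumes "tensor x" shows "tensor_left M (\<lambda>i. \<zero>\<^bsub>F i\<^esub>) x \<in> TR"
  using assms
proof (induction x rule: frag_induction)
  case (one w)
  then obtain i m j w' where eq: "w = (i, m, j) # w'" by (cases w) (auto simp: pure_tensors_def)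
  have m: "m \<in> carrier (M i j)" using one by (rule pure_tensor_mem) (simp add: eq)
  have "[] @ (i, m, j) # w' \<in> PT" using one by (simp add: eq)
  from zero_factor_TR[OF this] show ?case by (simp add: tensor_left_def eq bleft_zero m)
qed (simp_all add: tensor_left_def TR_zero frag_extend_diff TR_diff)

lemma zero_right_TR:
  assumes "tensor x" shows "tensor_right M x (\<lambda>i. \<zero>\<^bsub>F i\<^esub>) \<in> TR"
  using assms
proof (induction x rule: frag_induction)
  case (one w)
  then obtain i m j w' where eq: "w = w' @ [(i, m, j)]"
    by (cases w rule: rev_cases) (auto simp: pure_tensors_def)
  have m: "m \<in> carrier (M i j)" using one by (rule pure_tensor_mem) (simp add: eq)
  have "w' @ (i, m, j) # [] \<in> PT" using one by (simp add: eq)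
  from zero_factor_TR[OF this] show ?case by (simp add: tensor_right_def eq bright_zero m)
qed (simp_all add: tensor_right_def TR_zero frag_extend_diff TR_diff)

lemma tensor_left_zero [simp]: "tensor_left M a 0 = 0"
  and tensor_right_zero [simp]: "tensor_right M 0 a = 0"
  by (simp_all add: tensor_left_def tensor_right_def)

lemma unit_family_closed: "k \<in> carrier K \<Longrightarrow> unit_family k i \<in> carrier (F i)"
  by simp

lemma scalar_ring_TA: "scalar_ring K TA scalar"
proof
  fix s t assume "s \<in> carrier TA" "t \<in> carrier TA"
  then obtain a x b y where s: "s = (a, tclass x)" "\<forall>i. a i \<in> carrier (F i)" "tensor x"
    and t: "t = (b, tclass y)" "\<forall>i. b i \<in> carrier (F i)" "tensor y"
    by (auto simp: carrier_TA)
  then have "tensor (x + y)" by (intro tensor_add)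
  then show "s \<oplus>\<^bsub>TA\<^esub> t \<in> carrier TA"
    using s t by (auto simp: add_TA carrier_TA)
  have "tensor (tensor_left M a y + tensor_right M x b + tensor_concat x y)"
    using s t by (intro tensor_add tensor_left_tensor tensor_right_tensor tensor_concat_tensor) simp_all
  then show "s \<otimes>\<^bsub>TA\<^esub> t \<in> carrier TA"
    using s t by (auto simp: mult_TA carrier_TA)
next
  show "scalar k \<in> carrier TA" if "k \<in> carrier K" for k
    using that by (auto simp: scalar_def carrier_TA intro!: exI[of _ 0])
  show "scalar (k \<oplus>\<^bsub>K\<^esub> l) = scalar k \<oplus>\<^bsub>TA\<^esub> scalar l" if "k \<in> carrier K" "l \<in> carrier K" for k l
    using that by (simp add: scalar_def add_TA FK.smult_l_distr)
  show "scalar (k \<otimes>\<^bsub>K\<^esub> l) = scalar k \<otimes>\<^bsub>TA\<^esub> scalar l" if "k \<in> carrier K" "l \<in> carrier K" for k l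
  proof -
    have "unit_family (k \<otimes>\<^bsub>K\<^esub> l) i = unit_family k i \<otimes>\<^bsub>F i\<^esub> unit_family l i" for i
      using scalar_ring.iota_mult[OF scalar_ring_fd_algebra[OF fd_algebra_F]] that by simp
    then show ?thesis using that by (simp add: scalar_def mult_TA)
  qed
  show "scalar \<one>\<^bsub>K\<^esub> = \<one>\<^bsub>TA\<^esub>" by (simp add: scalar_def one_TA)
qed

section \<open>Generators of the tensor algebra in degrees 0 and 1\<close>

definition positive :: "(('n, 'b) pure_tensor \<Rightarrow>\<^sub>0 int) \<Rightarrow> ('n, 'f, 'b) tensor"
  where "positive x = (\<lambda>i. \<zero>\<^bsub>F i\<^esub>, tclass x)"

abbreviation letter :: "'n \<times> 'b \<times> 'n \<Rightarrow> ('n, 'f, 'b) tensor"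
  where "letter e \<equiv> positive (frag_of [e])"

text \<open>The copy of f in the i-th factor of the degree 0 part; for f = 1 it is the idempotent of
  the vertex i.\<close>

definition vertex :: "'n \<Rightarrow> 'f \<Rightarrow> ('n, 'f, 'b) tensor"
  where "vertex i f = ((\<lambda>j. if j = i then f else \<zero>\<^bsub>F j\<^esub>), tclass 0)"

lemma letter_pure: "m \<in> carrier (M i j) \<Longrightarrow> [(i, m, j)] \<in> PT"
  by (simp add: pure_tensors_def)

lemma positive_closed: "tensor x \<Longrightarrow> positive x \<in> carrier TA"
  by (auto simp: positive_def carrier_TA)

lemma positive_add: "positive x \<oplus>\<^bsub>TA\<^esub> positive y = positive (x + y)"
  by (simp add: positive_def add_TA)

lemma positive_eqI: "x - y \<in> TR \<Longrightarrow> positive x = positive y"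
  by (simp add: positive_def tclass_eqI)

lemma positive_mult:
  assumes "tensor x" "tensor y"
  shows "positive x \<otimes>\<^bsub>TA\<^esub> positive y = positive (tensor_concat x y)"
proof -
  have "tclass (tensor_left M (\<lambda>i. \<zero>\<^bsub>F i\<^esub>) y + tensor_right M x (\<lambda>i. \<zero>\<^bsub>F i\<^esub>) + tensor_concat x y) =
      tclass (tensor_concat x y)"
    using zero_left_TR[OF assms(2)] zero_right_TR[OF assms(1)] by (intro tclass_eqI) (simp add: TR_add)
  then show ?thesis using assms by (simp add: positive_def mult_TA)
qed

lemma positive_mult_scalar:
  assumes "tensor x" "k \<in> carrier K"
  shows "positive x \<otimes>\<^bsub>TA\<^esub> scalar k = positive (tensor_right M x (unit_family k))"
  using assms by (simp add: positive_def scalar_def mult_TA)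

lemma scalar_mult_positive:
  assumes "tensor x" "k \<in> carrier K"
  shows "scalar k \<otimes>\<^bsub>TA\<^esub> positive x = positive (tensor_left M (unit_family k) x)"
  using assms by (simp add: positive_def scalar_def mult_TA)

text \<open>From the right, k acts on a letter through the algebra at j, from the left through the
  one at i, and \<open>bleft_central\<close> says that these agree. Letters thus commute with K,
  which makes their action on modules linear over K.\<close>

lemma letter_scalar:
  assumes "k \<in> carrier K" "m \<in> carrier (M i j)"
  shows "letter (i, m, j) \<otimes>\<^bsub>TA\<^esub> scalar k = letter (i, bleft (M i j) (unit_family k i) m, j)"
    "scalar k \<otimes>\<^bsub>TA\<^esub> letter (i, m, j) = letter (i, m, j) \<otimes>\<^bsub>TA\<^esub> scalar k"
  using assms
  by (simp_all add: positive_mult_scalar scalar_mult_positive letter_pure tensor_left_def tensor_right_def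
      bleft_central)

lemma letter_add:
  assumes "m \<in> carrier (M i j)" "m' \<in> carrier (M i j)"
  shows "letter (i, m \<oplus>\<^bsub>M i j\<^esub> m', j) = letter (i, m, j) \<oplus>\<^bsub>TA\<^esub> letter (i, m', j)"
  using additive_relator[of "[]" i m j "[]" m'] letter_pure[OF assms(1)] assms(2)
  by (simp add: positive_add) (intro positive_eqI, simp add: algebra_simps)

lemma vertex_closed: "f \<in> carrier (F i) \<Longrightarrow> vertex i f \<in> carrier TA"
  by (auto simp: vertex_def carrier_TA intro!: exI[of _ 0])

lemma vertex_add:
  "f \<in> carrier (F i) \<Longrightarrow> f' \<in> carrier (F i) \<Longrightarrow> vertex i (f \<oplus>\<^bsub>F i\<^esub> f') = vertex i f \<oplus>\<^bsub>TA\<^esub> vertex i f'"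
  by (auto simp: vertex_def add_TA)

lemma vertex_scalar:
  assumes "f \<in> carrier (F i)" "k \<in> carrier K"
  shows "vertex i (k \<odot>\<^bsub>F i\<^esub> f) = vertex i f \<otimes>\<^bsub>TA\<^esub> scalar k"
proof -
  have "f \<otimes>\<^bsub>F i\<^esub> (k \<odot>\<^bsub>F i\<^esub> \<one>\<^bsub>F i\<^esub>) = k \<odot>\<^bsub>F i\<^esub> f"
    using fd_algebra_F[of i] assms by (simp add: fd_algebra_def)
  then show ?thesis using assms by (auto simp: vertex_def scalar_def mult_TA)
qed

end

section \<open>Modules over the tensor algebra\<close>

locale tensor_module = tensor_setting K F M
  for K :: "'k ring" and F :: "'n::finite \<Rightarrow> ('k, 'f) module"
    and M :: "'n \<Rightarrow> 'n \<Rightarrow> ('f, 'b) bimodule" +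
  fixes V :: "(('n, 'f, 'b) tensor, 'm) rmodule"
  assumes right_module_V: "right_module TA V"
begin

sublocale scalar_module K TA scalar V
  using right_module_V
  by (intro scalar_module.intro scalar_ring_TA scalar_module_axioms.intro)

lemma letter_closed: "m \<in> carrier (M i j) \<Longrightarrow> letter (i, m, j) \<in> carrier TA"
  by (intro positive_closed) (simp add: letter_pure)

lemma ract_letter_scalar:
  assumes "x \<in> carrier V" "m \<in> carrier (M i j)" "k \<in> carrier K"
  shows "ract V x (letter (i, bleft (M i j) (unit_family k i) m, j)) = smult (ract V x (letter (i, m, j))) k"
    "ract V (smult x k) (letter (i, m, j)) = smult (ract V x (letter (i, m, j))) k"
proof -
  note closed = letter_closed[OF assms(2)] iota_closed[OF assms(3)]
  show "ract V x (letter (i, bleft (M i j) (unit_family k i) m, j)) = smult (ract V x (letter (i, m, j))) k"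
    using ract_mult[OF assms(1) closed] by (simp only: letter_scalar(1)[OF assms(3,2)])
  show "ract V (smult x k) (letter (i, m, j)) = smult (ract V x (letter (i, m, j))) k"
    using ract_mult[OF assms(1) closed] ract_mult[OF assms(1) closed(2,1)]
    by (simp only: letter_scalar(2)[OF assms(3,2)])
qed

lemma ract_letter_zero:
  assumes x: "x \<in> carrier V" shows "ract V x (letter (i, \<zero>\<^bsub>M i j\<^esub>, j)) = \<zero>\<^bsub>V\<^esub>"
proof -
  let ?l = "letter (i, \<zero>\<^bsub>M i j\<^esub>, j)"
  have l: "?l \<in> carrier TA" by (intro letter_closed) simp
  have "?l \<oplus>\<^bsub>TA\<^esub> ?l = ?l" by (simp flip: letter_add)
  then have "ract V x ?l \<oplus>\<^bsub>V\<^esub> ract V x ?l = ract V x ?l"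
    using ract_add_right[OF x l l] by simp
  then show ?thesis using ract_closed[OF x l] by simp
qed

lemma ract_vertex_zero:
  assumes x: "x \<in> carrier V" shows "ract V x (vertex i \<zero>\<^bsub>F i\<^esub>) = \<zero>\<^bsub>V\<^esub>"
proof -
  let ?l = "vertex i \<zero>\<^bsub>F i\<^esub>"
  have l: "?l \<in> carrier TA" by (intro vertex_closed) simp
  have "?l \<oplus>\<^bsub>TA\<^esub> ?l = ?l" by (simp flip: vertex_add)
  then have "ract V x ?l \<oplus>\<^bsub>V\<^esub> ract V x ?l = ract V x ?l"
    using ract_add_right[OF x l l] by simp
  then show ?thesis using ract_closed[OF x l] by simp
qed

text \<open>There are finitely many pairs of vertices and each bimodule is finite dimensional over
  K, so one finite set of letters serves all x, i and j. For fixed x, the m whose letter sends x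
  into the span are closed under sums and include all multiples of the chosen generators.\<close>

lemma letters_spanned:
  "\<exists>E. finite E \<and> (\<forall>(i, m, j)\<in>E. m \<in> carrier (M i j)) \<and>
    (\<forall>x\<in>carrier V. \<forall>i j. \<forall>m\<in>carrier (M i j).
      ract V x (letter (i, m, j)) \<in> span ((\<lambda>e. ract V x (letter e)) ` E))"
proof -
  have "\<forall>ij. \<exists>B. case ij of (i, j) \<Rightarrow> finite B \<and> B \<subseteq> carrier (M i j) \<and>
      (\<forall>m\<in>carrier (M i j). \<exists>c. (\<forall>b\<in>B. c b \<in> carrier K) \<and>
        m = (\<Oplus>\<^bsub>M i j\<^esub>b\<in>B. bleft (M i j) (unit_family (c b) i) b))"
    using bimodule_spanned by (simp add: spanned_over_def)
  from choice[OF this] obtain D where "\<forall>ij. case ij of (i, j) \<Rightarrow> finite (D ij) \<and> D ij \<subseteq> carrier (M i j) \<and>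
      (\<forall>m\<in>carrier (M i j). \<exists>c. (\<forall>b\<in>D ij. c b \<in> carrier K) \<and>
        m = (\<Oplus>\<^bsub>M i j\<^esub>b\<in>D ij. bleft (M i j) (unit_family (c b) i) b))"
    by (elim exE)
  then have D: "finite (D (i, j))" "D (i, j) \<subseteq> carrier (M i j)"
    "\<forall>m\<in>carrier (M i j). \<exists>c. (\<forall>b\<in>D (i, j). c b \<in> carrier K) \<and>
        m = (\<Oplus>\<^bsub>M i j\<^esub>b\<in>D (i, j). bleft (M i j) (unit_family (c b) i) b)" for i j
    by simp_all
  let ?E = "(\<lambda>((i, j), d). (i, d, j)) ` (SIGMA ij:UNIV. D ij)"
  have main: "ract V x (letter (i, m, j)) \<in> span ((\<lambda>e. ract V x (letter e)) ` ?E)"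
    if x: "x \<in> carrier V" and m: "m \<in> carrier (M i j)" for x i m j
  proof -
    let ?S = "span ((\<lambda>e. ract V x (letter e)) ` ?E)"
    let ?U = "{m \<in> carrier (M i j). ract V x (letter (i, m, j)) \<in> ?S}"
    obtain c where c: "\<forall>b\<in>D (i, j). c b \<in> carrier K"
      "m = (\<Oplus>\<^bsub>M i j\<^esub>b\<in>D (i, j). bleft (M i j) (unit_family (c b) i) b)"
      using bspec[OF D(3) m] by (elim exE conjE)
    have "(\<Oplus>\<^bsub>M i j\<^esub>b\<in>D (i, j). bleft (M i j) (unit_family (c b) i) b) \<in> ?U"
    proof (rule B.finsum_mem_closed[OF D(1)])
      fix d assume d: "d \<in> D (i, j)"
      have dM: "d \<in> carrier (M i j)" using D(2) d by (rule subsetD)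
      have k: "c d \<in> carrier K" using c(1) d by (rule bspec)
      have "(i, d, j) \<in> ?E" using d by (intro image_eqI[of _ _ "((i, j), d)"]) simp_all
      then have "smult (ract V x (letter (i, d, j))) (c d) \<in> ?S"
        using k by (intro span_act span_base imageI)
      then show "bleft (M i j) (unit_family (c d) i) d \<in> ?U"
        using ract_letter_scalar(1)[OF x dM k] bleft_closed[OF unit_family_closed[OF k] dM] by simp
    next
      show "\<zero>\<^bsub>M i j\<^esub> \<in> ?U" by (simp add: ract_letter_zero[OF x] span_zero)
    next
      fix m m' assume "m \<in> ?U" "m' \<in> ?U"
      then show "m \<oplus>\<^bsub>M i j\<^esub> m' \<in> ?U"
        by (simp add: letter_add ract_add_right[OF x] letter_closed span_add)
    qed simp
    then show ?thesis by (simp add: c(2))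
  qed
  have "finite ?E" using D(1) by (intro finite_imageI finite_SigmaI) auto
  moreover have "\<forall>(i, m, j)\<in>?E. m \<in> carrier (M i j)"
    using subsetD[OF D(2)] by auto
  moreover have "\<forall>x\<in>carrier V. \<forall>i j. \<forall>m\<in>carrier (M i j).
      ract V x (letter (i, m, j)) \<in> span ((\<lambda>e. ract V x (letter e)) ` ?E)"
    by (intro ballI allI main)
  ultimately show ?thesis by (intro exI[of _ ?E] conjI)
qed

text \<open>Degree 0 is a finite product of algebras that are finite dimensional over K. A family a
  is the sum of its components \<open>vertex i (a i)\<close>, split off one vertex at a time by
  induction over a finite set of vertices.\<close>

lemma degree_zero_spanned:
  "\<exists>X. finite X \<and> (\<forall>(i, f)\<in>X. f \<in> carrier (F i)) \<and>
    (\<forall>x\<in>carrier V. \<forall>a. (\<forall>i. a i \<in> carrier (F i)) \<longrightarrow>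
      ract V x (a, tclass 0) \<in> span ((\<lambda>(i, f). ract V x (vertex i f)) ` X))"
proof -
  have "\<forall>i. \<exists>B. finite B \<and> B \<subseteq> carrier (F i) \<and>
      (\<forall>f\<in>carrier (F i). \<exists>c. (\<forall>b\<in>B. c b \<in> carrier K) \<and> f = (\<Oplus>\<^bsub>F i\<^esub>b\<in>B. c b \<odot>\<^bsub>F i\<^esub> b))"
    using fd_algebra_F by (simp add: spanned_over_def fd_algebra_def)
  from choice[OF this] obtain D where "\<forall>i. finite (D i) \<and> D i \<subseteq> carrier (F i) \<and>
      (\<forall>f\<in>carrier (F i). \<exists>c. (\<forall>b\<in>D i. c b \<in> carrier K) \<and> f = (\<Oplus>\<^bsub>F i\<^esub>b\<in>D i. c b \<odot>\<^bsub>F i\<^esub> b))"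
    by (elim exE)
  then have D: "finite (D i)" "D i \<subseteq> carrier (F i)"
      "\<forall>f\<in>carrier (F i). \<exists>c. (\<forall>b\<in>D i. c b \<in> carrier K) \<and> f = (\<Oplus>\<^bsub>F i\<^esub>b\<in>D i. c b \<odot>\<^bsub>F i\<^esub> b)" for i
    by simp_all
  let ?X = "SIGMA i:UNIV. D i"
  have main: "ract V x (a, tclass 0) \<in> span ((\<lambda>(i, f). ract V x (vertex i f)) ` ?X)"
    if x: "x \<in> carrier V" and a: "\<forall>i. a i \<in> carrier (F i)" for x a
  proof -
    let ?S = "span ((\<lambda>(i, f). ract V x (vertex i f)) ` ?X)"
    have vertex: "ract V x (vertex i f) \<in> ?S" if f: "f \<in> carrier (F i)" for i f
    proof -
      let ?U = "{f \<in> carrier (F i). ract V x (vertex i f) \<in> ?S}"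
      obtain c where c: "\<forall>b\<in>D i. c b \<in> carrier K" "f = (\<Oplus>\<^bsub>F i\<^esub>b\<in>D i. c b \<odot>\<^bsub>F i\<^esub> b)"
        using bspec[OF D(3) f] by (elim exE conjE)
      have "(\<Oplus>\<^bsub>F i\<^esub>b\<in>D i. c b \<odot>\<^bsub>F i\<^esub> b) \<in> ?U"
      proof (rule F.finsum_mem_closed[OF D(1)])
        fix d assume d: "d \<in> D i"
        have dF: "d \<in> carrier (F i)" using D(2) d by (rule subsetD)
        have k: "c d \<in> carrier K" using c(1) d by (rule bspec)
        have "ract V x (vertex i d) \<in> ?S" using d by (intro span_base image_eqI[of _ _ "(i, d)"]) simp_all
        then have "smult (ract V x (vertex i d)) (c d) \<in> ?S" using k by (rule span_act)
        then show "c d \<odot>\<^bsub>F i\<^esub> d \<in> ?U"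
          using ract_mult[OF x vertex_closed[OF dF] iota_closed[OF k]] dF k by (simp add: vertex_scalar)
      next
        show "\<zero>\<^bsub>F i\<^esub> \<in> ?U" by (simp add: ract_vertex_zero[OF x] span_zero)
      next
        fix m m' assume "m \<in> ?U" "m' \<in> ?U"
        then show "m \<oplus>\<^bsub>F i\<^esub> m' \<in> ?U"
          by (simp add: vertex_add ract_add_right[OF x] vertex_closed span_add)
      qed simp
      then show ?thesis by (simp add: c(2))
    qed
    have "ract V x (\<lambda>i. if i \<in> I then a i else \<zero>\<^bsub>F i\<^esub>, tclass 0) \<in> ?S" if "finite I" for I
      using that
    proof (induction I)
      case empty
      have "scalar \<zero>\<^bsub>K\<^esub> = (\<lambda>i. \<zero>\<^bsub>F i\<^esub>, tclass 0)" by (simp add: scalar_def)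
      then show ?case using smult_zero[OF x] by (simp add: span_zero)
    next
      case (insert j I)
      have "(\<lambda>i. if i \<in> insert j I then a i else \<zero>\<^bsub>F i\<^esub>, tclass 0) =
          vertex j (a j) \<oplus>\<^bsub>TA\<^esub> (\<lambda>i. if i \<in> I then a i else \<zero>\<^bsub>F i\<^esub>, tclass 0)"
        using insert(2) a by (auto simp: vertex_def add_TA)
      moreover have "(\<lambda>i. if i \<in> I then a i else \<zero>\<^bsub>F i\<^esub>, tclass 0) \<in> carrier TA"
        using a by (auto simp: carrier_TA intro!: exI[of _ 0])
      ultimately show ?case
        using insert(3) vertex[of "a j" j] a vertex_closed[of "a j" j]
        by (simp add: ract_add_right[OF x] span_add)
    qed
    from this[of UNIV] show ?thesis by simp
  qed
  have "finite ?X" using D(1) by (intro finite_SigmaI) simp_all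
  moreover have "\<forall>(i, f)\<in>?X. f \<in> carrier (F i)" using subsetD[OF D(2)] by auto
  moreover have "\<forall>x\<in>carrier V. \<forall>a. (\<forall>i. a i \<in> carrier (F i)) \<longrightarrow>
      ract V x (a, tclass 0) \<in> span ((\<lambda>(i, f). ract V x (vertex i f)) ` ?X)"
    by (intro ballI allI impI main) simp_all
  ultimately show ?thesis by (intro exI[of _ ?X] conjI)
qed

text \<open>In the tensor algebra a word is the product of its letters, and the product acts factor
  by factor. Splitting off the last letter matches \<open>foldl\<close>, which applies it
  last.\<close>

lemma ract_positive_word:
  assumes x: "x \<in> carrier V" and "w \<in> PT"
  shows "ract V x (positive (frag_of w)) = foldl (ract V) x (map letter w)"
  using assms(2)
proof (induction w rule: rev_induct)
  case Nil
  then show ?case by (simp add: pure_tensors_def)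
next
  case (snoc e w)
  show ?case
  proof (cases "w = []")
    case False
    have w: "w \<in> PT" and e: "[e] \<in> PT" and ends: "snd (snd (last w)) = fst e"
      using snoc.prems False by (auto simp: pure_tensors_def successively_append_iff)
    have "tensor_concat (frag_of w) (frag_of [e]) = frag_of (w @ [e])"
      by (simp add: tensor_concat_def ends)
    then have "positive (frag_of (w @ [e])) = positive (frag_of w) \<otimes>\<^bsub>TA\<^esub> letter e"
      using w e by (simp add: positive_mult)
    then show ?thesis using snoc.IH[OF w] x w e by (simp add: ract_mult positive_closed)
  qed simp
qed

text \<open>
  Since the radical acts nilpotently, \<open>V\<close> is spanned over \<open>K\<close> by the products of the given
  generators with a spanning element of degree \<open>0\<close> and boundedly many spanning elements of degree \<open>1\<close>.
\<close>

lemma nilpotent_finitely_spanned: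
  assumes spanned: "spanned_over (carrier TA) (ract V) V"
    and nilpotent: "\<And>v rs. v \<in> carrier V \<Longrightarrow> length rs = N \<Longrightarrow> set rs \<subseteq> tensor_radical F M \<Longrightarrow>
      foldl (ract V) v rs = \<zero>\<^bsub>V\<^esub>"
  shows "\<exists>G. finite G \<and> G \<subseteq> carrier V \<and> carrier V \<subseteq> span G"
proof -
  obtain B where B: "finite B" "B \<subseteq> carrier V"
    and sum: "\<forall>v\<in>carrier V. \<exists>c. (\<forall>b\<in>B. c b \<in> carrier TA) \<and> v = (\<Oplus>\<^bsub>V\<^esub>b\<in>B. ract V b (c b))"
    using spanned unfolding spanned_over_def by (elim exE conjE)
  obtain E where E: "finite E" "\<forall>(i, m, j)\<in>E. m \<in> carrier (M i j)"
    and letters: "\<forall>x\<in>carrier V. \<forall>i j. \<forall>m\<in>carrier (M i j).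
      ract V x (letter (i, m, j)) \<in> span ((\<lambda>e. ract V x (letter e)) ` E)"
    using letters_spanned by (elim exE conjE)
  obtain X where X: "finite X" "\<forall>(i, f)\<in>X. f \<in> carrier (F i)"
    and degree_zero: "\<forall>x\<in>carrier V. \<forall>a. (\<forall>i. a i \<in> carrier (F i)) \<longrightarrow>
      ract V x (a, tclass 0) \<in> span ((\<lambda>(i, f). ract V x (vertex i f)) ` X)"
    using degree_zero_spanned by (elim exE conjE)
  define step where "step = (\<lambda>Y. (\<lambda>(y, e). ract V y (letter e)) ` (Y \<times> E))"
  \<comment> \<open>\<open>Y k\<close> consists of the products of a generator from B, a degree 0
    element given by X, and k letters from E.\<close>
  define Y where "Y = (\<lambda>k. (step ^^ k) ((\<lambda>(b, i, f). ract V b (vertex i f)) ` (B \<times> X)))"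
  \<comment> \<open>The bound N is included so that \<open>Y 0\<close> is part of G also when N =
    0.\<close>
  define G where "G = (\<Union>k\<le>N. Y k)"
  have Y_Suc: "Y (Suc k) = step (Y k)" for k by (simp add: Y_def)
  have bV: "b \<in> carrier V" if "b \<in> B" for b using B(2) that by (rule subsetD)
  have finite_Y: "finite (Y k)" for k
    by (induction k) (simp_all add: Y_Suc, simp_all add: Y_def step_def B(1) X(1) E(1))
  have Y_closed: "Y k \<subseteq> carrier V" for k
  proof (induction k)
    case 0
    have "ract V b (vertex i f) \<in> carrier V" if "b \<in> B" "(i, f) \<in> X" for b i f
      using X(2) that by (intro ract_closed bV vertex_closed) auto
    then show ?case by (auto simp: Y_def)
  next
    case (Suc k)
    have "ract V y (letter (i, m, j)) \<in> carrier V" if "y \<in> Y k" "(i, m, j) \<in> E" for y i m j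
      using E(2) that Suc by (intro ract_closed letter_closed) auto
    then show ?case unfolding Y_Suc by (auto simp: step_def)
  qed
  have Y_0: "(\<lambda>(i, f). ract V b (vertex i f)) ` X \<subseteq> Y 0" if "b \<in> B" for b
  proof (rule image_subsetI)
    fix z assume "z \<in> X"
    then show "(case z of (i, f) \<Rightarrow> ract V b (vertex i f)) \<in> Y 0"
      using that by (cases z) (auto simp: Y_def intro!: image_eqI[of _ _ "(b, z)"])
  qed
  have G: "finite G" "G \<subseteq> carrier V"
    using finite_Y Y_closed by (auto simp: G_def)
  \<comment> \<open>Letters act linearly over K, so it is enough to act on the elements of Z, where
    \<open>letters\<close> expresses an arbitrary letter by those in E.\<close>
  have step: "ract V v (letter (i, m, j)) \<in> span (step Z)"
    if Z: "Z \<subseteq> carrier V" and v: "v \<in> span Z" and m: "m \<in> carrier (M i j)" for Z v i m j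
    using v
  proof induction
    case span_zero
    then show ?case by (simp add: ract_zero letter_closed m action_span.span_zero)
  next
    case (span_base z)
    have "(\<lambda>e. ract V z (letter e)) ` E \<subseteq> step Z"
      using span_base by (auto simp: step_def)
    moreover have "ract V z (letter (i, m, j)) \<in> span ((\<lambda>e. ract V z (letter e)) ` E)"
      using letters m subsetD[OF Z span_base] by simp
    ultimately show ?case by (rule subsetD[OF action_span_mono])
  next
    case (span_add v w)
    then show ?case
      using subsetD[OF span_closed[OF Z]] m by (simp add: ract_add_left letter_closed action_span.span_add)
  next
    case (span_act v k)
    have "ract V (smult v k) (letter (i, m, j)) = smult (ract V v (letter (i, m, j))) k"
      using subsetD[OF span_closed[OF Z] span_act(1)] m span_act(2) by (rule ract_letter_scalar(2))
    with action_span.span_act[OF span_act.IH span_act(2)] show ?case by simp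
  qed
  have word: "foldl (ract V) b (map letter es) \<in> span (Y (length es))"
    if b: "b \<in> B" and "\<forall>(i, m, j)\<in>set es. m \<in> carrier (M i j)" for b es
    using that(2)
  proof (induction es rule: rev_induct)
    case Nil
    \<comment> \<open>\<open>Y 0\<close> holds products of b with degree 0 elements, not necessarily
      b itself; but b = b 1 and 1 has degree 0, which puts b into the span.\<close>
    have one: "ract V b (\<lambda>i. \<one>\<^bsub>F i\<^esub>, tclass 0) = b"
      using ract_one[OF bV[OF b]] by (simp add: one_TA)
    have "ract V b (\<lambda>i. \<one>\<^bsub>F i\<^esub>, tclass 0) \<in> span ((\<lambda>(i, f). ract V b (vertex i f)) ` X)"
      using degree_zero bV[OF b] by simp
    then have "ract V b (\<lambda>i. \<one>\<^bsub>F i\<^esub>, tclass 0) \<in> span (Y 0)"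
      by (rule subsetD[OF action_span_mono[OF Y_0[OF b]]])
    then show ?case by (simp add: one)
  next
    case (snoc e es)
    then show ?case using step[OF Y_closed] by (cases e) (simp add: Y_Suc)
  qed
  have short: "foldl (ract V) b (map letter es) \<in> span G"
    if b: "b \<in> B" and es: "\<forall>(i, m, j)\<in>set es. m \<in> carrier (M i j)" for b es
  proof (cases "length es < N")
    case True
    then have "Y (length es) \<subseteq> G" unfolding G_def by (intro UN_upper) simp
    then show ?thesis using word[OF b es] by (rule subsetD[OF action_span_mono])
  next
    case False
    have radical: "letter e \<in> tensor_radical F M" if "e \<in> set es" for e
      using es that letter_closed by (cases e) (auto simp: tensor_radical_def positive_def)
    have zero: "foldl (ract V) \<zero>\<^bsub>V\<^esub> rs = \<zero>\<^bsub>V\<^esub>" if "set rs \<subseteq> carrier TA" for rs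
      using that by (induction rs) (simp_all add: ract_zero)
    \<comment> \<open>The first N letters already annihilate b, and the remaining ones keep the
      result 0.\<close>
    have "foldl (ract V) b (map letter (take N es)) = \<zero>\<^bsub>V\<^esub>"
      using False radical set_take_subset by (intro nilpotent bV[OF b]) fastforce+
    moreover have "set (map letter (drop N es)) \<subseteq> carrier TA"
      using radical set_drop_subset by (fastforce simp: tensor_radical_def)
    ultimately have "foldl (ract V) b (map letter (take N es @ drop N es)) = \<zero>\<^bsub>V\<^esub>"
      using zero by (simp only: map_append foldl_append)
    then show ?thesis by (simp add: span_zero)
  qed
  \<comment> \<open>The induction rule for formal sums hands over just the claim for x and y in the
    difference case; the conjunct \<open>tensor x\<close> carries along that both are sums of pure
    tensors.\<close>
  have positive: "tensor x \<and> ract V b (positive x) \<in> span G" if b: "b \<in> B" and "tensor x" for b x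
    using that(2)
  proof (induction x rule: frag_induction)
    case zero
    have "positive 0 = scalar \<zero>\<^bsub>K\<^esub>" by (simp add: positive_def scalar_def)
    then show ?case using smult_zero[OF bV[OF b]] by (simp add: span_zero)
  next
    case (one w)
    then have "\<forall>(i, m, j)\<in>set w. m \<in> carrier (M i j)" by (auto simp: pure_tensors_def)
    from short[OF b this] show ?case by (simp add: ract_positive_word[OF bV[OF b] one] one)
  next
    case (diff x y)
    let ?p = "ract V b (positive (x - y))" and ?q = "ract V b (positive y)"
    have pos: "positive (x - y) \<in> carrier TA" "positive y \<in> carrier TA"
      using diff by (intro positive_closed tensor_diff; simp)+
    have "ract V b (positive x) = ?p \<oplus>\<^bsub>V\<^esub> ?q"
      using ract_add_right[OF bV[OF b] pos] by (simp add: positive_add)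
    moreover have "?p \<in> carrier V" "?q \<in> carrier V" using pos bV[OF b] by (simp_all add: ract_closed)
    ultimately have "?p = ract V b (positive x) \<ominus>\<^bsub>V\<^esub> ?q"
      by (simp add: a_minus_def V.a_assoc V.r_neg)
    moreover have "tensor (x - y)" using diff by (intro tensor_diff) simp_all
    ultimately show ?case using diff span_minus[OF G(2)] by simp
  qed
  have gen: "ract V b t \<in> span G" if b: "b \<in> B" and t: "t \<in> carrier TA" for b t
  proof -
    obtain a x where t: "t = (a, tclass x)" and a: "\<forall>i. a i \<in> carrier (F i)" and x: "tensor x"
      using t by (auto simp: carrier_TA)
    \<comment> \<open>Degree 0 and positive degree are treated apart: the former sends b into the
      span of \<open>Y 0\<close>, the latter is handled word by word.\<close>
    have eq: "t = (a, tclass 0) \<oplus>\<^bsub>TA\<^esub> positive x"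
      using a by (simp add: t positive_def add_TA)
    have closed: "(a, tclass 0) \<in> carrier TA" using a by (auto simp: carrier_TA intro!: exI[of _ 0])
    have "Y 0 \<subseteq> G" by (auto simp: G_def)
    with Y_0[OF b] have "(\<lambda>(i, f). ract V b (vertex i f)) ` X \<subseteq> G" by (rule subset_trans)
    moreover have "ract V b (a, tclass 0) \<in> span ((\<lambda>(i, f). ract V b (vertex i f)) ` X)"
      using degree_zero bV[OF b] a by simp
    ultimately have "ract V b (a, tclass 0) \<in> span G"
      by (rule subsetD[OF action_span_mono])
    then show ?thesis
      using conjunct2[OF positive[OF b x]] ract_add_right[OF bV[OF b] closed positive_closed[OF x]]
      by (simp add: eq span_add)
  qed
  have "v \<in> span G" if v: "v \<in> carrier V" for v
  proof -
    obtain c where c: "\<forall>b\<in>B. c b \<in> carrier TA" "v = (\<Oplus>\<^bsub>V\<^esub>b\<in>B. ract V b (c b))"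
      using bspec[OF sum v] by (elim exE conjE)
    have "(\<Oplus>\<^bsub>V\<^esub>b\<in>B. ract V b (c b)) \<in> span G"
      using gen c(1) by (intro V.finsum_mem_closed[OF B(1)] span_closed[OF G(2)] span_zero span_add) simp_all
    then show ?thesis by (simp add: c(2))
  qed
  then have "carrier V \<subseteq> span G" by (rule subsetI)
  with G show ?thesis by (intro exI[of _ G] conjI)
qed

end

section \<open>Nilpotent modules, and the correspondence for both kinds of categories\<close>

text \<open>A simple submodule is generated by a single vector w over the tensor algebra, and the
  exponent N that annihilates V annihilates it too; so it is again an object.\<close>

lemma (in tensor_setting) length_category_nmod_category:
  fixes S :: "'n \<Rightarrow> (('n, 'f, 'b) tensor, 'm) rmodule"
  assumes S: "simple_objects (nmod_category F M) S"
  shows "length_category (nmod_category F M) S"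
proof -
  interpret scalar_ring K TA scalar by (rule scalar_ring_TA)
  have objects: "V \<in> objects (nmod_category F M) \<longleftrightarrow> right_module TA V \<and>
      spanned_over (carrier TA) (ract V) V \<and>
      (\<exists>N. \<forall>v\<in>carrier V. \<forall>rs. length rs = N \<and> set rs \<subseteq> tensor_radical F M \<longrightarrow>
        foldl (ract V) v rs = \<zero>\<^bsub>V\<^esub>)" for V :: "(('n, 'f, 'b) tensor, 'm) rmodule"
    by (simp add: nmod_category_def)
  have scalars: "scalars (nmod_category F M) = carrier TA" by (simp add: nmod_category_def)
  show ?thesis
  proof (rule length_categoryI[OF scalars S])
    fix V :: "(('n, 'f, 'b) tensor, 'm) rmodule" assume V: "V \<in> objects (nmod_category F M)"
    then show "right_module TA V" by (simp add: objects)
    then interpret V: tensor_module K F M V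
      by (intro tensor_module.intro tensor_setting_axioms tensor_module_axioms.intro)
    obtain N where N: "\<forall>v\<in>carrier V. \<forall>rs. length rs = N \<and> set rs \<subseteq> tensor_radical F M \<longrightarrow>
        foldl (ract V) v rs = \<zero>\<^bsub>V\<^esub>"
      using V unfolding objects by (elim exE conjE)
    have "spanned_over (carrier TA) (ract V) V" using V by (simp add: objects)
    then show "\<exists>G. finite G \<and> G \<subseteq> carrier V \<and> carrier V \<subseteq> V.span G"
      by (rule V.nilpotent_finitely_spanned[where N = N]) (simp add: N)
    fix X assume "submodule_of (nmod_category F M) X V"
      and simple: "simple_module (carrier TA) (restrict_module V X)"
    then have X: "V.submod X" by (simp add: submodule_of_def V.submod_def scalars)
    let ?W = "restrict_module V X"
    interpret W: scalar_module K TA scalar ?W using X by (rule V.scalar_module_restrict)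
    obtain w where w: "w \<in> carrier ?W" "carrier ?W = ract ?W w ` carrier TA"
      using W.simple_module_cyclic[OF simple] by (elim bexE)
    have "\<exists>c. (\<forall>b\<in>{w}. c b \<in> carrier TA) \<and> v = (\<Oplus>\<^bsub>?W\<^esub>b\<in>{w}. ract ?W b (c b))"
      if "v \<in> carrier ?W" for v
    proof -
      obtain a where a: "a \<in> carrier TA" "v = ract ?W w a"
        using \<open>v \<in> carrier ?W\<close> unfolding w(2) by (elim imageE)
      then have "v = (\<Oplus>\<^bsub>?W\<^esub>b\<in>{w}. ract ?W b a)"
        using W.ract_closed[OF w(1) a(1)] by (simp add: W.V.finsum_insert W.V.finsum_empty)
      with a(1) show ?thesis by (intro exI[of _ "\<lambda>_. a"]) simp
    qed
    then have "spanned_over (carrier TA) (ract ?W) ?W"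
      unfolding spanned_over_def using w(1) by (intro exI[of _ "{w}"]) simp
    moreover have "\<forall>v\<in>carrier ?W. \<forall>rs. length rs = N \<and> set rs \<subseteq> tensor_radical F M \<longrightarrow>
        foldl (ract ?W) v rs = \<zero>\<^bsub>?W\<^esub>"
    proof -
      have "X \<subseteq> carrier V" using X by (auto simp: V.submod_def dest: additive_subgroup.a_subset)
      then show ?thesis using N by (auto simp: restrict_module_def)
    qed
    ultimately show "?W \<in> objects (nmod_category F M)"
      using W.right_module unfolding objects by (intro conjI exI[of _ N])
  qed
qed

theorem theorem2p8:
  fixes K :: "'k ring"
    and A :: "('k, 'a) module"
    and F :: "'n::finite \<Rightarrow> ('k, 'f) module"
    and M :: "'n \<Rightarrow> 'n \<Rightarrow> ('f, 'b) bimodule"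
    and LA :: "('a, 'm) module_category"
    and SA :: "'n \<Rightarrow> ('a, 'm) rmodule"
    and LM :: "(('n, 'f, 'b) tensor, 'm) module_category"
    and SM :: "'n \<Rightarrow> (('n, 'f, 'b) tensor, 'm) rmodule"
  shows
    "(fd_algebra K A \<and> LA = mod_category K A \<and> simple_objects LA SA \<longrightarrow>
        (\<forall>Z. nonlinear_stability_function Z \<longrightarrow>
           (generic_stability LA SA Z \<longleftrightarrow> weak_reddening_path LA SA (stability_path Z)) \<and>
           (green_stability LA SA Z \<longleftrightarrow> weak_green_path LA SA (stability_path Z)) \<and>
           (generic_stability LA SA Z \<and> codimension_one_crossings LA SA (stability_path Z)
              \<longleftrightarrow> reddening_path LA SA (stability_path Z)) \<and>
           (green_stability LA SA Z \<and> codimension_one_crossings LA SA (stability_path Z)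
              \<longleftrightarrow> green_path LA SA (stability_path Z))) \<and>
        (\<forall>\<gamma>. weak_reddening_path LA SA \<gamma> \<longrightarrow>
           (\<exists>Z. nonlinear_stability_function Z \<and>
              (\<forall>V\<in>nonzero_objects LA. \<forall>t.
                 (\<gamma> t \<in> semistability_set LA SA V \<longleftrightarrow> semistable_pair LA SA Z V t) \<and>
                 (semistable_pair LA SA Z V t \<longleftrightarrow>
                    stability_path Z t \<in> semistability_set LA SA V)))))
     \<and>
     (modulated_quiver K F M \<and> LM = nmod_category F M \<and> simple_objects LM SM \<longrightarrow>
        (\<forall>Z. nonlinear_stability_function Z \<longrightarrow>
           (generic_stability LM SM Z \<longleftrightarrow> weak_reddening_path LM SM (stability_path Z)) \<and>
           (green_stability LM SM Z \<longleftrightarrow> weak_green_path LM SM (stability_path Z)) \<and>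
           (generic_stability LM SM Z \<and> codimension_one_crossings LM SM (stability_path Z)
              \<longleftrightarrow> reddening_path LM SM (stability_path Z)) \<and>
           (green_stability LM SM Z \<and> codimension_one_crossings LM SM (stability_path Z)
              \<longleftrightarrow> green_path LM SM (stability_path Z))) \<and>
        (\<forall>\<gamma>. weak_reddening_path LM SM \<gamma> \<longrightarrow>
           (\<exists>Z. nonlinear_stability_function Z \<and>
              (\<forall>V\<in>nonzero_objects LM. \<forall>t.
                 (\<gamma> t \<in> semistability_set LM SM V \<longleftrightarrow> semistable_pair LM SM Z V t) \<and>
                 (semistable_pair LM SM Z V t \<longleftrightarrow>
                    stability_path Z t \<in> semistability_set LM SM V)))))"
  by (rule conjI; intro impI length_category.stability_correspondence; elim conjE; hypsubst;
      intro length_category_mod_category tensor_setting.length_category_nmod_category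
        tensor_setting.intro; assumption)

end
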